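(* Let $T:[0,1]\to[0,1]$ be an $S$-unimodal map with a non-flat critical point. Assume that $T$ has no periodic attractors. Then for $\mathrm{Leb}$-almost every $x\in[0,1]$ we have $\underline{\lambda}(x)\ge 0$.
   Context: $\mathrm{Leb}$ denotes Lebesgue measure on $[0,1]$. A differentiable map $T:[0,1]\to[0,1]$ is unimodal if there is a unique point $c\in(0,1)$ with $T'(c)=0$ (the critical point). A unimodal map $T$ is of class $C^3$ if $T$ is $C^1$ on $[0,1]$ and $C^3$ on $[0,1]\setminus\{c\}$. For such $T$ and $x\in(0,1)\setminus\{c\}$ put $$ST(x):=\frac{T'''(x)}{T'(x)}-\frac32\left(\frac{T''(x)}{T'(x)}\right)^2 ;$$ $T$ has negative Schwarzian derivative if $ST(x)\le 0$ for all $x\in(0,1)\setminus\{c\}$. A unimodal map $T$ is $S$-unimodal if it is of class $C^3$, has negative Schwarzian derivative, satisfies $T(0)=T(1)=0$ and has a strictly positive right derivative at $x=0$. An $S$-unimodal map $T$ has a non-flat critical point if there exist a $C^3$ diffeomorphism $\phi:\mathbb{R}\to\mathbb{R}$ with $\phi(0)=0$ and $1<l<\infty$ such that $T(x)=T(c)-|\phi(x-c)|^l$ for all $x$ close to $c$. For $x\in[0,1]$, the $\omega$-limit set $\omega(x)$ is the set of $y\in[0,1]$ for which there is a sequence $n_k\to\infty$ with $T^{n_k}(x)\to y$. For a periodic point $p\in[0,1]$ of prime period $q$, with orbit $O(p)=\{p,T(p),\dots,T^{q-1}(p)\}$, the basin of attraction is $B(O(p)):=\{x\in[0,1]:\omega(x)=O(p)\}$.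 $T$ has a periodic attractor if there is a periodic point $p\in[0,1]$ such that $B(O(p))$ has non-empty interior. The lower Lyapunov exponent at $x\in[0,1]$ is $\underline{\lambda}(x):=\liminf_{n\to\infty}\frac1n\log|(T^n)'(x)|$. *)

theory Defs
  imports "HOL-Analysis.Analysis"
begin

text \<open>
  Maps of the interval \<open>[0,1]\<close> are functions \<open>real \<Rightarrow> real\<close> whose values outside \<open>{0..1}\<close> are
  irrelevant; derivatives are therefore taken within the domain (one-sided at the endpoints).
\<close>

definition deriv_on :: "real set \<Rightarrow> (real \<Rightarrow> real) \<Rightarrow> real \<Rightarrow> real" where
  "deriv_on S f x = vector_derivative f (at x within S)"

definition Ck_on :: "nat \<Rightarrow> (real \<Rightarrow> real) \<Rightarrow> real set \<Rightarrow> bool" where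
  "Ck_on k f S \<longleftrightarrow>
     (\<forall>j<k. ((deriv_on S ^^ j) f) differentiable_on S) \<and> continuous_on S ((deriv_on S ^^ k) f)"

text \<open>
  The critical point is the only zero of the derivative in all of \<open>[0,1]\<close>, and it is interior.
\<close>

definition unimodal :: "(real \<Rightarrow> real) \<Rightarrow> bool" where
  "unimodal T \<longleftrightarrow>
     T \<in> {0..1} \<rightarrow> {0..1} \<and> T differentiable_on {0..1} \<and>
     (\<exists>c\<in>{0<..<1}. \<forall>x\<in>{0..1}. deriv_on {0..1} T x = 0 \<longleftrightarrow> x = c)"

definition critical_point :: "(real \<Rightarrow> real) \<Rightarrow> real" where
  "critical_point T = (THE c. c \<in> {0<..<1} \<and> deriv_on {0..1} T c = 0)"

definition unimodal_C3 :: "(real \<Rightarrow> real) \<Rightarrow> bool" where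
  "unimodal_C3 T \<longleftrightarrow>
     unimodal T \<and> Ck_on 1 T {0..1} \<and> Ck_on 3 T ({0..1} - {critical_point T})"

definition schwarzian :: "(real \<Rightarrow> real) \<Rightarrow> real \<Rightarrow> real" where
  "schwarzian T x =
     (deriv ^^ 3) T x / deriv T x - 3 / 2 * ((deriv ^^ 2) T x / deriv T x)\<^sup>2"

definition negative_schwarzian :: "(real \<Rightarrow> real) \<Rightarrow> bool" where
  "negative_schwarzian T \<longleftrightarrow> (\<forall>x\<in>{0<..<1} - {critical_point T}. schwarzian T x \<le> 0)"

definition S_unimodal :: "(real \<Rightarrow> real) \<Rightarrow> bool" where
  "S_unimodal T \<longleftrightarrow>
     unimodal_C3 T \<and> negative_schwarzian T \<and> T 0 = 0 \<and> T 1 = 0 \<and>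
     (\<exists>d>0. (T has_real_derivative d) (at_right 0))"

definition C3_diffeomorphism :: "(real \<Rightarrow> real) \<Rightarrow> bool" where
  "C3_diffeomorphism \<phi> \<longleftrightarrow> bij \<phi> \<and> Ck_on 3 \<phi> UNIV \<and> Ck_on 3 (inv \<phi>) UNIV"

definition nonflat_critical_point :: "(real \<Rightarrow> real) \<Rightarrow> bool" where
  "nonflat_critical_point T \<longleftrightarrow>
     (\<exists>\<phi> l. C3_diffeomorphism \<phi> \<and> \<phi> 0 = 0 \<and> 1 < l \<and>
        (\<forall>\<^sub>F x in nhds (critical_point T).
           T x = T (critical_point T) - \<bar>\<phi> (x - critical_point T)\<bar> powr l))"

definition omega_limit :: "(real \<Rightarrow> real) \<Rightarrow> real \<Rightarrow> real set" where
  "omega_limit T x =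
     {y \<in> {0..1}. \<exists>n :: nat \<Rightarrow> nat. filterlim n at_top sequentially \<and>
                    (\<lambda>k. (T ^^ n k) x) \<longlonglongrightarrow> y}"

definition has_prime_period :: "(real \<Rightarrow> real) \<Rightarrow> real \<Rightarrow> nat \<Rightarrow> bool" where
  "has_prime_period T p q \<longleftrightarrow>
     0 < q \<and> (T ^^ q) p = p \<and> (\<forall>j. 0 < j \<and> j < q \<longrightarrow> (T ^^ j) p \<noteq> p)"

definition periodic_orbit :: "(real \<Rightarrow> real) \<Rightarrow> real \<Rightarrow> nat \<Rightarrow> real set" where
  "periodic_orbit T p q = (\<lambda>j. (T ^^ j) p) ` {..<q}"

definition basin :: "(real \<Rightarrow> real) \<Rightarrow> real set \<Rightarrow> real set" where
  "basin T A = {x \<in> {0..1}. omega_limit T x = A}"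

definition has_periodic_attractor :: "(real \<Rightarrow> real) \<Rightarrow> bool" where
  "has_periodic_attractor T \<longleftrightarrow>
     (\<exists>p\<in>{0..1}. \<exists>q. has_prime_period T p q \<and> interior (basin T (periodic_orbit T p q)) \<noteq> {})"

text \<open>
  Extended logarithm of the absolute value with \<open>log 0 = -\<infinity>\<close> (the library has \<open>ln 0 = 0\<close>), needed
  at points whose orbit meets the critical point.
\<close>

definition log_abs :: "real \<Rightarrow> ereal" where
  "log_abs y = (if y = 0 then -\<infinity> else ereal (ln \<bar>y\<bar>))"

definition lower_lyapunov :: "(real \<Rightarrow> real) \<Rightarrow> real \<Rightarrow> ereal" where
  "lower_lyapunov T x =
     liminf (\<lambda>n. ereal (1 / real n) * log_abs (deriv_on {0..1} (T ^^ n) x))"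

end

theory Submission
  imports Defs
begin

text \<open>
  Write \<open>x\<^sub>j\<close> for \<open>T\<^sup>j x\<close>. A branch of \<open>T\<^sup>n\<close> is an interval whose interior contains no preimage of
  the critical point \<open>c\<close> of order below \<open>n\<close>, so that \<open>T\<^sup>n\<close> is monotone there. Two facts about branches
  carry the proof.

  Since the Schwarzian derivative is nonpositive, \<open>T\<close> expands cross-ratios on both sides of \<open>c\<close>, and hence
  every iterate does on its branches (\<open>cross_ratio_branch\<close>). In particular the derivative at an interior
  point of a branch is at least the smaller of the mean slopes towards its two ends
  (\<open>slope_le_derivative\<close>). Since there is no periodic attractor, no iterate maps an interval on which it
  is monotone into itself (\<open>trap_attractor\<close>).

  An end \<open>a\<close> of the maximal branch \<open>(a, b)\<close> of \<open>T\<^sup>n\<close> around \<open>x\<close> satisfies \<open>T\<^sup>j a = c\<close> for some \<open>j < n\<close>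
  (or is an end of \<open>[0, 1]\<close>, which is harmless). Therefore \<open>|T\<^sup>n a - T\<^sup>n x|\<close> is the length of the image under
  \<open>T\<^bsup>n-j\<^esup>\<close> of the interval between \<open>c\<close> and \<open>x\<^sub>j\<close>, and two estimates suffice to bound \<open>|(T\<^sup>n)' x|\<close> from
  below by every \<open>exp (- \<zeta> n)\<close>.

  (1) Monotone images of intervals adjacent to \<open>c\<close> contract only subexponentially (\<open>contraction\<close>). If
  \<open>T\<^sup>m\<close> is monotone on \<open>[T c - h, T c]\<close>, move to the end of the maximal branch on the side where the image
  is shorter, and follow that end until it reaches the critical value. This yields a larger \<open>h\<close> and a
  smaller \<open>m\<close>, and by the cross-ratio inequality the ratio of image length to \<open>h\<close> deteriorates at most by a
  factor \<open>6\<close>. While \<open>h\<close> is small such a step consumes a long return time of \<open>c\<close> to itself; once \<open>h\<close> is not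
  small, \<open>m\<close> is bounded, because \<open>c\<close> does not border an interval on which all iterates are monotone
  (\<open>branch_at_c1_bounded\<close>).

  (2) Almost every orbit approaches \<open>c\<close> only subexponentially (\<open>slow_approach\<close>). When the orbit of \<open>x\<close>
  comes closer to \<open>c\<close> than ever before, the branch at that time maps over a neighbourhood of \<open>c\<close> of a size
  comparable to the previous minimal distance (\<open>closest_approach\<close>); this is where non-flatness enters. By the
  cross-ratio inequality the points of the branch that then come closer by a factor \<open>4\<^bsup>-s\<^esup>\<close> fill at most a
  proportion \<open>8 * 4\<^bsup>-s\<^esup>\<close>, and this survives iteration over successive approaches (\<open>covered_total_depth\<close>).
  Close approaches are separated by long return times, so there are few of them; summing over the possible
  sets of times gives a summable bound for the measure of the points with \<open>|x\<^sub>k - c|\<close> exponentially small, and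
  the Borel-Cantelli lemma applies.
\<close>

section \<open>Negative Schwarzian derivative and the cross-ratio\<close>

text \<open>
  For increasing \<open>f\<close> this says that \<open>f\<close> does not decrease the cross-ratio
  \<open>|middle| |total| / (|left| |right|)\<close> of the points \<open>w \<le> x \<le> y \<le> z\<close>. The multiplied-out form allows
  coinciding points, and a sign change of \<open>f\<close> leaves it invariant.
\<close>

definition cross_ratio_le :: "(real \<Rightarrow> real) \<Rightarrow> real \<Rightarrow> real \<Rightarrow> real \<Rightarrow> real \<Rightarrow> bool" where
  "cross_ratio_le f w x y z \<longleftrightarrow>
     (y - x) * (z - w) * ((f x - f w) * (f z - f y)) \<le> (x - w) * (z - y) * ((f y - f x) * (f z - f w))"

text \<open>
  A nonpositive Schwarzian derivative means that \<open>1 / sqrt f'\<close> is convex: below \<open>k\<close> is this function, and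
  \<open>k1\<close>, \<open>k2\<close> are its first two derivatives.
\<close>

locale schwarzian_nonpos =
  fixes f f1 f2 f3 :: "real \<Rightarrow> real" and A B :: real
  assumes f: "\<And>x. A < x \<Longrightarrow> x < B \<Longrightarrow> (f has_real_derivative f1 x) (at x)"
    and f1: "\<And>x. A < x \<Longrightarrow> x < B \<Longrightarrow> (f1 has_real_derivative f2 x) (at x)"
    and f2: "\<And>x. A < x \<Longrightarrow> x < B \<Longrightarrow> (f2 has_real_derivative f3 x) (at x)"
    and pos: "\<And>x. A < x \<Longrightarrow> x < B \<Longrightarrow> 0 < f1 x"
    and S: "\<And>x. A < x \<Longrightarrow> x < B \<Longrightarrow> f3 x / f1 x - 3 / 2 * (f2 x / f1 x)\<^sup>2 \<le> 0"
begin

lemma increasing: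
  assumes "A < x" "x < y" "y < B" shows "f x < f y"
proof (rule DERIV_pos_imp_increasing[OF assms(2)])
  fix t assume "x \<le> t" "t \<le> y"
  then have "A < t" "t < B" using assms by auto
  then show "\<exists>d. (f has_real_derivative d) (at t) \<and> 0 < d" using f pos by blast
qed

definition k :: "real \<Rightarrow> real" where "k x = 1 / sqrt (f1 x)"
definition k1 :: "real \<Rightarrow> real" where "k1 x = - f2 x / (2 * f1 x * sqrt (f1 x))"
definition k2 :: "real \<Rightarrow> real" where "k2 x = - (f3 x / f1 x - 3 / 2 * (f2 x / f1 x)\<^sup>2) / (2 * sqrt (f1 x))"

lemma k_pos: "A < x \<Longrightarrow> x < B \<Longrightarrow> 0 < k x"
  using pos by (simp add: k_def)

lemma k2_nonneg: "A < x \<Longrightarrow> x < B \<Longrightarrow> 0 \<le> k2 x"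
  using pos[of x] S[of x] by (simp add: k2_def divide_le_0_iff)

lemma sqrt_deriv:
  assumes "A < x" "x < B"
  shows "((\<lambda>x. sqrt (f1 x)) has_real_derivative f2 x / (2 * sqrt (f1 x))) (at x)"
proof -
  have "((\<lambda>x. sqrt (f1 x)) has_real_derivative inverse (sqrt (f1 x)) / 2 * f2 x) (at x)"
    by (rule DERIV_chain2[OF DERIV_real_sqrt[OF pos[OF assms]] f1[OF assms]])
  moreover have "inverse r / 2 * d = d / (2 * r)" for r d :: real by (simp add: inverse_eq_divide)
  ultimately show ?thesis by metis
qed

lemma k1_deriv:
  assumes "A < x" "x < B" shows "(k1 has_real_derivative k2 x) (at x)"
proof -
  define s where "s = sqrt (f1 x)"
  have s: "0 < s" "f1 x = s * s" using pos[OF assms] unfolding s_def by auto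
  have "((\<lambda>x. - f2 x / (2 * f1 x * sqrt (f1 x))) has_real_derivative
      ((- f3 x) * (2 * f1 x * sqrt (f1 x)) - (- f2 x) * ((2 * f2 x) * sqrt (f1 x) + f2 x / (2 * sqrt (f1 x)) * (2 * f1 x)))
        / ((2 * f1 x * sqrt (f1 x)) * (2 * f1 x * sqrt (f1 x)))) (at x)"
    using pos[OF assms] assms
    by (intro DERIV_divide DERIV_minus DERIV_mult DERIV_cmult f2 f1 sqrt_deriv) auto
  also have "((- f3 x) * (2 * f1 x * sqrt (f1 x)) - (- f2 x) * ((2 * f2 x) * sqrt (f1 x) + f2 x / (2 * sqrt (f1 x)) * (2 * f1 x)))
        / ((2 * f1 x * sqrt (f1 x)) * (2 * f1 x * sqrt (f1 x))) = k2 x"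
    unfolding k2_def s_def[symmetric] s(2) using s(1) by (simp add: field_simps power2_eq_square)
  finally show ?thesis unfolding k1_def[abs_def] .
qed

text \<open>
  This is the infinitesimal cross-ratio inequality. For fixed \<open>x\<close>, the function
  \<open>(f t - f x) k t k x - (t - x)\<close> vanishes to second order at \<open>x\<close> and has second derivative
  \<open>(f t - f x) k2 t k x\<close>, so convexity of \<open>k\<close> makes it nonnegative on the right of \<open>x\<close>.
\<close>

lemma two_points:
  assumes xy: "A < x" "x < y" "y < B"
  shows "f1 x * f1 y * (y - x)\<^sup>2 \<le> (f y - f x)\<^sup>2"
proof -
  define \<psi> where "\<psi> t = sqrt (f1 t) + (f t - f x) * k1 t" for t
  define \<phi> where "\<phi> t = (f t - f x) * k t * k x - (t - x)" for t
  have d\<psi>: "(\<psi> has_real_derivative (f t - f x) * k2 t) (at t)" if "x \<le> t" "t \<le> y" for t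
  proof -
    have t: "A < t" "t < B" using that xy by auto
    have "(\<psi> has_real_derivative (f2 t / (2 * sqrt (f1 t)) + ((f1 t - 0) * k1 t + k2 t * (f t - f x)))) (at t)"
      unfolding \<psi>_def by (intro DERIV_add DERIV_mult DERIV_diff sqrt_deriv f k1_deriv DERIV_const t)
    moreover have "f1 t * k1 t = - (f2 t / (2 * sqrt (f1 t)))" unfolding k1_def using pos[OF t] by simp
    ultimately show ?thesis by (simp add: mult.commute)
  qed
  have f_ge: "f x \<le> f t" if "x \<le> t" "t \<le> y" for t
    using increasing[of x t] that xy by (cases "x = t") auto
  have \<psi>: "\<psi> x \<le> \<psi> t" if t: "x \<le> t" "t \<le> y" for t
  proof (rule DERIV_nonneg_imp_nondecreasing[OF t(1)])
    fix s assume s: "x \<le> s" "s \<le> t"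
    have "0 \<le> (f s - f x) * k2 s" using f_ge[of s] k2_nonneg[of s] s t xy by (intro mult_nonneg_nonneg) auto
    then show "\<exists>y. (\<psi> has_real_derivative y) (at s) \<and> 0 \<le> y" using d\<psi>[of s] s t by auto
  qed
  have x': "A < x" "x < B" using xy by auto
  have dk: "(k has_real_derivative k1 t) (at t)" if "A < t" "t < B" for t
  proof -
    define s where "s = sqrt (f1 t)"
    have s: "0 < s" "f1 t = s * s" using pos[OF that] unfolding s_def by auto
    have "((\<lambda>x. 1 / sqrt (f1 x)) has_real_derivative (0 * sqrt (f1 t) - 1 * (f2 t / (2 * sqrt (f1 t)))) / (sqrt (f1 t) * sqrt (f1 t))) (at t)"
      using pos[OF that] that by (intro DERIV_divide DERIV_const sqrt_deriv) auto
    also have "(0 * sqrt (f1 t) - 1 * (f2 t / (2 * sqrt (f1 t)))) / (sqrt (f1 t) * sqrt (f1 t)) = k1 t"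
      unfolding k1_def s_def[symmetric] s(2) using s(1) by (simp add: field_simps)
    finally show ?thesis unfolding k_def[abs_def] .
  qed
  have kx: "\<psi> x * k x = 1" unfolding \<psi>_def k_def using pos[OF x'] by simp
  have "\<phi> x \<le> \<phi> y"
  proof (rule DERIV_nonneg_imp_nondecreasing[of x y])
    fix t assume t: "x \<le> t" "t \<le> y"
    then have t': "A < t" "t < B" using xy by auto
    have "(\<phi> has_real_derivative ((((f1 t - 0) * k t + k1 t * (f t - f x)) * k x + 0 * ((f t - f x) * k t)) - (1 - 0))) (at t)"
      unfolding \<phi>_def by (intro DERIV_mult DERIV_diff f dk DERIV_const DERIV_ident t')
    moreover have "f1 t * k t = sqrt (f1 t)" unfolding k_def using pos[OF t'] real_div_sqrt[of "f1 t"] by simp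
    ultimately have "(\<phi> has_real_derivative (\<psi> t * k x - 1)) (at t)" unfolding \<psi>_def by (simp add: mult.commute)
    moreover have "\<psi> x * k x \<le> \<psi> t * k x" using \<psi>[OF t] k_pos[OF x'] by (intro mult_right_mono) auto
    ultimately show "\<exists>z. (\<phi> has_real_derivative z) (at t) \<and> 0 \<le> z" using kx by auto
  qed (use xy in auto)
  then have "y - x \<le> (f y - f x) * (k y * k x)" unfolding \<phi>_def by (simp add: mult.assoc)
  then have "(y - x)\<^sup>2 \<le> ((f y - f x) * (k y * k x))\<^sup>2" using xy by (intro power_mono) auto
  also have "\<dots> = (f y - f x)\<^sup>2 / (f1 x * f1 y)"
    unfolding k_def using pos[of x] pos[of y] xy by (simp add: power_mult_distrib power_divide field_simps)
  finally show ?thesis using pos[of x] pos[of y] xy by (simp add: field_simps)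
qed

text \<open>
  The two-point inequality is integrated twice, once over the left interval and once over the right one;
  the logarithm of the cross-ratio is the double integral of \<open>(t - s)\<^sup>-\<^sup>2\<close>.
\<close>

lemma cross_ratio:
  assumes o: "A < u" "u < v" "v < w" "w < z" "z < B"
  shows "cross_ratio_le f u v w z"
proof -
  define E where "E s t = f1 t / (f t - f s) - 1 / (t - s)" for s t
  have E_mono: "E v t \<le> E u t" if t: "v < t" "t \<le> z" for t
  proof (rule DERIV_nonpos_imp_nonincreasing[of u v])
    fix s assume s: "u \<le> s" "s \<le> v"
    then have s': "A < s" "s < t" "s < B" and t': "A < t" "t < B" using o t by auto
    have fs: "f s < f t" by (rule increasing) (use s' t' in auto)
    have "((\<lambda>s. E s t) has_real_derivative
        ((0 * (f t - f s) - f1 t * (0 - f1 s)) / ((f t - f s) * (f t - f s)) - (0 * (t - s) - 1 * (0 - 1)) / ((t - s) * (t - s)))) (at s)"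
      unfolding E_def using fs s' by (intro DERIV_diff DERIV_divide DERIV_const DERIV_ident f) auto
    moreover have "f1 s * f1 t / (f t - f s)\<^sup>2 \<le> 1 / (t - s)\<^sup>2"
      using two_points[OF s'(1,2) t'(2)] fs s' by (simp add: field_simps)
    ultimately show "\<exists>y. ((\<lambda>s. E s t) has_real_derivative y) (at s) \<and> y \<le> 0"
      by (auto simp: power2_eq_square mult.commute)
  qed (use o in auto)
  define D where "D t = (ln (f t - f u) - ln (f t - f v)) - (ln (t - u) - ln (t - v))" for t
  have "D w \<le> D z"
  proof (rule DERIV_nonneg_imp_nondecreasing[of w z])
    fix t assume t: "w \<le> t" "t \<le> z"
    then have t': "A < t" "t < B" "v < t" "u < t" using o by auto
    have ft: "f u < f t" "f v < f t" using increasing[of u t] increasing[of v t] t' o by auto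
    have "(D has_real_derivative
      ((1 / (f t - f u) * (f1 t - 0) - 1 / (f t - f v) * (f1 t - 0)) - (1 / (t - u) * (1 - 0) - 1 / (t - v) * (1 - 0)))) (at t)"
      unfolding D_def using ft t'
      by (intro DERIV_diff DERIV_chain2[OF DERIV_ln_divide] DERIV_const DERIV_ident f) auto
    moreover have "((1 / (f t - f u) * (f1 t - 0) - 1 / (f t - f v) * (f1 t - 0)) - (1 / (t - u) * (1 - 0) - 1 / (t - v) * (1 - 0))) = E u t - E v t"
      unfolding E_def by simp
    ultimately show "\<exists>y. (D has_real_derivative y) (at t) \<and> 0 \<le> y" using E_mono[of t] t t' by auto
  qed (use o in auto)
  define a where "a = f w - f u"
  define b where "b = f w - f v"
  define a' where "a' = f z - f u"
  define b' where "b' = f z - f v"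
  have abp: "0 < a" "0 < b" "0 < a'" "0 < b'" unfolding a_def b_def a'_def b'_def
    using increasing[of u w] increasing[of v w] increasing[of u z] increasing[of v z] o by auto
  have xp: "0 < w - u" "0 < w - v" "0 < z - u" "0 < z - v" using o by auto
  have "ln (a * (w - v) * (b' * (z - u))) \<le> ln (a' * (z - v) * (b * (w - u)))"
    using \<open>D w \<le> D z\<close> abp xp unfolding D_def a_def[symmetric] b_def[symmetric] a'_def[symmetric] b'_def[symmetric]
    by (simp add: ln_mult)
  then have main: "a * (w - v) * (b' * (z - u)) \<le> a' * (z - v) * (b * (w - u))"
    using abp xp by (subst (asm) ln_le_cancel_iff) (auto intro!: mult_pos_pos)
  have "a * b' = a' * b + (f v - f u) * (f z - f w)" unfolding a_def b_def a'_def b'_def by (simp add: algebra_simps)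
  moreover have "(z - v) * (w - u) = (z - u) * (w - v) + (v - u) * (z - w)" by (simp add: algebra_simps)
  moreover have "a * (w - v) * (b' * (z - u)) = (a * b') * ((w - v) * (z - u))" "a' * (z - v) * (b * (w - u)) = (a' * b) * ((z - v) * (w - u))"
    by (simp_all add: algebra_simps)
  ultimately have "(a' * b + (f v - f u) * (f z - f w)) * ((w - v) * (z - u)) \<le> (a' * b) * ((z - u) * (w - v) + (v - u) * (z - w))"
    using main by metis
  then have "(w - v) * (z - u) * ((f v - f u) * (f z - f w)) \<le> (v - u) * (z - w) * (b * a')" by (simp add: algebra_simps)
  then show ?thesis unfolding cross_ratio_le_def a'_def b_def .
qed

text \<open>The inequality extends to the closed interval by continuity, contracting the four points
  towards the midpoint.\<close>

lemma cross_ratio_closed: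
  assumes c: "continuous_on {A..B} f" and o: "A \<le> u" "u \<le> v" "v \<le> w" "w \<le> z" "z \<le> B"
  shows "cross_ratio_le f u v w z"
proof (cases "u < v \<and> v < w \<and> w < z")
  case False
  then consider "u = v" | "v = w" | "w = z" using o by linarith
  then show ?thesis
  proof cases
    case 2
    have "(v - u) * (z - v) * ((f v - f v) * (f z - f u)) = 0" by simp
    then show ?thesis using 2 by (simp add: cross_ratio_le_def)
  qed (simp_all add: cross_ratio_le_def)
next
  case True
  define m where "m = (A + B) / 2"
  have AB: "A < B" using True o by auto
  define p where "p x e = x + e * (m - x)" for x e :: real
  have pin: "A < p x e \<and> p x e < B" if "0 < e" "e < 1" "A \<le> x" "x \<le> B" for x e
  proof -
    have "p x e = (1 - e) * x + e * m" unfolding p_def by (simp add: algebra_simps)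
    moreover have "(1 - e) * A \<le> (1 - e) * x" "(1 - e) * x \<le> (1 - e) * B" using that by (auto intro: mult_left_mono)
    moreover have "e * A < e * m" "e * m < e * B" using that AB unfolding m_def by auto
    moreover have "(1 - e) * A + e * A = A" "(1 - e) * B + e * B = B" by (simp_all add: algebra_simps)
    ultimately show ?thesis by linarith
  qed
  have pord: "p x e < p y e" if "e < 1" "x < y" for x y e
  proof -
    have "p y e - p x e = (1 - e) * (y - x)" unfolding p_def by (simp add: algebra_simps)
    then show ?thesis using that by (smt (verit) mult_pos_pos)
  qed
  have lp: "((\<lambda>e. p x e) \<longlongrightarrow> x) (at_right 0)" for x
  proof -
    have "((\<lambda>e. x + e * (m - x)) \<longlongrightarrow> x + 0 * (m - x)) (at_right 0)" by (intro tendsto_intros)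
    then show ?thesis unfolding p_def by simp
  qed
  have ev: "\<forall>\<^sub>F e in at_right (0::real). 0 < e \<and> e < 1"
    using eventually_at_right_real[of 0 1] by (auto elim: eventually_mono)
  have lf: "((\<lambda>e. f (p x e)) \<longlongrightarrow> f x) (at_right 0)" if "A \<le> x" "x \<le> B" for x
    by (rule continuous_on_tendsto_compose[OF c lp]) (use that ev pin in \<open>auto elim!: eventually_mono intro: less_imp_le\<close>)
  note L = lf[of u] lf[of v] lf[of w] lf[of z]
  show ?thesis unfolding cross_ratio_le_def
  proof (rule tendsto_le[OF trivial_limit_at_right_real])
    show "((\<lambda>e. (p v e - p u e) * (p z e - p w e) * ((f (p w e) - f (p v e)) * (f (p z e) - f (p u e)))) \<longlongrightarrow>
       (v - u) * (z - w) * ((f w - f v) * (f z - f u))) (at_right 0)"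
      by (intro tendsto_intros lp L) (use o in auto)
    show "((\<lambda>e. (p w e - p v e) * (p z e - p u e) * ((f (p v e) - f (p u e)) * (f (p z e) - f (p w e)))) \<longlongrightarrow>
       (w - v) * (z - u) * ((f v - f u) * (f z - f w))) (at_right 0)"
      by (intro tendsto_intros lp L) (use o in auto)
    show "\<forall>\<^sub>F e in at_right 0. (p w e - p v e) * (p z e - p u e) * ((f (p v e) - f (p u e)) * (f (p z e) - f (p w e)))
        \<le> (p v e - p u e) * (p z e - p w e) * ((f (p w e) - f (p v e)) * (f (p z e) - f (p u e)))"
      using ev
    proof eventually_elim
      case (elim e)
      have "cross_ratio_le f (p u e) (p v e) (p w e) (p z e)"
        by (rule cross_ratio) (use pin[of e] pord[of e] elim True o in auto)
      then show ?case unfolding cross_ratio_le_def .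
    qed
  qed
qed

end

section \<open>Monotone branches of iterates\<close>

lemma ratio_le_trans:
  fixes p q p1 q1 p2 q2 :: real
  assumes "q * p1 \<le> p * q1" "q1 * p2 \<le> p1 * q2" "p1 > 0" "q1 > 0" "0 \<le> p" "0 \<le> p2"
  shows "q * p2 \<le> p * q2"
proof -
  have "q * p1 * p2 \<le> p * q1 * p2" by (rule mult_right_mono) (use assms in auto)
  also have "\<dots> = p * (q1 * p2)" by simp
  also have "\<dots> \<le> p * (p1 * q2)" by (rule mult_left_mono) (use assms in auto)
  finally have "p1 * (q * p2) \<le> p1 * (p * q2)" by (simp add: algebra_simps)
  then show ?thesis using assms by simp
qed

locale cr_unimodal =
  fixes T :: "real \<Rightarrow> real" and c :: real
  assumes c_pos: "0 < c" and c_less: "c < 1"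
    and T_range: "\<And>z. 0 \<le> z \<Longrightarrow> z \<le> 1 \<Longrightarrow> 0 \<le> T z \<and> T z \<le> 1"
    and T_0: "T 0 = 0" and T_1: "T 1 = 0"
    and T_incr: "\<And>x y. 0 \<le> x \<Longrightarrow> x < y \<Longrightarrow> y \<le> c \<Longrightarrow> T x < T y"
    and T_decr: "\<And>x y. c \<le> x \<Longrightarrow> x < y \<Longrightarrow> y \<le> 1 \<Longrightarrow> T y < T x"
    and T_cont: "continuous_on {0..1} T"
    and cross_ratio_left: "\<And>w x y z. 0 \<le> w \<Longrightarrow> w \<le> x \<Longrightarrow> x \<le> y \<Longrightarrow> y \<le> z \<Longrightarrow> z \<le> c \<Longrightarrow> cross_ratio_le T w x y z"
    and cross_ratio_right: "\<And>w x y z. c \<le> w \<Longrightarrow> w \<le> x \<Longrightarrow> x \<le> y \<Longrightarrow> y \<le> z \<Longrightarrow> z \<le> 1 \<Longrightarrow> cross_ratio_le T w x y z"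
begin

lemma T_max: "0 \<le> z \<Longrightarrow> z \<le> 1 \<Longrightarrow> z \<noteq> c \<Longrightarrow> T z < T c"
  using T_incr[of z c] T_decr[of c z] by linarith

lemma T_max_le: "0 \<le> z \<Longrightarrow> z \<le> 1 \<Longrightarrow> T z \<le> T c"
  using T_max[of z] by (cases "z = c") auto

lemma Tc_pos: "0 < T c"
  using T_max[of 0] T_0 c_pos by auto

lemma Tc_le: "T c \<le> 1"
  using T_range[of c] c_pos c_less by auto

lemma it_range: "0 \<le> z \<Longrightarrow> z \<le> 1 \<Longrightarrow> 0 \<le> (T ^^ n) z \<and> (T ^^ n) z \<le> 1"
  by (induction n) (auto simp: T_range)

lemma it_cont: "continuous_on {0..1} (T ^^ n)"
proof (induction n)
  case 0
  then show ?case by (simp add: continuous_on_id id_def)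
next
  case (Suc n)
  have "continuous_on {0..1} (\<lambda>x. T ((T ^^ n) x))"
    by (rule continuous_on_compose2[OF T_cont Suc]) (use it_range in auto)
  then show ?case by (simp add: comp_def)
qed

lemma it_add: "(T ^^ (m + n)) x = (T ^^ m) ((T ^^ n) x)"
  by (simp add: funpow_add)

lemma it_Suc: "(T ^^ Suc n) x = (T ^^ n) (T x)"
  by (simp add: funpow_swap1)

lemma it_ivt:
  assumes "0 \<le> x" "x \<le> y" "y \<le> 1"
    and "(T ^^ n) x \<le> v \<and> v \<le> (T ^^ n) y \<or> (T ^^ n) y \<le> v \<and> v \<le> (T ^^ n) x"
  obtains z where "x \<le> z" "z \<le> y" "(T ^^ n) z = v"
proof -
  have "continuous_on {x..y} (T ^^ n)"
    using it_cont by (rule continuous_on_subset) (use assms in auto)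
  then have "\<exists>z. x \<le> z \<and> z \<le> y \<and> (T ^^ n) z = v"
    using assms IVT'[of "T ^^ n" x v y] IVT2'[of "T ^^ n" y v x] by auto
  then show ?thesis using that by blast
qed

text \<open>
  Only the open interval is restricted, so that a branch may end at a preimage of \<open>c\<close>; the closed interval
  is still mapped monotonically.
\<close>

definition branch :: "nat \<Rightarrow> real \<Rightarrow> real \<Rightarrow> bool" where
  "branch n u v \<longleftrightarrow> (\<forall>j<n. \<forall>z. u < z \<and> z < v \<longrightarrow> (T ^^ j) z \<noteq> c)"

lemma branch_0 [simp]: "branch 0 u v"
  by (simp add: branch_def)

lemma branch_mono: "branch n u v \<Longrightarrow> m \<le> n \<Longrightarrow> u \<le> u' \<Longrightarrow> v' \<le> v \<Longrightarrow> branch m u' v'"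
proof -
  assume a: "branch n u v" "m \<le> n" "u \<le> u'" "v' \<le> v"
  have "(T ^^ j) z \<noteq> c" if "j < m" "u' < z" "z < v'" for j z
  proof -
    have "j < n" "u < z" "z < v" using that a by auto
    then show ?thesis using a(1) unfolding branch_def by blast
  qed
  then show ?thesis unfolding branch_def by blast
qed

lemma branch_strict:
  assumes "0 \<le> u" "v \<le> 1" "branch n u v"
  shows "(\<forall>x y. u \<le> x \<and> x < y \<and> y \<le> v \<longrightarrow> (T ^^ n) x < (T ^^ n) y) \<or>
         (\<forall>x y. u \<le> x \<and> x < y \<and> y \<le> v \<longrightarrow> (T ^^ n) y < (T ^^ n) x)"
  using assms
proof (induction n)
  case 0
  then show ?case by simp
next
  case (Suc n)
  let ?f = "T ^^ n"
  have b: "branch n u v" using Suc.prems branch_mono[of "Suc n" u v n u v] by simp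
  then have IH: "(\<forall>x y. u \<le> x \<and> x < y \<and> y \<le> v \<longrightarrow> ?f x < ?f y) \<or>
         (\<forall>x y. u \<le> x \<and> x < y \<and> y \<le> v \<longrightarrow> ?f y < ?f x)"
    using Suc by auto
  have nc: "?f z \<noteq> c" if "u < z" "z < v" for z
    using Suc.prems(3) that unfolding branch_def by auto
  have R: "0 \<le> ?f z \<and> ?f z \<le> 1" if "u \<le> z" "z \<le> v" for z
    using it_range that Suc.prems by auto
  have side: "(\<forall>z. u \<le> z \<and> z \<le> v \<longrightarrow> ?f z \<le> c) \<or> (\<forall>z. u \<le> z \<and> z \<le> v \<longrightarrow> c \<le> ?f z)"
  proof (rule ccontr)
    assume "\<not> ?thesis"
    then obtain x y where x: "u \<le> x" "x \<le> v" "?f x > c" and y: "u \<le> y" "y \<le> v" "?f y < c"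
      by force
    obtain z where z: "min x y \<le> z" "z \<le> max x y" "?f z = c"
    proof (rule it_ivt[of "min x y" "max x y" n c])
      show "?f (min x y) \<le> c \<and> c \<le> ?f (max x y) \<or> ?f (max x y) \<le> c \<and> c \<le> ?f (min x y)"
        using x y by (auto simp: min_def max_def)
    qed (use x y Suc.prems in auto)
    have "z \<noteq> x" "z \<noteq> y" using z x y by auto
    then have "u < z" "z < v" using z x y by (auto simp: min_def max_def split: if_splits)
    then show False using nc z by auto
  qed
  from side IH show ?case
  proof (elim disjE)
    assume s: "\<forall>z. u \<le> z \<and> z \<le> v \<longrightarrow> ?f z \<le> c"
      and m: "\<forall>x y. u \<le> x \<and> x < y \<and> y \<le> v \<longrightarrow> ?f x < ?f y"
    have "T (?f x) < T (?f y)" if "u \<le> x \<and> x < y \<and> y \<le> v" for x y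
      by (rule T_incr) (use s m R that in auto)
    then show ?thesis by simp
  next
    assume s: "\<forall>z. u \<le> z \<and> z \<le> v \<longrightarrow> ?f z \<le> c"
      and m: "\<forall>x y. u \<le> x \<and> x < y \<and> y \<le> v \<longrightarrow> ?f y < ?f x"
    have "T (?f y) < T (?f x)" if "u \<le> x \<and> x < y \<and> y \<le> v" for x y
      by (rule T_incr) (use s m R that in auto)
    then show ?thesis by simp
  next
    assume s: "\<forall>z. u \<le> z \<and> z \<le> v \<longrightarrow> c \<le> ?f z"
      and m: "\<forall>x y. u \<le> x \<and> x < y \<and> y \<le> v \<longrightarrow> ?f x < ?f y"
    have "T (?f y) < T (?f x)" if "u \<le> x \<and> x < y \<and> y \<le> v" for x y
      by (rule T_decr) (use s m R that in auto)
    then show ?thesis by simp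
  next
    assume s: "\<forall>z. u \<le> z \<and> z \<le> v \<longrightarrow> c \<le> ?f z"
      and m: "\<forall>x y. u \<le> x \<and> x < y \<and> y \<le> v \<longrightarrow> ?f y < ?f x"
    have "T (?f x) < T (?f y)" if "u \<le> x \<and> x < y \<and> y \<le> v" for x y
      by (rule T_decr) (use s m R that in auto)
    then show ?thesis by simp
  qed
qed

lemma branch_between:
  assumes "0 \<le> u" "v \<le> 1" "branch n u v" "u \<le> x" "x < y" "y < z" "z \<le> v"
  shows "(T ^^ n) x < (T ^^ n) y \<and> (T ^^ n) y < (T ^^ n) z \<or> (T ^^ n) z < (T ^^ n) y \<and> (T ^^ n) y < (T ^^ n) x"
  using branch_strict[OF assms(1-3)] assms(4-7) by fastforce

lemma branch_inj:
  assumes "0 \<le> u" "v \<le> 1" "branch n u v" "u \<le> x" "x \<le> v" "u \<le> y" "y \<le> v" "(T ^^ n) x = (T ^^ n) y"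
  shows "x = y"
  using branch_strict[OF assms(1-3)] assms(4-8) by (metis less_irrefl linorder_neqE_linordered_idom)

lemma branch_side:
  assumes "0 \<le> u" "u \<le> v" "v \<le> 1" "branch (Suc n) u v"
  shows "((T ^^ n) u \<le> c \<and> (T ^^ n) v \<le> c) \<or> (c \<le> (T ^^ n) u \<and> c \<le> (T ^^ n) v)"
proof (rule ccontr)
  assume neg: "\<not> ?thesis"
  then obtain z where z: "u \<le> z" "z \<le> v" "(T ^^ n) z = c"
    using it_ivt[of u v n c] assms by (metis linorder_linear)
  then have "z \<noteq> u" "z \<noteq> v" using neg by auto
  then show False using z assms(4) unfolding branch_def by (metis lessI order_le_less)
qed

lemma branch_image:
  assumes "0 \<le> u" "u \<le> v" "v \<le> 1" "branch (n + m) u v"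
  shows "branch m (min ((T ^^ n) u) ((T ^^ n) v)) (max ((T ^^ n) u) ((T ^^ n) v))"
  unfolding branch_def
proof (intro allI impI)
  fix j z assume j: "j < m" and z: "min ((T ^^ n) u) ((T ^^ n) v) < z \<and> z < max ((T ^^ n) u) ((T ^^ n) v)"
  then obtain y where y: "u \<le> y" "y \<le> v" "(T ^^ n) y = z"
    using it_ivt[of u v n z] assms by (smt (verit, best) max_def min_def)
  then have "y \<noteq> u" "y \<noteq> v" using z by (auto simp: min_def max_def split: if_splits)
  then have "u < y" "y < v" using y by auto
  then have "(T ^^ (j + n)) y \<noteq> c" using assms(4) j unfolding branch_def by auto
  then show "(T ^^ j) z \<noteq> c" using y by (simp add: it_add)
qed

lemma branch_add:
  assumes "0 \<le> u" "u \<le> v" "v \<le> 1" "branch n u v"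
    and "branch m (min ((T ^^ n) u) ((T ^^ n) v)) (max ((T ^^ n) u) ((T ^^ n) v))"
  shows "branch (n + m) u v"
  unfolding branch_def
proof (intro allI impI)
  fix j z assume j: "j < n + m" and z: "u < z \<and> z < v"
  show "(T ^^ j) z \<noteq> c"
  proof (cases "j < n")
    case True
    then show ?thesis using assms(4) z unfolding branch_def by auto
  next
    case False
    then obtain i where i: "j = i + n" "i < m" using j
      by (metis add.commute add_less_cancel_left le_add_diff_inverse not_less)
    have "min ((T ^^ n) u) ((T ^^ n) v) < (T ^^ n) z \<and> (T ^^ n) z < max ((T ^^ n) u) ((T ^^ n) v)"
      using branch_between[OF assms(1,3,4), of u z v] z by auto
    then show ?thesis using assms(5) i unfolding branch_def by (simp add: it_add)
  qed
qed

definition len :: "nat \<Rightarrow> real \<Rightarrow> real \<Rightarrow> real" where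
  "len n x y = \<bar>(T ^^ n) x - (T ^^ n) y\<bar>"

lemma len_nonneg [simp]: "0 \<le> len n x y" and len_same [simp]: "len n x x = 0"
  by (auto simp: len_def)

lemma len_commute: "len n x y = len n y x"
  by (auto simp: len_def)

lemma len_0: "len 0 x y = \<bar>x - y\<bar>"
  by (simp add: len_def)

lemma len_it: "len (m + n) x y = len m ((T ^^ n) x) ((T ^^ n) y)"
  by (simp add: len_def it_add)

lemma len_add:
  assumes "0 \<le> u" "v \<le> 1" "branch n u v" "u \<le> x" "x \<le> y" "y \<le> z" "z \<le> v"
  shows "len n x z = len n x y + len n y z"
proof (cases "x = y \<or> y = z")
  case True
  then show ?thesis by auto
next
  case False
  then show ?thesis using branch_between[OF assms(1-3), of x y z] assms unfolding len_def by auto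
qed

lemma len_pos:
  assumes "0 \<le> u" "v \<le> 1" "branch n u v" "u \<le> x" "x < y" "y \<le> v"
  shows "0 < len n x y"
  using branch_inj[OF assms(1-3), of x y] assms unfolding len_def by auto

lemma len_mono:
  assumes "0 \<le> u" "v \<le> 1" "branch n u v" "u \<le> x'" "x' \<le> x" "x \<le> y" "y \<le> y'" "y' \<le> v"
  shows "len n x y \<le> len n x' y'"
  using len_add[OF assms(1-3), of x' x y'] len_add[OF assms(1-3), of x y y'] assms
    len_nonneg[of n x' x] len_nonneg[of n y y'] by linarith

lemma len_ivt:
  assumes "0 \<le> u" "v \<le> 1" "branch n u v" "u \<le> x" "x \<le> y" "y \<le> v" "0 \<le> l" "l \<le> len n x y"
  obtains z where "x \<le> z" "z \<le> y" "len n z y = l"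
proof -
  have "\<exists>z. x \<le> z \<and> z \<le> y \<and> len n z y = l"
  proof (rule IVT2')
    show "len n y y \<le> l" "l \<le> len n x y" "x \<le> y" using assms by auto
    have "continuous_on {x..y} (T ^^ n)"
      using it_cont by (rule continuous_on_subset) (use assms in auto)
    then show "continuous_on {x..y} (\<lambda>z. len n z y)"
      unfolding len_def by (intro continuous_intros)
  qed
  then show ?thesis using that by blast
qed

text \<open>
  Cross-ratio expansion is stable under composition, and along a branch each step of the orbit takes place
  on one side of \<open>c\<close>.
\<close>

lemma cross_ratio_branch:
  assumes "0 \<le> u" "v \<le> 1" "branch n u v" "u \<le> w" "w \<le> x" "x \<le> y" "y \<le> z" "z \<le> v"
  shows "cross_ratio_le (T ^^ n) w x y z"
  using assms(3)
proof (induction n)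
  case 0
  then show ?case by (simp add: cross_ratio_le_def mult.commute mult.left_commute)
next
  case (Suc n)
  let ?f = "T ^^ n"
  have b: "branch n u v" using Suc.prems branch_mono[of "Suc n" u v n u v] by simp
  have IH: "cross_ratio_le ?f w x y z" using Suc b by simp
  show ?case
  proof (cases "w < x \<and> x < y \<and> y < z")
    case False
    then consider "w = x" | "x = y" | "y = z" using assms by linarith
    then show ?thesis
    proof cases
      case 2
      have "(x - w) * (z - x) * (((T ^^ Suc n) x - (T ^^ Suc n) x) * ((T ^^ Suc n) z - (T ^^ Suc n) w)) = 0" by simp
      then show ?thesis using 2 by (simp add: cross_ratio_le_def)
    qed (simp_all add: cross_ratio_le_def)
  next
    case lt: True
    have side: "(?f w \<le> c \<and> ?f z \<le> c) \<or> (c \<le> ?f w \<and> c \<le> ?f z)"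
      using branch_side[of w z n] branch_mono[OF Suc.prems, of "Suc n" w z] assms by auto
    have ord: "(?f w < ?f x \<and> ?f x < ?f y \<and> ?f y < ?f z) \<or> (?f z < ?f y \<and> ?f y < ?f x \<and> ?f x < ?f w)"
      using branch_between[OF assms(1,2) b, of w x y] branch_between[OF assms(1,2) b, of x y z] lt assms
      by linarith
    have ordT: "(T (?f w) < T (?f x) \<and> T (?f x) < T (?f y) \<and> T (?f y) < T (?f z)) \<or>
        (T (?f z) < T (?f y) \<and> T (?f y) < T (?f x) \<and> T (?f x) < T (?f w))"
      using branch_between[OF assms(1,2) Suc.prems, of w x y] branch_between[OF assms(1,2) Suc.prems, of x y z] lt assms
      by auto
    have R: "0 \<le> ?f t" "?f t \<le> 1" if "t \<in> {w, z}" for t using it_range[of t n] that assms by auto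
    have crT: "cross_ratio_le T (?f w) (?f x) (?f y) (?f z)"
      using ord
    proof
      assume "?f w < ?f x \<and> ?f x < ?f y \<and> ?f y < ?f z"
      then have "?f w \<le> ?f x" "?f x \<le> ?f y" "?f y \<le> ?f z" by auto
      then show ?thesis using cross_ratio_left[of "?f w" "?f x" "?f y" "?f z"] cross_ratio_right[of "?f w" "?f x" "?f y" "?f z"] side R[of w] R[of z]
        by blast
    next
      assume o: "?f z < ?f y \<and> ?f y < ?f x \<and> ?f x < ?f w"
      then have "?f z \<le> ?f y" "?f y \<le> ?f x" "?f x \<le> ?f w" by auto
      then have "cross_ratio_le T (?f z) (?f y) (?f x) (?f w)" 
        using cross_ratio_left[of "?f z" "?f y" "?f x" "?f w"] cross_ratio_right[of "?f z" "?f y" "?f x" "?f w"] side R[of w] R[of z]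
        by blast
      then show ?thesis by (simp add: cross_ratio_le_def algebra_simps)
    qed
    have pos: "0 < (?f x - ?f w) * (?f z - ?f y)" "0 < (?f y - ?f x) * (?f z - ?f w)"
      using ord by (auto simp: zero_less_mult_iff)
    have "(y - x) * (z - w) * ((T (?f x) - T (?f w)) * (T (?f z) - T (?f y)))
       \<le> (x - w) * (z - y) * ((T (?f y) - T (?f x)) * (T (?f z) - T (?f w)))"
    proof (rule ratio_le_trans)
      show "(y - x) * (z - w) * ((?f x - ?f w) * (?f z - ?f y)) \<le> (x - w) * (z - y) * ((?f y - ?f x) * (?f z - ?f w))"
        using IH by (simp add: cross_ratio_le_def)
      show "(?f y - ?f x) * (?f z - ?f w) * ((T (?f x) - T (?f w)) * (T (?f z) - T (?f y)))
        \<le> (?f x - ?f w) * (?f z - ?f y) * ((T (?f y) - T (?f x)) * (T (?f z) - T (?f w)))"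
        using crT by (simp add: cross_ratio_le_def)
      show "0 \<le> (T (?f x) - T (?f w)) * (T (?f z) - T (?f y))"
        using ordT by (auto simp: zero_le_mult_iff)
    qed (use pos lt in auto)
    then show ?thesis by (simp add: cross_ratio_le_def)
  qed
qed

text \<open>The same inequality in terms of lengths, where the orientation of the branch is irrelevant.\<close>

lemma cross_ratio_len:
  assumes "0 \<le> u" "v \<le> 1" "branch n u v" "u \<le> w" "w \<le> x" "x \<le> y" "y \<le> z" "z \<le> v"
  shows "(y - x) * (z - w) * (len n w x * len n y z) \<le> (x - w) * (z - y) * (len n x y * len n w z)"
proof -
  let ?f = "T ^^ n"
  have "cross_ratio_le ?f w x y z" by (rule cross_ratio_branch[OF assms])
  moreover have "len n w x * len n y z = (?f x - ?f w) * (?f z - ?f y)"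
     "len n x y * len n w z = (?f y - ?f x) * (?f z - ?f w)"
    using branch_strict[OF assms(1-3)]
  proof -
    have le: "(?f w \<le> ?f x \<and> ?f x \<le> ?f y \<and> ?f y \<le> ?f z) \<or> (?f z \<le> ?f y \<and> ?f y \<le> ?f x \<and> ?f x \<le> ?f w)"
      using branch_strict[OF assms(1-3)]
    proof
      assume m: "\<forall>x y. u \<le> x \<and> x < y \<and> y \<le> v \<longrightarrow> ?f x < ?f y"
      have "?f s \<le> ?f t" if "u \<le> s" "s \<le> t" "t \<le> v" for s t using m that by (cases "s = t") force+
      then show ?thesis using assms(4-8) by auto
    next
      assume m: "\<forall>x y. u \<le> x \<and> x < y \<and> y \<le> v \<longrightarrow> ?f y < ?f x"
      have "?f t \<le> ?f s" if "u \<le> s" "s \<le> t" "t \<le> v" for s t using m that by (cases "s = t") force+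
      then show ?thesis using assms(4-8) by auto
    qed
    then show "len n w x * len n y z = (?f x - ?f w) * (?f z - ?f y)"
       "len n x y * len n w z = (?f y - ?f x) * (?f z - ?f w)"
      unfolding len_def by (auto simp: abs_if algebra_simps)
  qed
  ultimately show ?thesis by (simp add: cross_ratio_le_def)
qed

lemma finite_preimage: "finite {z. 0 \<le> z \<and> z \<le> 1 \<and> (T ^^ n) z = v}"
proof (induction n arbitrary: v)
  case 0
  have "{z. 0 \<le> z \<and> z \<le> 1 \<and> (T ^^ 0) z = v} \<subseteq> {v}" by auto
  then show ?case using finite_subset by blast
next
  case (Suc n)
  have one: "finite {z. 0 \<le> z \<and> z \<le> 1 \<and> T z = y}" for y
  proof -
    have sub: "finite S" if "\<And>a b. a \<in> S \<Longrightarrow> b \<in> S \<Longrightarrow> a = b" for S :: "real set"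
    proof (cases "S = {}")
      case False
      then obtain a where "a \<in> S" by auto
      then have "S = {a}" using that by blast
      then show ?thesis by simp
    qed simp
    have "finite {z. 0 \<le> z \<and> z \<le> c \<and> T z = y}"
    proof (rule sub)
      fix a b assume "a \<in> {z. 0 \<le> z \<and> z \<le> c \<and> T z = y}" "b \<in> {z. 0 \<le> z \<and> z \<le> c \<and> T z = y}"
      then show "a = b" using T_incr[of a b] T_incr[of b a] by (cases a b rule: linorder_cases) auto
    qed
    moreover have "finite {z. c \<le> z \<and> z \<le> 1 \<and> T z = y}"
    proof (rule sub)
      fix a b assume "a \<in> {z. c \<le> z \<and> z \<le> 1 \<and> T z = y}" "b \<in> {z. c \<le> z \<and> z \<le> 1 \<and> T z = y}"
      then show "a = b" using T_decr[of a b] T_decr[of b a] by (cases a b rule: linorder_cases) auto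
    qed
    ultimately show ?thesis
      by (rule finite_subset[rotated, OF finite_UnI]) auto
  qed
  have "{z. 0 \<le> z \<and> z \<le> 1 \<and> (T ^^ Suc n) z = v} \<subseteq> (\<Union>y\<in>{z. 0 \<le> z \<and> z \<le> 1 \<and> (T ^^ n) z = v}. {z. 0 \<le> z \<and> z \<le> 1 \<and> T z = y})"
    using T_range by (auto simp: it_Suc simp del: funpow.simps)
  then show ?case using Suc one by (meson finite_UN_I finite_subset)
qed

definition precrit :: "nat \<Rightarrow> real set" where
  "precrit n = {z. 0 \<le> z \<and> z \<le> 1 \<and> (\<exists>j<n. (T ^^ j) z = c)}"

lemma finite_precrit: "finite (precrit n)"
proof -
  have "precrit n = (\<Union>j<n. {z. 0 \<le> z \<and> z \<le> 1 \<and> (T ^^ j) z = c})"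
    by (auto simp: precrit_def)
  then show ?thesis using finite_preimage by simp
qed

lemma branch_iff: "0 \<le> u \<Longrightarrow> v \<le> 1 \<Longrightarrow> branch n u v \<longleftrightarrow> {u<..<v} \<inter> precrit n = {}"
  unfolding branch_def precrit_def by fastforce

lemma precrit_mono: "m \<le> n \<Longrightarrow> precrit m \<subseteq> precrit n"
  unfolding precrit_def by (auto intro: order_less_le_trans)

text \<open>
  The maximal branch exists because there are only finitely many preimages of \<open>c\<close> of bounded order. An end
  that is not such a preimage can only be an end of the unit interval.
\<close>

lemma branch_right_end:
  assumes "0 \<le> u" "u \<le> v" "v \<le> 1" "branch n u v"
  obtains b where "v \<le> b" "b \<le> 1" "branch n u b" "b \<in> precrit n \<or> b = 1 \<and> b \<notin> precrit n"
proof -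
  define S where "S = insert 1 (precrit n \<inter> {v..})"
  have S: "finite S" "S \<noteq> {}" unfolding S_def using finite_precrit by auto
  define b where "b = Min S"
  have b: "b \<in> S" "\<And>s. s \<in> S \<Longrightarrow> b \<le> s" using S unfolding b_def by auto
  have "branch n u b"
  proof -
    have "z \<notin> precrit n" if "u < z" "z < b" for z
    proof
      assume z: "z \<in> precrit n"
      have "z \<notin> S" using b(2)[of z] that by auto
      then have "z < v" unfolding S_def using z by auto
      then show False using assms z that branch_iff[of u v n] by auto
    qed
    moreover have "b \<le> 1" using b(2) S_def by auto
    ultimately show ?thesis using branch_iff[of u b n] assms by auto
  qed
  moreover have "v \<le> b" "b \<le> 1" "b \<in> precrit n \<or> b = 1 \<and> b \<notin> precrit n"
    using b assms unfolding S_def by auto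
  ultimately show ?thesis using that by blast
qed

lemma branch_left_end:
  assumes "0 \<le> u" "u \<le> v" "v \<le> 1" "branch n u v"
  obtains a where "0 \<le> a" "a \<le> u" "branch n a v" "a \<in> precrit n \<or> a = 0 \<and> a \<notin> precrit n"
proof -
  define S where "S = insert 0 (precrit n \<inter> {..u})"
  have S: "finite S" "S \<noteq> {}" unfolding S_def using finite_precrit by auto
  define b where "b = Max S"
  have b: "b \<in> S" "\<And>s. s \<in> S \<Longrightarrow> s \<le> b" using S unfolding b_def by auto
  have "branch n b v"
  proof -
    have "z \<notin> precrit n" if "b < z" "z < v" for z
    proof
      assume z: "z \<in> precrit n"
      have "z \<notin> S" using b(2)[of z] that by auto
      then have "u < z" unfolding S_def using z by auto
      then show False using assms z that branch_iff[of u v n] by auto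
    qed
    moreover have "0 \<le> b" using b(2) S_def by auto
    ultimately show ?thesis using branch_iff[of b v n] assms by auto
  qed
  moreover have "0 \<le> b" "b \<le> u" "b \<in> precrit n \<or> b = 0 \<and> b \<notin> precrit n"
    using b assms unfolding S_def by auto
  ultimately show ?thesis using that by blast
qed

lemma precritD:
  assumes "z \<in> precrit n"
  obtains j where "j < n" "(T ^^ j) z = c" "(T ^^ Suc j) z = T c" "0 \<le> z" "z \<le> 1"
  using assms unfolding precrit_def by auto

end

section \<open>Traps are periodic attractors\<close>

locale smooth_unimodal = cr_unimodal +
  fixes T' :: "real \<Rightarrow> real"
  assumes T_deriv: "\<And>x. 0 \<le> x \<Longrightarrow> x \<le> 1 \<Longrightarrow> (T has_real_derivative T' x) (at x within {0..1})"
    and T'_c: "T' c = 0"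
begin

lemma it_deriv:
  assumes "0 \<le> x" "x \<le> 1"
  shows "((T ^^ n) has_real_derivative (\<Prod>j<n. T' ((T ^^ j) x))) (at x within {0..1})"
proof (induction n)
  case 0
  then show ?case by (simp add: id_def)
next
  case (Suc n)
  have "(T has_real_derivative T' ((T ^^ n) x)) (at ((T ^^ n) x) within (T ^^ n) ` {0..1})"
    by (rule DERIV_subset[OF T_deriv]) (use it_range assms in auto)
  from DERIV_image_chain[OF this Suc] show ?case by (simp add: mult.commute comp_def)
qed

text \<open>
  Passes from an arbitrary period to the prime period.
\<close>

lemma periodic_orbit_eq:
  assumes "1 \<le> N" "(T ^^ N) q = q"
  obtains p where "has_prime_period T q p" "periodic_orbit T q p = (\<lambda>j. (T ^^ j) q) ` {..<N}"
proof -
  define p where "p = (LEAST p. 0 < p \<and> (T ^^ p) q = q)"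
  have p: "0 < p \<and> (T ^^ p) q = q" unfolding p_def by (rule LeastI[of _ N]) (use assms in auto)
  have pN: "p \<le> N" unfolding p_def by (rule Least_le) (use assms in auto)
  have "has_prime_period T q p"
    unfolding has_prime_period_def using p not_less_Least[of _ "\<lambda>p. 0 < p \<and> (T ^^ p) q = q"] p_def by auto
  moreover have "(\<lambda>j. (T ^^ j) q) ` {..<N} \<subseteq> (\<lambda>j. (T ^^ j) q) ` {..<p}"
  proof
    fix y assume "y \<in> (\<lambda>j. (T ^^ j) q) ` {..<N}"
    then obtain j where "y = (T ^^ j) q" by auto
    then have "y = (T ^^ (j mod p)) q" using funpow_mod_eq[of p T q j] p by simp
    then show "y \<in> (\<lambda>j. (T ^^ j) q) ` {..<p}" using p by auto
  qed
  ultimately show ?thesis using that[of p] pN unfolding periodic_orbit_def by fastforce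
qed

text \<open>
  If a whole interval is attracted by \<open>q\<close> under \<open>T\<^sup>N\<close>, then each of the \<open>N\<close> residue classes of times
  converges to one point of the orbit of \<open>q\<close>, which identifies the limit set.
\<close>

lemma attractorI:
  assumes N: "1 \<le> N" "(T ^^ N) q = q" and q: "0 \<le> q" "q \<le> 1" and lr: "0 \<le> l" "l < r" "r \<le> 1"
    and lim: "\<And>y. l < y \<Longrightarrow> y < r \<Longrightarrow> (\<lambda>n. (T ^^ (N * n)) y) \<longlonglongrightarrow> q"
  shows "has_periodic_attractor T"
proof -
  obtain p where p: "has_prime_period T q p" and po: "periodic_orbit T q p = (\<lambda>j. (T ^^ j) q) ` {..<N}"
    by (rule periodic_orbit_eq[OF N])
  have om: "omega_limit T y = (\<lambda>j. (T ^^ j) q) ` {..<N}" if y: "l < y" "y < r" for y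
  proof -
    have y01: "0 \<le> y" "y \<le> 1" using y lr by auto
    have limj: "(\<lambda>n. (T ^^ (j + N * n)) y) \<longlonglongrightarrow> (T ^^ j) q" for j
    proof -
      have "(\<lambda>n. (T ^^ j) ((T ^^ (N * n)) y)) \<longlonglongrightarrow> (T ^^ j) q"
        by (rule continuous_on_tendsto_compose[OF it_cont[of j] lim[OF y]]) (use q it_range[OF y01] in auto)
      then show ?thesis by (simp add: it_add)
    qed
    show ?thesis
    proof
      show "(\<lambda>j. (T ^^ j) q) ` {..<N} \<subseteq> omega_limit T y"
      proof
        fix z assume "z \<in> (\<lambda>j. (T ^^ j) q) ` {..<N}"
        then obtain j where j: "z = (T ^^ j) q" by auto
        have "filterlim (\<lambda>n. j + N * n) at_top sequentially"
          using N(1) by (intro filterlim_subseq) (auto simp: strict_mono_def)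
        then show "z \<in> omega_limit T y"
          unfolding omega_limit_def j using limj[of j] it_range[OF q, of j] by auto
      qed
      show "omega_limit T y \<subseteq> (\<lambda>j. (T ^^ j) q) ` {..<N}"
      proof
        fix z assume "z \<in> omega_limit T y"
        then obtain nk where nk: "filterlim nk at_top sequentially" "(\<lambda>k. (T ^^ nk k) y) \<longlonglongrightarrow> z"
          unfolding omega_limit_def by auto
        show "z \<in> (\<lambda>j. (T ^^ j) q) ` {..<N}"
        proof (rule ccontr)
          assume z: "z \<notin> (\<lambda>j. (T ^^ j) q) ` {..<N}"
          define e where "e = Min ((\<lambda>j. dist z ((T ^^ j) q)) ` {..<N})"
          have e: "0 < e" "\<And>j. j < N \<Longrightarrow> e \<le> dist z ((T ^^ j) q)"
          proof -
            have "0 \<in> {..<N}" using N by simp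
            then have ne: "{..<N} \<noteq> {}" by blast
            show "0 < e" unfolding e_def using ne z by (subst Min_gr_iff) auto
            show "\<And>j. j < N \<Longrightarrow> e \<le> dist z ((T ^^ j) q)" unfolding e_def by auto
          qed
          have "\<forall>j\<in>{..<N}. \<forall>\<^sub>F n in sequentially. dist ((T ^^ (j + N * n)) y) ((T ^^ j) q) < e / 2"
            using e(1) by (intro ballI tendstoD[OF limj]) auto
          then have "\<forall>\<^sub>F n in sequentially. \<forall>j\<in>{..<N}. dist ((T ^^ (j + N * n)) y) ((T ^^ j) q) < e / 2"
            by (rule eventually_ball_finite[OF finite_lessThan])
          then obtain M where M: "\<And>n j. M \<le> n \<Longrightarrow> j < N \<Longrightarrow> dist ((T ^^ (j + N * n)) y) ((T ^^ j) q) < e / 2"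
            unfolding eventually_sequentially by auto
          have "\<forall>\<^sub>F k in sequentially. N * M \<le> nk k" using nk(1) by (simp add: filterlim_at_top)
          moreover have "\<forall>\<^sub>F k in sequentially. dist ((T ^^ nk k) y) z < e / 2" using tendstoD[OF nk(2), of "e / 2"] e by auto
          ultimately have "\<forall>\<^sub>F k in sequentially. False"
          proof eventually_elim
            case (elim k)
            define n where "n = nk k div N"
            define j where "j = nk k mod N"
            have j: "j < N" unfolding j_def using N by auto
            have "M \<le> n" unfolding n_def using elim(1) N by (simp add: less_eq_div_iff_mult_less_eq mult.commute)
            then have "dist ((T ^^ nk k) y) ((T ^^ j) q) < e / 2" using M[of n j] j unfolding n_def j_def by simp
            then show False using elim(2) e(2)[OF j] by (smt (verit) dist_commute dist_triangle field_sum_of_halves)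
          qed
          then show False by simp
        qed
      qed
    qed
  qed
  have "{l<..<r} \<subseteq> basin T (periodic_orbit T q p)" unfolding basin_def po using om lr by auto
  then have "{l<..<r} \<subseteq> interior (basin T (periodic_orbit T q p))" by (simp add: interior_maximal)
  moreover have "(l + r) / 2 \<in> {l<..<r}" using lr by auto
  ultimately show ?thesis unfolding has_periodic_attractor_def using p q by (metis atLeastAtMost_iff empty_iff subsetD)
qed

lemma it_mult: "(T ^^ (N * n)) x = ((T ^^ N) ^^ n) x"
  by (simp add: funpow_mult)

text \<open>The orbit of \<open>x\<close> is monotone and tends to a fixed point \<open>q\<close>; all points between are squeezed.\<close>

lemma increasing_trap_attractor:
  assumes N: "1 \<le> N" and uv: "0 \<le> u" "v \<le> 1" and x: "u \<le> x" "x \<le> v"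
    and inc: "\<And>y z. u \<le> y \<Longrightarrow> y < z \<Longrightarrow> z \<le> v \<Longrightarrow> (T ^^ N) y < (T ^^ N) z"
    and self: "u \<le> (T ^^ N) u" "(T ^^ N) v \<le> v"
    and neq: "(T ^^ N) x \<noteq> x"
  shows "has_periodic_attractor T"
proof -
  define g where "g = T ^^ N"
  have inc': "g y \<le> g z" if "u \<le> y" "y \<le> z" "z \<le> v" for y z
    using inc[of y z] that unfolding g_def by (cases "y = z") auto
  have gR: "u \<le> g y \<and> g y \<le> v" if "u \<le> y" "y \<le> v" for y
    using inc'[of u y] inc'[of y v] that self unfolding g_def by auto
  have itR: "u \<le> (g ^^ n) y \<and> (g ^^ n) y \<le> v" if "u \<le> y" "y \<le> v" for y n
    by (induction n) (use that gR in auto)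
  have itm: "(g ^^ n) y \<le> (g ^^ n) z" if "u \<le> y" "y \<le> z" "z \<le> v" for y z n
    by (induction n) (use that itR inc' in auto)
  have gc: "continuous_on {u..v} g" unfolding g_def using it_cont by (rule continuous_on_subset) (use uv in auto)
  have fixpt: "g q = q" if "(\<lambda>n. (g ^^ n) x) \<longlonglongrightarrow> q" "u \<le> q" "q \<le> v" for q
  proof -
    have "(\<lambda>n. g ((g ^^ n) x)) \<longlonglongrightarrow> g q"
      by (rule continuous_on_tendsto_compose[OF gc that(1)]) (use that itR x in auto)
    moreover have "(\<lambda>n. g ((g ^^ n) x)) \<longlonglongrightarrow> q" using LIMSEQ_Suc[OF that(1)] by simp
    ultimately show ?thesis by (rule LIMSEQ_unique)
  qed
  have fixit: "(g ^^ n) q = q" if "g q = q" for n q by (induction n) (use that in auto)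
  show ?thesis
  proof (cases "g x < x")
    case True
    have "decseq (\<lambda>n. (g ^^ n) x)"
    proof (rule decseq_SucI)
      show "(g ^^ Suc n) x \<le> (g ^^ n) x" for n using itm[of "g x" x n] True gR x by (simp add: funpow_swap1)
    qed
    then obtain q where q: "(\<lambda>n. (g ^^ n) x) \<longlonglongrightarrow> q" "\<And>n. q \<le> (g ^^ n) x"
      using decseq_convergent[of "\<lambda>n. (g ^^ n) x" u] itR x by auto
    have uq: "u \<le> q" using LIMSEQ_le_const[OF q(1), of u] itR x by auto
    have qx: "q < x" using q(2)[of 1] True by simp
    have gq: "g q = q" by (rule fixpt[OF q(1) uq]) (use qx x in auto)
    show ?thesis
    proof (rule attractorI[OF N, of q q x])
      fix y assume y: "q < y" "y < x"
      have "(\<lambda>n. (g ^^ n) y) \<longlonglongrightarrow> q"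
      proof (rule tendsto_sandwich[OF _ _ tendsto_const q(1)])
        show "\<forall>\<^sub>F n in sequentially. q \<le> (g ^^ n) y" using itm[of q y] fixit[OF gq] y uq x by (auto intro!: always_eventually)
        show "\<forall>\<^sub>F n in sequentially. (g ^^ n) y \<le> (g ^^ n) x" using itm[of y x] y uq x by (auto intro!: always_eventually)
      qed
      then show "(\<lambda>n. (T ^^ (N * n)) y) \<longlonglongrightarrow> q" unfolding it_mult g_def .
    qed (use gq uq qx x uv g_def in auto)
  next
    case False
    then have gx: "x < g x" using neq unfolding g_def by auto
    have "incseq (\<lambda>n. (g ^^ n) x)"
    proof (rule incseq_SucI)
      show "(g ^^ n) x \<le> (g ^^ Suc n) x" for n using itm[of x "g x" n] gx gR x by (simp add: funpow_swap1)
    qed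
    then obtain q where q: "(\<lambda>n. (g ^^ n) x) \<longlonglongrightarrow> q" "\<And>n. (g ^^ n) x \<le> q"
      using incseq_convergent[of "\<lambda>n. (g ^^ n) x" v] itR x by auto
    have qv: "q \<le> v" using LIMSEQ_le_const2[OF q(1), of v] itR x by auto
    have qx: "x < q" using q(2)[of 1] gx by simp
    have gq: "g q = q" by (rule fixpt[OF q(1) _ qv]) (use qx x in auto)
    show ?thesis
    proof (rule attractorI[OF N, of q x q])
      fix y assume y: "x < y" "y < q"
      have "(\<lambda>n. (g ^^ n) y) \<longlonglongrightarrow> q"
      proof (rule tendsto_sandwich[OF _ _ q(1) tendsto_const])
        show "\<forall>\<^sub>F n in sequentially. (g ^^ n) y \<le> q" using itm[of y q] fixit[OF gq] y qv x by (auto intro!: always_eventually)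
        show "\<forall>\<^sub>F n in sequentially. (g ^^ n) x \<le> (g ^^ n) y" using itm[of x y] y qv x by (auto intro!: always_eventually)
      qed
      then show "(\<lambda>n. (T ^^ (N * n)) y) \<longlonglongrightarrow> q" unfolding it_mult g_def .
    qed (use gq qv qx x uv g_def in auto)
  qed
qed

text \<open>
  Apply the preceding lemma to \<open>T\<^bsup>2p\<^esup>\<close>. The remaining case is that \<open>T\<^bsup>2p\<^esup>\<close> is the identity on
  \<open>[u, v]\<close>, which a nonpositive Schwarzian derivative does not exclude locally. Then the cross-ratio
  inequality bounds the slope beyond \<open>v\<close> by \<open>1\<close>, while the identity cannot extend to the end of the branch;
  hence points beyond \<open>v\<close> are moved towards \<open>v\<close> and an interval is attracted after all.
\<close>

lemma trap_attractor:
  assumes p: "1 \<le> p" and uv: "0 \<le> u" "u < v" "v \<le> 1" and br: "branch p u v"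
    and self: "u \<le> (T ^^ p) u" "(T ^^ p) u \<le> v" "u \<le> (T ^^ p) v" "(T ^^ p) v \<le> v"
  shows "has_periodic_attractor T"
proof -
  let ?f = "T ^^ p"
  define N where "N = p + p"
  let ?g = "T ^^ N"
  have N: "1 \<le> N" unfolding N_def using p by simp
  have gf: "?g y = ?f (?f y)" for y unfolding N_def by (simp add: it_add)
  have brN: "branch N u v" unfolding N_def
    by (rule branch_add[OF uv(1) less_imp_le[OF uv(2)] uv(3) br]) (rule branch_mono[OF br], use self in auto)
  have fR: "u \<le> ?f y \<and> ?f y \<le> v" if "u \<le> y" "y \<le> v" for y
  proof (cases "y = u \<or> y = v")
    case True
    then show ?thesis using self by auto
  next
    case False
    then show ?thesis using branch_between[OF uv(1,3) br, of u y v] that self by auto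
  qed
  have inc: "?g y < ?g z" if "u \<le> y" "y < z" "z \<le> v" for y z
  proof -
    from branch_strict[OF uv(1,3) br] show ?thesis
    proof
      assume m: "\<forall>x y. u \<le> x \<and> x < y \<and> y \<le> v \<longrightarrow> ?f x < ?f y"
      then have "?f y < ?f z" using that by blast
      then show ?thesis unfolding gf using m fR[of y] fR[of z] that by auto
    next
      assume m: "\<forall>x y. u \<le> x \<and> x < y \<and> y \<le> v \<longrightarrow> ?f y < ?f x"
      then have "?f z < ?f y" using that by blast
      then show ?thesis unfolding gf using m fR[of y] fR[of z] that by auto
    qed
  qed
  have gR: "u \<le> ?g y \<and> ?g y \<le> v" if "u \<le> y" "y \<le> v" for y unfolding gf using fR that by auto
  show ?thesis
  proof (cases "\<exists>x. u \<le> x \<and> x \<le> v \<and> ?g x \<noteq> x")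
    case True
    then obtain x where x: "u \<le> x" "x \<le> v" "?g x \<noteq> x" by auto
    show ?thesis
      by (rule increasing_trap_attractor[OF N uv(1,3) x(1,2) inc _ _ x(3)]) (use gR uv in auto)
  next
    case False
    then have id: "?g x = x" if "u \<le> x" "x \<le> v" for x using that by blast
    obtain b where b: "v \<le> b" "b \<le> 1" "branch N u b" "b \<in> precrit N \<or> b = 1 \<and> b \<notin> precrit N"
      by (rule branch_right_end[OF uv(1) less_imp_le[OF uv(2)] uv(3) brN])
    have incb: "?g y < ?g z" if "u \<le> y" "y < z" "z \<le> b" for y z
    proof -
      have "\<not> (\<forall>x y. u \<le> x \<and> x < y \<and> y \<le> b \<longrightarrow> ?g y < ?g x)"
      proof
        assume "\<forall>x y. u \<le> x \<and> x < y \<and> y \<le> b \<longrightarrow> ?g y < ?g x"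
        then have "?g v < ?g u" using uv b by blast
        then show False using id uv by auto
      qed
      then show ?thesis using branch_strict[OF uv(1) b(2,3)] that by blast
    qed
    \<comment> \<open>at the end of the branch either the derivative is \<open>0\<close> or the value is \<open>T\<^sup>N 1 = 0\<close>\<close>
    have "\<exists>w. v < w \<and> w \<le> b \<and> ?g w \<noteq> w"
    proof (rule ccontr)
      assume "\<not> ?thesis"
      then have id': "?g x = x" if "u \<le> x" "x \<le> b" for x using id that by (cases "x \<le> v") auto
      show False
      proof (cases "b \<in> precrit N")
        case False
        then have "?g 1 = 1" using b id'[of b] uv by auto
        moreover have "(T ^^ n) 0 = 0" for n by (induction n) (auto simp: T_0)
        then have "?g 1 = 0" using N T_1 by (metis Suc_le_D it_Suc One_nat_def)
        ultimately show False by simp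
      next
        case True
        then obtain i where i: "i < N" "(T ^^ i) b = c" by (rule precritD)
        have p0: "(\<Prod>j<N. T' ((T ^^ j) b)) = 0" using i T'_c by (intro prod_zero) auto
        have "(?g has_real_derivative 0) (at b within {0..1})"
          using it_deriv[of b N, unfolded p0] b(1,2) uv by simp
        then have "((\<lambda>y. (?g y - ?g b) / (y - b)) \<longlongrightarrow> 0) (at b within {0..1})"
          unfolding has_field_derivative_iff .
        then have "((\<lambda>y. (?g y - ?g b) / (y - b)) \<longlongrightarrow> 0) (at b within {u..b})"
          by (rule tendsto_within_subset) (use uv b in auto)
        then have l0: "((\<lambda>y. (?g y - ?g b) / (y - b)) \<longlongrightarrow> 0) (at_left b)"
          using at_within_Icc_at_left[of u b] uv b by auto
        have "\<forall>\<^sub>F y in at_left b. y \<in> {u<..<b}" using uv b by (intro eventually_at_left_real) auto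
        then have "\<forall>\<^sub>F y in at_left b. (?g y - ?g b) / (y - b) = 1"
          by eventually_elim (use id' uv b in auto)
        then have l1: "((\<lambda>y. (?g y - ?g b) / (y - b)) \<longlongrightarrow> 1) (at_left b)" by (rule tendsto_eventually)
        show False using tendsto_unique[OF _ l0 l1] by simp
      qed
    qed
    then obtain w where w: "v < w" "w \<le> b" "?g w \<noteq> w" by auto
    \<comment> \<open>compare two halves of \<open>[u, v]\<close>, where the slope is \<open>1\<close>, with \<open>[v, w]\<close>\<close>
    define d where "d = (v - u) / 2"
    have d: "0 < d" "v = u + 2 * d" unfolding d_def using uv by (auto simp: field_simps)
    define r where "r = w - v"
    define r' where "r' = ?g w - v"
    have r: "0 < r" unfolding r_def using w by simp
    have r': "0 < r'" unfolding r'_def using incb[of v w] id[of v] w uv by auto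
    have "(v - (u + d)) * (w - u) * (len N u (u + d) * len N v w) \<le> (u + d - u) * (w - v) * (len N (u + d) v * len N u w)"
      by (rule cross_ratio_len[OF uv(1) b(2,3)]) (use d w in auto)
    moreover have "len N u (u + d) = d" "len N (u + d) v = d" "len N v w = r'" "len N u w = 2 * d + r'"
      unfolding len_def using id[of u] id[of v] id[of "u + d"] d r' r'_def by auto
    moreover have "w - u = 2 * d + r" "v - (u + d) = d" "u + d - u = d" "w - v = r" unfolding r_def using d by auto
    ultimately have "d * (2 * d + r) * (d * r') \<le> d * r * (d * (2 * d + r'))" by simp
    then have "(2 * d * d * d) * r' \<le> (2 * d * d * d) * r" by (simp add: algebra_simps)
    then have "r' \<le> r" using d by (simp add: mult_le_cancel_left)
    then have gw: "?g w \<le> w" unfolding r_def r'_def by simp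
    show ?thesis
      by (rule increasing_trap_attractor[OF N _ _ _ _ _ _ gw w(3), of v]) (use uv w b incb id in auto)
  qed
qed

text \<open>
  The derivative of \<open>T\<^sup>p\<close> vanishes at \<open>c\<close>, so the orbit is superattracting.
\<close>

lemma periodic_critical_point_attractor:
  assumes p: "1 \<le> p" "(T ^^ p) c = c"
  shows "has_periodic_attractor T"
proof -
  let ?g = "T ^^ p"
  have p0: "(\<Prod>j<p. T' ((T ^^ j) c)) = 0" using p T'_c by (intro prod_zero bexI[of _ 0]) auto
  have "(?g has_real_derivative 0) (at c within {0..1})"
    using it_deriv[of c p, unfolded p0] c_pos c_less by auto
  then have "((\<lambda>y. (?g y - ?g c) / (y - c)) \<longlongrightarrow> 0) (at c within {0..1})"
    unfolding has_field_derivative_iff .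
  then have "\<forall>\<^sub>F y in at c within {0..1}. dist ((?g y - ?g c) / (y - c)) 0 < 1 / 2" by (rule tendstoD) simp
  then obtain d where d: "0 < d" "\<And>y. y \<in> {0..1} \<Longrightarrow> y \<noteq> c \<Longrightarrow> dist y c < d \<Longrightarrow> \<bar>(?g y - c) / (y - c)\<bar> < 1 / 2"
    unfolding eventually_at using p by (auto simp: dist_real_def)
  define e where "e = min d (min c (1 - c))"
  have e: "0 < e" "e \<le> d" "e \<le> c" "e \<le> 1 - c" unfolding e_def using d c_pos c_less by auto
  have half: "\<bar>?g y - c\<bar> \<le> 1 / 2 * \<bar>y - c\<bar>" if "\<bar>y - c\<bar> < e" for y
  proof (cases "y = c")
    case True
    then show ?thesis using p by simp
  next
    case False
    have "0 \<le> y \<and> y \<le> 1" using that e by linarith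
    then have "\<bar>?g y - c\<bar> / \<bar>y - c\<bar> < 1 / 2" using d(2)[of y] that e False by (auto simp: dist_real_def abs_divide)
    then show ?thesis using False by (simp add: field_simps)
  qed
  have it: "\<bar>(?g ^^ n) y - c\<bar> \<le> (1 / 2) ^ n * \<bar>y - c\<bar> \<and> \<bar>(?g ^^ n) y - c\<bar> < e" if "\<bar>y - c\<bar> < e" for y n
  proof (induction n)
    case 0
    then show ?case using that by simp
  next
    case (Suc n)
    define a where "a = \<bar>(?g ^^ n) y - c\<bar>"
    define b where "b = \<bar>?g ((?g ^^ n) y) - c\<bar>"
    have a: "0 \<le> a" "a \<le> (1 / 2) ^ n * \<bar>y - c\<bar>" "a < e" using Suc unfolding a_def by auto
    have "b \<le> 1 / 2 * a" unfolding a_def b_def using half a(3) a_def by blast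
    then have "b \<le> 1 / 2 * ((1 / 2) ^ n * \<bar>y - c\<bar>)" "b < e" using a by linarith+
    then show ?case unfolding b_def by simp
  qed
  show ?thesis
  proof (rule attractorI[OF p, of "c - e" "c + e"])
    fix y assume "c - e < y" "y < c + e"
    then have y: "\<bar>y - c\<bar> < e" by auto
    have "(\<lambda>n. (1 / 2 :: real) ^ n) \<longlonglongrightarrow> 0" by (rule LIMSEQ_realpow_zero) auto
    then have l0: "(\<lambda>n. (1 / 2) ^ n * \<bar>y - c\<bar>) \<longlonglongrightarrow> 0" by (rule tendsto_mult_left_zero)
    have "(\<lambda>n. (?g ^^ n) y - c) \<longlonglongrightarrow> 0"
    proof (rule Lim_null_comparison[OF _ l0])
      show "\<forall>\<^sub>F n in sequentially. norm ((?g ^^ n) y - c) \<le> (1 / 2) ^ n * \<bar>y - c\<bar>"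
        using it[OF y] by (intro always_eventually allI) (simp only: real_norm_def)
    qed
    then show "(\<lambda>n. (T ^^ (p * n)) y) \<longlonglongrightarrow> c" unfolding it_mult by (rule LIM_zero_cancel)
  qed (use e c_pos c_less in auto)
qed

end

section \<open>Maps without traps\<close>

text \<open>
  The first two assumptions are what the absence of periodic attractors is used for. The third bounds the
  slope at the end point \<open>1\<close>, the only point besides \<open>0\<close> where a branch can end without meeting \<open>c\<close>.
\<close>

locale trap_free = cr_unimodal +
  fixes \<sigma> :: real
  assumes no_trap: "\<And>p u v. 1 \<le> p \<Longrightarrow> 0 \<le> u \<Longrightarrow> u < v \<Longrightarrow> v \<le> 1 \<Longrightarrow> branch p u v \<Longrightarrow>
       u \<le> (T ^^ p) u \<Longrightarrow> (T ^^ p) u \<le> v \<Longrightarrow> u \<le> (T ^^ p) v \<Longrightarrow> (T ^^ p) v \<le> v \<Longrightarrow> False"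
    and crit_nonperiodic: "\<And>p. 1 \<le> p \<Longrightarrow> (T ^^ p) c \<noteq> c"
    and \<sigma>_pos: "0 < \<sigma>" and \<sigma>_slope: "\<And>z. c \<le> z \<Longrightarrow> z \<le> 1 \<Longrightarrow> \<sigma> * (1 - z) \<le> T z"
begin

text \<open>
  Otherwise \<open>[0, z]\<close> would be mapped into itself.
\<close>

lemma T_above: assumes "0 < z" "z \<le> c" shows "z < T z"
proof (rule ccontr)
  assume "\<not> z < T z"
  moreover have "branch 1 0 z" unfolding branch_def using assms by auto
  moreover have "0 \<le> T z" using T_range[of z] assms c_less by auto
  ultimately show False using no_trap[of 1 0 z] assms c_less T_0 by auto
qed

lemma c_less_Tc: "c < T c"
  using T_above[of c] c_pos by simp

lemma c1_range: "0 \<le> (T ^^ n) (T c)" "(T ^^ n) (T c) \<le> T c"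
proof -
  show "0 \<le> (T ^^ n) (T c)" using it_range[of "T c" n] Tc_pos Tc_le by auto
  have "(T ^^ n) (T c) = T ((T ^^ n) c)" by (metis comp_apply funpow.simps(2) it_Suc)
  then show "(T ^^ n) (T c) \<le> T c" using T_max_le it_range[of c n] c_pos c_less by auto
qed

lemma it_le_Tc: "0 \<le> z \<Longrightarrow> z \<le> 1 \<Longrightarrow> (T ^^ Suc n) z \<le> T c"
  using T_max_le it_range[of z n] by auto

lemma branch_from_0: assumes "0 \<le> z" "z \<le> 1" "branch n 0 z" shows "z \<le> (T ^^ n) z"
  using assms(3)
proof (induction n)
  case (Suc n)
  have "z \<le> (T ^^ n) z" using Suc branch_mono[of "Suc n" 0 z n 0 z] by simp
  moreover have "(T ^^ n) 0 = 0" by (induction n) (auto simp: T_0)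
  then have "(T ^^ n) z \<le> c" using branch_side[OF _ assms(1,2) Suc.prems] c_pos by auto
  ultimately have "z = 0 \<or> (T ^^ n) z < T ((T ^^ n) z)" using T_above[of "(T ^^ n) z"] assms by force
  moreover have "(T ^^ Suc n) 0 = 0" using \<open>(T ^^ n) 0 = 0\<close> T_0 by simp
  ultimately show ?case using \<open>z \<le> (T ^^ n) z\<close> by auto
qed simp

lemma it_1: "1 \<le> n \<Longrightarrow> (T ^^ n) 1 = 0"
proof -
  have "(T ^^ n) 0 = 0" for n by (induction n) (auto simp: T_0)
  then show "1 \<le> n \<Longrightarrow> (T ^^ n) 1 = 0"
    by (metis Suc_le_D T_1 it_Suc One_nat_def)
qed

lemma branch_to_1: assumes "0 \<le> z" "z \<le> 1" "branch n z 1" "1 \<le> n" shows "\<sigma> * (1 - z) \<le> len n z 1"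
proof -
  obtain k where n: "n = 1 + k" using assms(4) by (metis le_iff_add)
  have "c \<le> z"
  proof (rule ccontr)
    assume "\<not> c \<le> z"
    then show False using assms c_less unfolding branch_def by (metis funpow_0 less_le_trans not_le zero_less_one)
  qed
  then have 1: "\<sigma> * (1 - z) \<le> T z" using \<sigma>_slope assms by auto
  have R: "0 \<le> T z" "T z \<le> 1" using T_range assms by auto
  have "branch k (min ((T ^^ 1) z) ((T ^^ 1) 1)) (max ((T ^^ 1) z) ((T ^^ 1) 1))"
    by (rule branch_image) (use assms n in auto)
  then have "branch k 0 (T z)" using R T_1 by (simp add: min_def max_def split: if_splits)
  then have "T z \<le> (T ^^ k) (T z)" using branch_from_0 R by auto
  then have "T z \<le> (T ^^ n) z" using n it_Suc by simp
  then show ?thesis using 1 R it_1[OF assms(4)] by (simp add: len_def)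
qed

text \<open>
  Neighbourhoods \<open>[T c - h, T c]\<close> of the critical value below it are convenient because every positive
  iterate of every point is at most \<open>T c\<close>: such an interval can only be left at its lower end.
\<close>

lemma no_trap_at_c1:
  assumes "1 \<le> p" "0 < h" "h \<le> T c" "branch p (T c - h) (T c)"
  shows "(T ^^ p) (T c) < T c - h \<or> (T ^^ p) (T c - h) < T c - h"
proof (rule ccontr)
  assume "\<not> ?thesis"
  moreover have "(T ^^ p) (T c - h) \<le> T c" using it_le_Tc[of "T c - h" "p - 1"] assms Tc_le by auto
  ultimately show False using no_trap[of p "T c - h" "T c"] assms Tc_le c1_range by auto
qed

section \<open>The critical point does not border a wandering interval\<close>

text \<open>
  Either the infimum is positive and all values are comparable, or it is zero and new minima occur
  infinitely often.
\<close>

lemma record_lows: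
  fixes L :: "nat \<Rightarrow> real"
  assumes pos: "\<And>m. 0 < L m" and bd: "\<And>m. L m \<le> 1"
  obtains K where "1 \<le> K" "\<And>N. \<exists>m\<ge>N. \<forall>j<m. L m \<le> K * L j"
proof (cases "\<exists>e>0. \<forall>m. e \<le> L m")
  case True
  then obtain e where e: "e > 0" "\<And>m. e \<le> L m" by auto
  have "1 \<le> 1 / e" using e(1) order_trans[OF e(2)[of 0] bd[of 0]] by (simp add: field_simps)
  moreover have "L m \<le> 1 / e * L j" for m j
  proof -
    have "L m \<le> 1" by (rule bd)
    also have "\<dots> \<le> 1 / e * L j" using e by (simp add: field_simps)
    finally show ?thesis .
  qed
  ultimately show ?thesis using that[of "1 / e"] by blast
next
  case False
  have "\<exists>m\<ge>N. \<forall>j<m. L m \<le> 1 * L j" for N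
  proof -
    define e where "e = Min (L ` {..N})"
    have e: "e > 0" "\<And>j. j \<le> N \<Longrightarrow> e \<le> L j" unfolding e_def using pos by auto
    then have ex: "\<exists>m. L m < e" using False by (meson not_le)
    define m where "m = (LEAST m. L m < e)"
    have m: "L m < e" unfolding m_def using ex by (rule LeastI_ex)
    have "e \<le> L j" if "j < m" for j using not_less_Least[of j "\<lambda>m. L m < e"] that m_def by auto
    moreover have "N \<le> m" using e(2)[of m] m by force
    ultimately show ?thesis using m by force
  qed
  then show ?thesis using that[of 1] by auto
qed

text \<open>
  The maximal interval of this kind would be mapped into a larger one of the same kind.
\<close>

lemma no_branch_at_0:
  assumes "0 < w" "w \<le> 1" "\<And>m. branch m 0 w"
  shows False
proof -
  define W where "W = {w. 0 \<le> w \<and> w \<le> 1 \<and> (\<forall>m. branch m 0 w)}"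
  have w: "w \<in> W" using assms W_def by auto
  have bd: "bdd_above W" unfolding W_def bdd_above_def by auto
  define s where "s = Sup W"
  have ws: "w \<le> s" unfolding s_def by (rule cSup_upper[OF w bd])
  have s1: "s \<le> 1" unfolding s_def by (rule cSup_least) (use w W_def in auto)
  have br: "branch m 0 s" for m
    unfolding branch_def
  proof (intro allI impI)
    fix j z assume "j < m" and z: "0 < z \<and> z < s"
    then obtain v where "v \<in> W" "z < v" using less_cSup_iff[OF _ bd] w unfolding s_def by auto
    then show "(T ^^ j) z \<noteq> c" using \<open>j < m\<close> z unfolding W_def branch_def by blast
  qed
  have "s \<le> c" using branch_side[of 0 s 0] br[of 1] assms ws s1 c_pos by auto
  then have Ts: "s < T s" using T_above assms ws by auto
  have "T s \<in> W"
  proof -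
    have "branch m 0 (T s)" for m
      using branch_image[of 0 s 1 m] br[of "1 + m"] ws assms s1 T_0 T_range[of s] by (simp add: min_def max_def split: if_splits)
    then show ?thesis unfolding W_def using T_range ws assms s1 by auto
  qed
  then have "T s \<le> s" unfolding s_def using bd by (rule cSup_upper)
  then show False using Ts by simp
qed

text \<open>
  This excludes wandering intervals that border \<open>c\<close>. Take a maximal \<open>J = [T c - h, T c]\<close> on which all
  iterates are monotone. Its images never return to \<open>J\<close>. Let \<open>m\<close> be a time when the image is about as short
  as all earlier ones. The maximal branch of \<open>T\<^sup>m\<close> around \<open>J\<close> ends on both sides at preimages of \<open>c\<close>, so on
  each side of \<open>J\<close> its image covers an earlier image of \<open>J\<close>. The cross-ratio inequality then extends \<open>J\<close>
  by a fixed amount, contrary to maximality.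
\<close>

lemma branch_at_c1_bounded:
  assumes "0 < h0" "h0 \<le> T c"
  obtains M where "\<And>m. branch m (T c - h0) (T c) \<Longrightarrow> m < M"
proof -
  have "\<exists>M. \<forall>m. branch m (T c - h0) (T c) \<longrightarrow> m < M"
  proof (rule ccontr)
    assume "\<not> ?thesis"
    then have "\<exists>m\<ge>M. branch m (T c - h0) (T c)" for M by (meson not_le)
    then have all0: "branch m (T c - h0) (T c)" for m using branch_mono by blast
    define Hs where "Hs = {h. 0 < h \<and> h \<le> T c \<and> (\<forall>m. branch m (T c - h) (T c))}"
    have h0: "h0 \<in> Hs" unfolding Hs_def using assms all0 by auto
    have bd: "bdd_above Hs" unfolding Hs_def bdd_above_def by auto
    define h where "h = Sup Hs"
    have hpos: "0 < h" using cSup_upper[OF h0 bd] assms h_def by auto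
    have hTc: "h \<le> T c" unfolding h_def by (rule cSup_least) (use h0 Hs_def in auto)
    have br: "branch m (T c - h) (T c)" for m
      unfolding branch_def
    proof (intro allI impI)
      fix j z assume j: "j < m" and z: "T c - h < z \<and> z < T c"
      then have "T c - z < Sup Hs" using h_def by auto
      then obtain h' where h': "h' \<in> Hs" "T c - z < h'" using less_cSup_iff[OF _ bd] h0 by auto
      then have "branch m (T c - h') (T c)" "T c - h' < z" using Hs_def by auto
      then show "(T ^^ j) z \<noteq> c" using j z unfolding branch_def by blast
    qed
    have maxl: "h' \<le> h" if "h' \<in> Hs" for h' unfolding h_def by (rule cSup_upper[OF that bd])
    let ?u = "T c - h" and ?v = "T c"
    have u: "0 \<le> ?u" "?u < ?v" "?v \<le> 1" using hpos hTc Tc_le by auto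
    \<comment> \<open>an image meeting \<open>J\<close> would extend it to a longer interval on which all iterates are monotone\<close>
    have away: "(T ^^ j) ?u \<le> ?u \<and> (T ^^ j) ?v \<le> ?u" if "1 \<le> j" for j
    proof (rule ccontr)
      assume neg: "\<not> ?thesis"
      define e where "e = min ((T ^^ j) ?u) ((T ^^ j) ?v)"
      define f where "f = max ((T ^^ j) ?u) ((T ^^ j) ?v)"
      have ef: "e < ?u" "?u < f" using neg no_trap_at_c1[OF that hpos hTc br] unfolding e_def f_def by (auto simp: min_def max_def)
      have bef: "branch m e f" for m
        using branch_image[of ?u ?v j m] br u unfolding e_def f_def by auto
      have "branch m e ?v" for m
        unfolding branch_def
      proof (intro allI impI)
        fix i z assume i: "i < m" and z: "e < z \<and> z < ?v"
        then have "z < f \<or> ?u < z" using ef by auto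
        then show "(T ^^ i) z \<noteq> c" using bef[of m] br[of m] i z unfolding branch_def by auto
      qed
      moreover have "0 \<le> e" unfolding e_def using it_range[of ?u j] it_range[of ?v j] u by auto
      ultimately have "T c - e \<in> Hs" unfolding Hs_def using ef u by auto
      then show False using maxl ef by force
    qed
    define L where "L m = len m ?u ?v" for m
    have Lpos: "0 < L m" for m unfolding L_def by (rule len_pos[OF u(1) u(3) br]) (use u in auto)
    have L1: "L m \<le> 1" for m unfolding L_def len_def using it_range[of ?u m] it_range[of ?v m] u by (auto simp: abs_if)
    obtain K where K: "1 \<le> K" "\<And>N. \<exists>m\<ge>N. \<forall>j<m. L m \<le> K * L j"
      using record_lows[of L] Lpos L1 by blast
    \<comment> \<open>for large times the branch does not extend to \<open>1\<close>, since \<open>T\<close> would map it to a branch at \<open>0\<close>\<close>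
    have "\<exists>M0. \<not> branch M0 ?u 1"
    proof (rule ccontr)
      assume "\<not> ?thesis"
      then have all1: "branch m ?u 1" for m by auto
      have ult: "?u < 1" using u by auto
      have "c \<le> ?u" using branch_side[of ?u 1 0] all1[of 1] u c_less by auto
      then have "T 1 < T ?u" using T_decr[of ?u 1] ult by auto
      then have Tu: "0 < T ?u" "T ?u \<le> 1" using T_1 T_range[of ?u] u by auto
      have "branch m 0 (T ?u)" for m
        using branch_image[of ?u 1 1 m] all1[of "1 + m"] u T_1 Tu by (simp add: min_def max_def split: if_splits)
      then show False using no_branch_at_0[of "T ?u"] Tu by auto
    qed
    then obtain M0 where M0: "\<not> branch M0 ?u 1" by auto
    \<comment> \<open>the extension obtained from the cross-ratio inequality when both outer images are at least \<open>1 / K\<close>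
      times the middle one\<close>
    define \<gamma> where "\<gamma> = h / (2 * K + K * K)"
    have K2: "0 < 2 * K + K * K" using K(1) by (simp add: add_pos_pos)
    have \<gamma>: "0 < \<gamma>" unfolding \<gamma>_def using K2 hpos by simp
    have ext: "\<gamma> \<le> ?u \<and> branch m (?u - \<gamma>) ?v" if mM: "max 1 M0 \<le> m" and mK: "\<forall>j<m. L m \<le> K * L j" for m
    proof -
      obtain a where a: "?v \<le> a" "a \<le> 1" "branch m ?u a" "a \<in> precrit m \<or> a = 1 \<and> a \<notin> precrit m"
        by (rule branch_right_end[OF u(1) less_imp_le[OF u(2)] u(3) br])
      have "\<not> branch m ?u 1" using M0 mM branch_mono[of m ?u 1 M0 ?u 1] by auto
      then have a': "a \<in> precrit m" using a by auto
      obtain b where b: "0 \<le> b" "b \<le> ?u" "branch m b a" "b \<in> precrit m \<or> b = 0 \<and> b \<notin> precrit m"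
        by (rule branch_left_end[OF u(1) order_trans[OF less_imp_le[OF u(2)] a(1)] a(2,3)])
      have "b \<noteq> 0"
      proof
        assume "b = 0"
        moreover have "0 < m" "c < a" using mM c_less_Tc a(1) by auto
        ultimately have "(T ^^ 0) c \<noteq> c" using b(3) c_pos unfolding branch_def by blast
        then show False by simp
      qed
      then have b': "b \<in> precrit m" using b by auto
      define P where "P = len m ?v a"
      define B where "B = len m b ?u"
      have P: "L m \<le> K * P"
      proof -
        obtain i where i: "i < m" "(T ^^ Suc i) a = T c" using a' by (rule precritD)
        have m: "m = Suc i + (m - Suc i)" "m - Suc i < m" using i by auto
        have av: "(T ^^ Suc i) ?v \<le> ?u" using away[of "Suc i"] by simp
        have "branch (m - Suc i) (min ((T ^^ Suc i) ?v) ((T ^^ Suc i) a)) (max ((T ^^ Suc i) ?v) ((T ^^ Suc i) a))"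
        proof (rule branch_image)
          show "branch (Suc i + (m - Suc i)) ?v a" using branch_mono[OF a(3), of m ?v a] m u by auto
        qed (use a u Tc_pos in auto)
        then have bb: "branch (m - Suc i) ((T ^^ Suc i) ?v) ?v" using av i(2) u by (simp add: min_def max_def split: if_splits)
        have "P = len (m - Suc i) ((T ^^ Suc i) ?v) ?v"
          unfolding P_def using len_it[of "m - Suc i" "Suc i" ?v a] m i by (simp add: add.commute)
        moreover have "L (m - Suc i) \<le> len (m - Suc i) ((T ^^ Suc i) ?v) ?v"
          unfolding L_def by (rule len_mono[OF _ _ bb]) (use u av c1_range(1)[of "Suc i"] in auto)
        moreover have "L m \<le> K * L (m - Suc i)" using mK m by auto
        ultimately show ?thesis using K(1) by (smt (verit) mult_left_mono)
      qed
      have B: "L m \<le> K * B"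
      proof -
        obtain i where i: "i < m" "(T ^^ Suc i) b = T c" using b' by (rule precritD)
        have m: "m = Suc i + (m - Suc i)" "m - Suc i < m" using i by auto
        have av: "(T ^^ Suc i) ?u \<le> ?u" using away[of "Suc i"] by simp
        have "branch (m - Suc i) (min ((T ^^ Suc i) b) ((T ^^ Suc i) ?u)) (max ((T ^^ Suc i) b) ((T ^^ Suc i) ?u))"
        proof (rule branch_image)
          show "branch (Suc i + (m - Suc i)) b ?u" using branch_mono[OF b(3), of m b ?u] m u a by auto
        qed (use a b u Tc_pos in auto)
        then have bb: "branch (m - Suc i) ((T ^^ Suc i) ?u) ?v" using av i(2) u by (simp add: min_def max_def split: if_splits)
        have "B = len (m - Suc i) ((T ^^ Suc i) ?u) ?v"
          unfolding B_def using len_it[of "m - Suc i" "Suc i" b ?u] m i by (simp add: add.commute len_commute)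
        moreover have "L (m - Suc i) \<le> len (m - Suc i) ((T ^^ Suc i) ?u) ?v"
          unfolding L_def by (rule len_mono[OF _ _ bb]) (use u av it_range[of ?u "Suc i"] in auto)
        moreover have "L m \<le> K * L (m - Suc i)" using mK m by auto
        ultimately show ?thesis using K(1) by (smt (verit) mult_left_mono)
      qed
      have PB: "0 < P" "0 < B" using P B Lpos[of m] K(1) by (auto simp: zero_less_mult_iff dest!: less_le_trans[OF Lpos])
      have av: "?v < a" using PB(1) a(1) unfolding P_def by (cases "?v = a") auto
      have tot: "len m b a = B + L m + P"
        using len_add[OF b(1) a(2) b(3), of b ?u a] len_add[OF b(1) a(2) b(3), of ?u ?v a] a b u
        unfolding P_def B_def L_def by auto
      let ?C = "?u - b"
      have "(?v - ?u) * (a - b) * (B * P) \<le> (?u - b) * (a - ?v) * (L m * (B + L m + P))"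
        using cross_ratio_len[OF b(1) a(2) b(3), of b ?u ?v a] a b u tot unfolding P_def B_def L_def by auto
      also have "\<dots> \<le> ?C * (a - b) * (L m * (B + L m + P))"
        by (rule mult_right_mono[OF mult_left_mono]) (use b u a PB Lpos[of m] in auto)
      finally have "(a - b) * (h * (B * P)) \<le> (a - b) * (?C * (L m * (B + L m + P)))" by (simp add: algebra_simps)
      then have 1: "h * (B * P) \<le> ?C * (L m * (B + L m + P))" using av b u by (simp add: mult_le_cancel_left)
      have "L m * (B + L m + P) = L m * B + L m * L m + L m * P" by (simp add: algebra_simps)
      also have "\<dots> \<le> (K * P) * B + (K * P) * (K * B) + (K * B) * P"
        by (intro add_mono mult_mono) (use P B PB Lpos[of m] in auto)
      also have "\<dots> = (2 * K + K * K) * (B * P)" by (simp add: algebra_simps)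
      finally have "?C * (L m * (B + L m + P)) \<le> ?C * ((2 * K + K * K) * (B * P))"
        by (rule mult_left_mono) (use b in auto)
      with 1 have "(B * P) * h \<le> (B * P) * (?C * (2 * K + K * K))" by (simp add: algebra_simps)
      then have "h \<le> ?C * (2 * K + K * K)" using PB by (simp add: mult_le_cancel_left)
      then have "\<gamma> \<le> ?C" unfolding \<gamma>_def using K2 by (simp add: field_simps)
      then show ?thesis using b branch_mono[OF b(3), of m "?u - \<gamma>" ?v] a by auto
    qed
    have "branch m (?u - \<gamma>) ?v \<and> \<gamma> \<le> ?u" for m
    proof -
      obtain n where n: "max m (max 1 M0) \<le> n" "\<forall>j<n. L n \<le> K * L j" using K(2) by blast
      then show ?thesis using ext[of n] branch_mono[of n "?u - \<gamma>" ?v m "?u - \<gamma>" ?v] by auto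
    qed
    moreover from this[of 0] have "h + \<gamma> \<le> T c" by simp
    ultimately have "h + \<gamma> \<in> Hs" unfolding Hs_def using \<gamma> hpos by (simp add: diff_diff_eq)
    then show False using maxl \<gamma> by force
  qed
  then show ?thesis using that by blast
qed

section \<open>Branches at the critical value contract subexponentially\<close>

text \<open>
  By continuity, since \<open>c\<close> is not periodic.
\<close>

lemma return_time:
  obtains h0 where "0 < h0" "h0 \<le> T c"
    "\<And>y t. 0 \<le> y \<Longrightarrow> y \<le> 1 \<Longrightarrow> T c - T y < h0 \<Longrightarrow> 1 \<le> t \<Longrightarrow> t < R \<Longrightarrow> h0 \<le> T c - T ((T ^^ t) y)"
proof -
  have "\<exists>h0>0. h0 \<le> T c \<and> (\<forall>y t. 0 \<le> y \<and> y \<le> 1 \<and> T c - T y < h0 \<and> 1 \<le> t \<and> t < R \<longrightarrow> h0 \<le> T c - T ((T ^^ t) y))"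
  proof (induction R)
    case 0
    then show ?case using Tc_pos by auto
  next
    case (Suc R)
    then obtain h0 where h0: "h0 > 0" "h0 \<le> T c"
      "\<And>y t. 0 \<le> y \<and> y \<le> 1 \<and> T c - T y < h0 \<and> 1 \<le> t \<and> t < R \<Longrightarrow> h0 \<le> T c - T ((T ^^ t) y)" by blast
    show ?case
    proof (cases "R = 0")
      case True
      then show ?thesis using h0 by auto
    next
      case False
      define g where "g y = T c - T ((T ^^ R) y)" for y
      have "continuous_on {0..1} (T ^^ Suc R)" by (rule it_cont)
      then have cg: "continuous_on {0..1} g" unfolding g_def by (auto intro!: continuous_intros simp: comp_def)
      have g0: "g c > 0" unfolding g_def using T_max[of "(T ^^ R) c"] it_range[of c R] crit_nonperiodic[of R] False c_pos c_less by auto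
      obtain d where d: "d > 0" "\<And>y. y \<in> {0..1} \<Longrightarrow> dist y c < d \<Longrightarrow> dist (g y) (g c) < g c / 2"
        using cg c_pos c_less g0 unfolding continuous_on_iff by (metis atLeastAtMost_iff half_gt_zero less_imp_le)
      define e where "e = min d (min (c / 2) (1 / 2 - c / 2))"
      have "0 < e" unfolding e_def using d c_pos c_less by simp
      moreover have "e \<le> d" "e \<le> c / 2" "e \<le> 1 / 2 - c / 2" unfolding e_def by linarith+
      ultimately have e: "0 < e" "e \<le> d" "0 < c - e" "c + e < 1" using c_pos c_less by (simp_all add: field_simps)
      define h1 where "h1 = min (min h0 (g c / 2)) (min (T c - T (c - e)) (T c - T (c + e)))"
      have "T (c - e) < T c" "T (c + e) < T c" using T_max[of "c - e"] T_max[of "c + e"] e c_pos c_less by auto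
      then have h1: "0 < h1" "h1 \<le> h0" "h1 \<le> g c / 2" "h1 \<le> T c - T (c - e)" "h1 \<le> T c - T (c + e)"
        unfolding h1_def using h0(1) g0 by (simp, linarith+)
      have near: "\<bar>y - c\<bar> < e" if "0 \<le> y" "y \<le> 1" "T c - T y < h1" for y
      proof (rule ccontr)
        assume "\<not> \<bar>y - c\<bar> < e"
        then consider "y \<le> c - e" | "c + e \<le> y" by linarith
        then show False
        proof cases
          case 1
          then have "T y \<le> T (c - e)" using T_incr[of y "c - e"] that e by (cases "y = c - e") auto
          then show False using that h1 by auto
        next
          case 2
          then have "T y \<le> T (c + e)" using T_decr[of "c + e" y] that e by (cases "y = c + e") auto
          then show False using that h1 by auto
        qed
      qed
      have "h1 \<le> T c - T ((T ^^ t) y)" if "0 \<le> y \<and> y \<le> 1 \<and> T c - T y < h1 \<and> 1 \<le> t \<and> t < Suc R" for y t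
      proof (cases "t = R")
        case True
        have "dist (g y) (g c) < g c / 2" using d(2)[of y] near[of y] that e by (auto simp: dist_real_def)
        then have "g c / 2 \<le> g y" by (auto simp: dist_real_def abs_if split: if_splits)
        then show ?thesis using True h1 g_def by auto
      next
        case False
        then have "h0 \<le> T c - T ((T ^^ t) y)" using h0(3)[of y t] that h1 by auto
        then show ?thesis using h1 by auto
      qed
      then show ?thesis using h1 h0 by (intro exI[of _ h1]) auto
    qed
  qed
  then obtain h0 where "h0>0" "h0 \<le> T c" "\<forall>y t. 0 \<le> y \<and> y \<le> 1 \<and> T c - T y < h0 \<and> 1 \<le> t \<and> t < R \<longrightarrow> h0 \<le> T c - T ((T ^^ t) y)"
    by blast
  then show ?thesis using that[of h0] by blast
qed

text \<open>
  Following the upper end \<open>a\<close> of a branch until it reaches the critical value turns \<open>[b, a]\<close> into an interval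
  at the critical value again. It is not shorter than \<open>[b, T c]\<close>, for otherwise \<open>[b, T c]\<close> would be trapped.
\<close>

lemma step_right:
  assumes b: "0 \<le> b" "b < T c" "T c \<le> a" "a \<le> 1" "branch m b a" and i: "i < m" "(T ^^ Suc i) a = T c"
  defines "h2 \<equiv> T c - (T ^^ Suc i) b"
  shows "T c - b \<le> h2" "h2 \<le> T c" "branch (m - Suc i) (T c - h2) (T c)"
    "T c - (T ^^ Suc i) (T c) \<le> h2" "len (m - Suc i) (T c - h2) (T c) = len m b a"
proof -
  have b1: "b \<le> 1" "b \<le> a" using b by auto
  have bi: "branch (Suc i) b a" using branch_mono[OF b(5), of "Suc i"] i by auto
  have le: "(T ^^ Suc i) b \<le> T c" using it_le_Tc b b1 by auto
  have both: "(T ^^ Suc i) b < b \<and> (T ^^ Suc i) b \<le> (T ^^ Suc i) (T c)"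
  proof -
    have "(T ^^ Suc i) (T c) < b \<or> (T ^^ Suc i) b < b"
      using no_trap_at_c1[of "Suc i" "T c - b"] b branch_mono[OF bi, of "Suc i" b "T c"] by auto
    moreover have "(T ^^ Suc i) b < (T ^^ Suc i) (T c)" if "T c < a"
    proof -
      have "(T ^^ Suc i) (T c) < T c \<or> (T ^^ Suc i) b < (T ^^ Suc i) (T c)"
        using branch_between[OF b(1) b(4) bi, of b "T c" a] b that i c1_range(2)[of "Suc i"] by linarith
      then show ?thesis using branch_between[OF b(1) b(4) bi, of b "T c" a] b that i le c1_range(2)[of "Suc i"] by auto
    qed
    moreover have "(T ^^ Suc i) b \<le> (T ^^ Suc i) (T c)" if "T c = a" using le i that by simp
    ultimately show ?thesis using b(3) i by (cases "T c = a") auto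
  qed
  show "T c - b \<le> h2" "T c - (T ^^ Suc i) (T c) \<le> h2" unfolding h2_def using both by auto
  show "h2 \<le> T c" unfolding h2_def using it_range[of b "Suc i"] b b1 by simp
  have m: "m = Suc i + (m - Suc i)" using i by auto
  have "branch (m - Suc i) (min ((T ^^ Suc i) b) ((T ^^ Suc i) a)) (max ((T ^^ Suc i) b) ((T ^^ Suc i) a))"
    by (rule branch_image) (use b b1 m in auto)
  then show "branch (m - Suc i) (T c - h2) (T c)" unfolding h2_def using le i by (simp add: min_def max_def split: if_splits)
  show "len (m - Suc i) (T c - h2) (T c) = len m b a"
    unfolding h2_def using len_it[of "m - Suc i" "Suc i" b a] m i by (simp add: add.commute)
qed

text \<open>
  The same for the lower end, where the orientation is reversed.
\<close>

lemma step_left: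
  assumes b: "0 \<le> b" "b < T c" "branch m b (T c)" and i: "i < m" "(T ^^ Suc i) b = T c"
  defines "h2 \<equiv> T c - (T ^^ Suc i) (T c)"
  shows "T c - b \<le> h2" "h2 \<le> T c" "branch (m - Suc i) (T c - h2) (T c)"
    "len (m - Suc i) (T c - h2) (T c) = len m b (T c)"
proof -
  have bi: "branch (Suc i) b (T c)" using branch_mono[OF b(3), of "Suc i"] i by auto
  have le: "(T ^^ Suc i) (T c) \<le> T c" by (rule c1_range)
  have "(T ^^ Suc i) (T c) < b \<or> (T ^^ Suc i) b < b"
    using no_trap_at_c1[of "Suc i" "T c - b"] b bi by auto
  then show "T c - b \<le> h2" unfolding h2_def using b i by auto
  show "h2 \<le> T c" unfolding h2_def using c1_range[of "Suc i"] by simp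
  have m: "m = Suc i + (m - Suc i)" using i by auto
  have "branch (m - Suc i) (min ((T ^^ Suc i) b) ((T ^^ Suc i) (T c))) (max ((T ^^ Suc i) b) ((T ^^ Suc i) (T c)))"
    by (rule branch_image) (use b Tc_le m in auto)
  then show "branch (m - Suc i) (T c - h2) (T c)" unfolding h2_def using le i by (simp add: min_def max_def split: if_splits)
  show "len (m - Suc i) (T c - h2) (T c) = len m b (T c)"
    unfolding h2_def using len_it[of "m - Suc i" "Suc i" b "T c"] m i by (simp add: add.commute len_commute)
qed

text \<open>
  In terms of mean slopes, the cross-ratio inequality says that the middle slope is at least the smaller of
  the two outer ones. Here the slope \<open>P / A\<close> on the right exceeds the slope \<open>L / h\<close> in the middle, hence the
  slope \<open>B / D\<close> on the left does not.
\<close>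

lemma slope_aux:
  fixes h D A L B P :: real
  assumes h: "0 < h" "0 \<le> D" "0 < A" "0 < L" "0 \<le> B" "0 < P"
    and cr: "h * (D + h + A) * (B * P) \<le> D * A * (L * (B + L + P))"
    and small: "L * A < P * h"
  shows "B * h \<le> L * D"
proof (rule ccontr)
  assume neg: "\<not> ?thesis"
  have D: "0 < D"
  proof (rule ccontr)
    assume "\<not> 0 < D"
    then have "D = 0" using h by auto
    then have "h * (h + A) * (B * P) \<le> 0" using cr by simp
    then have "B = 0" using h by (simp add: mult_le_0_iff zero_less_mult_iff not_le[symmetric])
    then show False using neg h \<open>D = 0\<close> by simp
  qed
  have 1: "L * D < B * h" using neg by simp
  have a: "L * B * (D * A) \<le> B * P * (h * D)"
    using mult_right_mono[of "L * A" "P * h" "B * D"] small h D by (simp add: algebra_simps)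
  have b: "L * P * (D * A) \<le> B * P * (h * A)"
    using mult_right_mono[of "L * D" "B * h" "P * A"] 1 h D by (simp add: algebra_simps)
  have "(L * D) * (L * A) < (B * h) * (P * h)"
    using mult_strict_mono[OF 1 small] order_le_less_trans[OF _ 1, of 0] h D by simp
  then have "L * L * (D * A) < B * P * (h * h)" by (simp add: algebra_simps)
  with a b have "D * A * (L * (B + L + P)) < h * (D + h + A) * (B * P)" by (simp add: algebra_simps)
  then show False using cr by simp
qed

text \<open>
  Let \<open>P\<close> and \<open>B\<close> be the lengths of the images of the two parts of the maximal branch outside
  \<open>[T c - h, T c]\<close>, and move through the side with the shorter one. If its image is long compared with \<open>L\<close>,
  the cross-ratio inequality shows that the interval can be enlarged in the same proportion, which compensates
  for the loss.
\<close>

lemma contraction_step: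
  assumes h: "0 < h" "h \<le> T c" and br: "branch m (T c - h) (T c)" and m: "1 \<le> m"
  shows "\<sigma> / 2 * h \<le> len m (T c - h) (T c) \<or>
    (\<exists>i h2. i < m \<and> h \<le> h2 \<and> h2 \<le> T c \<and> branch (m - Suc i) (T c - h2) (T c) \<and>
        T c - (T ^^ Suc i) (T c) \<le> h2 \<and>
        len (m - Suc i) (T c - h2) (T c) * h \<le> 6 * len m (T c - h) (T c) * h2)"
proof -
  let ?u = "T c - h" and ?v = "T c"
  define L where "L = len m ?u ?v"
  have u: "0 \<le> ?u" "?u \<le> ?v" "?u < ?v" "?v \<le> 1" using h Tc_le by auto
  have L: "0 < L" unfolding L_def by (rule len_pos[OF u(1,4) br]) (use u in auto)
  obtain a where a: "?v \<le> a" "a \<le> 1" "branch m ?u a" "a \<in> precrit m \<or> a = 1 \<and> a \<notin> precrit m"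
    by (rule branch_right_end[OF u(1,2,4) br])
  obtain b where b: "0 \<le> b" "b \<le> ?u" "branch m b a" "b \<in> precrit m \<or> b = 0 \<and> b \<notin> precrit m"
    by (rule branch_left_end[OF u(1) order_trans[OF u(2) a(1)] a(2,3)])
  have "b \<noteq> 0"
  proof
    assume "b = 0"
    moreover have "0 < m" "c < a" using m c_less_Tc a(1) by auto
    ultimately have "(T ^^ 0) c \<noteq> c" using b(3) c_pos unfolding branch_def by blast
    then show False by simp
  qed
  then have b': "b \<in> precrit m" using b by auto
  define P where "P = len m ?v a"
  define B where "B = len m b ?u"
  define D where "D = ?u - b"
  define A where "A = a - ?v"
  have nn: "0 \<le> P" "0 \<le> B" "0 \<le> D" "0 \<le> A" unfolding P_def B_def D_def A_def using a b by auto
  have lens: "len m b ?v = B + L" "len m b a = B + L + P" "len m ?u a = L + P"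
    using len_add[OF b(1) a(2) b(3), of b ?u a] len_add[OF b(1) a(2) b(3), of ?u ?v a]
      len_add[OF b(1) a(2) b(3), of b ?u ?v] a b u
    unfolding P_def B_def L_def by auto
  have cr: "h * (D + h + A) * (B * P) \<le> D * A * (L * (B + L + P))"
    using cross_ratio_len[OF b(1) a(2) b(3), of b ?u ?v a] a b u lens unfolding P_def B_def L_def D_def A_def by simp
  have Apos: "0 < A" if "0 < P" using that a(1) unfolding P_def A_def by (cases "?v = a") auto
  obtain ib where ib: "ib < m" "(T ^^ Suc ib) b = T c" using b' by (rule precritD)
  \<comment> \<open>the step through the left end\<close>
  have left: ?thesis if "(B + L) * h \<le> 6 * L * (h + D)"
  proof -
    define h2 where "h2 = T c - (T ^^ Suc ib) (T c)"
    have bl: "branch m b ?v" using branch_mono[OF b(3), of m b ?v] a by auto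
    note s = step_left[OF b(1) _ bl ib, folded h2_def]
    have bT: "b < T c" using b u by auto
    have hD: "h + D \<le> h2" using s(1)[OF bT] D_def by simp
    have "(B + L) * h \<le> 6 * L * h2" using that mult_left_mono[OF hD, of "6 * L"] L by linarith
    then have "len (m - Suc ib) (T c - h2) (T c) * h \<le> 6 * len m ?u ?v * h2"
      using s(4)[OF bT] lens(1) unfolding L_def by simp
    then show ?thesis using s(2,3)[OF bT] ib(1) hD nn h2_def by (intro disjI2 exI[of _ ib] exI[of _ h2]) auto
  qed
  show ?thesis
  proof (cases "a \<in> precrit m")
    case False
    then have a1: "a = 1" using a by auto
    \<comment> \<open>the branch ends at \<open>1\<close>, and the mean slope up to there is at least \<open>\<sigma>\<close>\<close>
    show ?thesis
    proof (cases "\<sigma> / 2 * h \<le> L")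
      case True
      then show ?thesis unfolding L_def by auto
    next
      case small: False
      have "\<sigma> * (1 - ?u) \<le> len m ?u 1" by (rule branch_to_1) (use u a a1 m in auto)
      moreover have "1 - ?u = h + A" using a1 A_def by simp
      ultimately have tot: "\<sigma> * (h + A) \<le> L + P" using lens(3) a1 by simp
      have sh: "0 < \<sigma> * h" using \<sigma>_pos h by simp
      have P: "\<sigma> * A < P" using tot small sh by (simp add: algebra_simps)
      then have Pp: "0 < P" using nn \<sigma>_pos by (meson le_less_trans less_imp_le mult_nonneg_nonneg)
      have "L * A \<le> \<sigma> / 2 * h * A" using small nn by (intro mult_right_mono) auto
      also have "\<dots> < h * P" using P h Apos[OF Pp] \<sigma>_pos
        by (smt (verit, best) divide_less_eq_1_pos mult.assoc mult.commute mult_less_cancel_left_pos mult_pos_pos field_sum_of_halves)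
      finally have "L * A < P * h" by (simp add: mult.commute)
      then have "B * h \<le> L * D" using slope_aux[OF h(1) nn(3) Apos[OF Pp] L nn(2) Pp cr] by simp
      then have "(B + L) * h \<le> L * (h + D)" by (simp add: algebra_simps)
      also have "\<dots> \<le> 6 * L * (h + D)" using L h nn by simp
      finally show ?thesis by (rule left)
    qed
  next
    case True
    then obtain i where i: "i < m" "(T ^^ Suc i) a = T c" by (rule precritD)
    have right: ?thesis if z: "b \<le> z" "z \<le> ?u" and le: "len m z a * h \<le> 6 * L * (T c - z)" for z
    proof -
      define h2 where "h2 = T c - (T ^^ Suc i) z"
      have z0: "0 \<le> z" "z < T c" using z b u by auto
      have bz: "branch m z a" using branch_mono[OF b(3), of m z a] z by auto
      note s = step_right[OF z0 a(1,2) bz i, folded h2_def]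
      have "6 * L * (T c - z) \<le> 6 * L * h2" using s(1) L by simp
      then have "len (m - Suc i) (T c - h2) (T c) * h \<le> 6 * len m ?u ?v * h2"
        using s(5) le unfolding L_def by simp
      then show ?thesis using s i(1) z by (intro disjI2 exI[of _ i] exI[of _ h2]) auto
    qed
    show ?thesis
    proof (cases "P \<le> B")
      case PB: True
      show ?thesis
      proof (cases "P \<le> L")
        case True
        then have "(L + P) * h \<le> 6 * L * h" using h L by simp
        then show ?thesis using right[of ?u] b lens(3) by simp
      next
        case PL: False
        then have Pp: "0 < P" using L by simp
        \<comment> \<open>enlarge the interval downwards until both outer images have length \<open>P\<close>\<close>
        obtain z where z: "b \<le> z" "z \<le> ?u" "len m z ?u = P"
          by (rule len_ivt[OF b(1) a(2) b(3) order_refl b(2) order_trans[OF u(2) a(1)] nn(1) PB[unfolded B_def]])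
        define E where "E = ?u - z"
        have E: "0 \<le> E" using z E_def by auto
        have lz: "len m z a = P + L + P"
          using len_add[OF b(1) a(2) b(3), of z ?u a] z u a lens(3) by auto
        have "h * (E + h + A) * (P * P) \<le> E * A * (L * (P + L + P))"
          using cross_ratio_len[OF b(1) a(2) b(3), of z ?u ?v a] a b u z lz unfolding P_def L_def E_def A_def by simp
        moreover have "h * A * (P * P) \<le> h * (E + h + A) * (P * P)"
          using h E Pp by (intro mult_right_mono mult_left_mono) auto
        moreover have "E * A * (L * (P + L + P)) \<le> E * A * (L * (3 * P))"
          using E nn L PL by (intro mult_left_mono) auto
        ultimately have "(A * P) * (h * P) \<le> (A * P) * (3 * E * L)" by (simp add: algebra_simps)
        then have hP: "h * P \<le> 3 * E * L" using Apos[OF Pp] Pp by (simp add: mult_le_cancel_left)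
        have "len m z a * h = 2 * (h * P) + L * h" unfolding lz by (simp add: algebra_simps)
        also have "\<dots> \<le> 6 * L * (h + E)" using hP mult_pos_pos[OF L h(1)] by (simp add: algebra_simps)
        finally show ?thesis using right[OF z(1,2)] E_def by (simp add: algebra_simps)
      qed
    next
      case PB: False
      then have Pp: "0 < P" using nn by simp
      show ?thesis
      proof (cases "B \<le> L")
        case True
        have "(B + L) * h \<le> 2 * L * h" using True h by simp
        also have "\<dots> \<le> 6 * L * (h + D)" using h L nn by (simp add: algebra_simps)
        finally show ?thesis by (rule left)
      next
        case BL: False
        have "h * A * (B * P) \<le> h * (D + h + A) * (B * P)"
          using h nn Pp by (intro mult_right_mono mult_left_mono) auto
        moreover have "D * A * (L * (B + L + P)) \<le> D * A * (L * (3 * P))"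
          using nn L PB BL by (intro mult_left_mono) auto
        ultimately have "(A * P) * (h * B) \<le> (A * P) * (3 * D * L)" using cr by (simp add: algebra_simps)
        then have hB: "h * B \<le> 3 * D * L" using Apos[OF Pp] Pp by (simp add: mult_le_cancel_left)
        have "(B + L) * h = h * B + L * h" by (simp add: algebra_simps)
        also have "\<dots> \<le> 6 * L * (h + D)"
          using hB mult_pos_pos[OF L h(1)] mult_nonneg_nonneg[OF nn(3) less_imp_le[OF L]] by (simp add: algebra_simps)
        finally show ?thesis by (rule left)
      qed
    qed
  qed
qed

text \<open>
  A step of \<open>contraction_step\<close> that ends at a small \<open>h\<close> lowers \<open>m\<close> by at least \<open>R\<close>, because it is a return
  of the orbit of \<open>c\<close> close to \<open>c\<close>; so there are at most \<open>m / R\<close> of them, each costing a factor \<open>6\<close>.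
\<close>

lemma contraction:
  assumes R: "1 \<le> R"
  obtains C where "0 < C" "\<And>m h. 0 < h \<Longrightarrow> h \<le> T c \<Longrightarrow> branch m (T c - h) (T c) \<Longrightarrow>
      C * h * 6 powr (- (real m / real R)) \<le> len m (T c - h) (T c)"
proof -
  obtain h0 where h0: "0 < h0" "h0 \<le> T c"
    and ret: "\<And>y t. 0 \<le> y \<Longrightarrow> y \<le> 1 \<Longrightarrow> T c - T y < h0 \<Longrightarrow> 1 \<le> t \<Longrightarrow> t < R \<Longrightarrow> h0 \<le> T c - T ((T ^^ t) y)"
    using return_time[of R] by blast
  obtain M where M: "\<And>m. branch m (T c - h0) (T c) \<Longrightarrow> m < M"
    using branch_at_c1_bounded[OF h0] by blast
  have u0: "0 \<le> T c - h0" "T c - h0 < T c" using h0 by auto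
  define S where "S = insert 1 ((\<lambda>m. len m (T c - h0) (T c)) ` {m. m < M \<and> branch m (T c - h0) (T c)})"
  define C0 where "C0 = Min S"
  have finS: "finite S" unfolding S_def by auto
  have "\<forall>s\<in>S. 0 < s" unfolding S_def using len_pos[OF u0(1) Tc_le _ _ u0(2)] by auto
  then have C0: "0 < C0" unfolding C0_def using finS S_def by (subst Min_gr_iff) auto
  have big: "C0 * h \<le> len m (T c - h) (T c)" if "h0 \<le> h" "h \<le> T c" "branch m (T c - h) (T c)" for h m
  proof -
    have b0: "branch m (T c - h0) (T c)" using branch_mono[OF that(3), of m "T c - h0" "T c"] that by auto
    then have "C0 \<le> len m (T c - h0) (T c)" unfolding C0_def using M[OF b0] finS S_def by (intro Min_le) auto
    also have "\<dots> \<le> len m (T c - h) (T c)" by (rule len_mono[OF _ _ that(3)]) (use that h0 Tc_le in auto)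
    finally have "C0 \<le> len m (T c - h) (T c)" .
    moreover have "C0 * h \<le> C0 * 1" using C0 that Tc_le by (intro mult_left_mono) auto
    ultimately show ?thesis by simp
  qed
  \<comment> \<open>the three terms serve the step that leaves small \<open>h\<close>, a branch ending at \<open>1\<close>, and \<open>m = 0\<close>\<close>
  define C where "C = min (C0 / 6) (min (\<sigma> / 2) 1)"
  have C: "0 < C" "6 * C \<le> C0" "C \<le> C0" "C \<le> \<sigma> / 2" "C \<le> 1" unfolding C_def using C0 \<sigma>_pos by auto
  have p1: "6 powr (- (real m / real R)) \<le> 1" for m
    using powr_mono[of "- (real m / real R)" 0 6] by simp
  have main: "C * h * 6 powr (- (real m / real R)) \<le> len m (T c - h) (T c)"
    if "0 < h" "h \<le> T c" "branch m (T c - h) (T c)" for m h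
    using that
  proof (induction m arbitrary: h rule: less_induct)
    case (less m)
    let ?L = "len m (T c - h) (T c)"
    have triv: ?case if "C * h \<le> ?L"
    proof -
      have "C * h * 6 powr (- (real m / real R)) \<le> C * h * 1"
        using C less.prems p1 by (intro mult_left_mono) auto
      then show ?thesis using that by simp
    qed
    show ?case
    proof (cases "h0 \<le> h")
      case True
      have "C * h \<le> C0 * h" using C less.prems by (intro mult_right_mono) auto
      then show ?thesis by (intro triv order_trans[OF _ big[OF True less.prems(2,3)]])
    next
      case hsmall: False
      show ?thesis
      proof (cases "m = 0")
        case True
        then show ?thesis using less.prems C by (simp add: len_0 mult_left_le_one_le)
      next
        case False
        then have m1: "1 \<le> m" by simp
        from contraction_step[OF less.prems m1] show ?thesis
        proof
          assume "\<sigma> / 2 * h \<le> ?L"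
          moreover have "C * h \<le> \<sigma> / 2 * h" using C less.prems by (intro mult_right_mono) auto
          ultimately show ?thesis by (intro triv) auto
        next
          assume "\<exists>i h2. i < m \<and> h \<le> h2 \<and> h2 \<le> T c \<and> branch (m - Suc i) (T c - h2) (T c) \<and>
            T c - (T ^^ Suc i) (T c) \<le> h2 \<and> len (m - Suc i) (T c - h2) (T c) * h \<le> 6 * ?L * h2"
          then obtain i h2 where i: "i < m" "h \<le> h2" "h2 \<le> T c" "branch (m - Suc i) (T c - h2) (T c)"
            "T c - (T ^^ Suc i) (T c) \<le> h2" "len (m - Suc i) (T c - h2) (T c) * h \<le> 6 * ?L * h2" by blast
          let ?L2 = "len (m - Suc i) (T c - h2) (T c)"
          have h2: "0 < h2" using i less.prems by auto
          show ?thesis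
          proof (cases "h0 \<le> h2")
            case True
            have "(6 * C) * h2 * h \<le> C0 * h2 * h" using C h2 less.prems by (intro mult_right_mono) auto
            also have "\<dots> \<le> ?L2 * h" using big[OF True i(3,4)] less.prems by (intro mult_right_mono) auto
            also have "\<dots> \<le> 6 * ?L * h2" by (rule i(6))
            finally have "h2 * (C * h) \<le> h2 * ?L" by (simp add: algebra_simps)
            then show ?thesis using h2 by (intro triv) (simp add: mult_le_cancel_left)
          next
            case False
            have "T c - T ((T ^^ Suc i) c) < h0"
              using i(5) False by (simp add: funpow_swap1)
            then have iR: "R \<le> Suc i" using ret[of c "Suc i"] c_pos c_less h0 by force
            have IH: "C * h2 * 6 powr (- (real (m - Suc i) / real R)) \<le> ?L2"
              by (rule less.IH) (use i m1 h2 in auto)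
            have "real (m - Suc i) / real R \<le> (real m - real R) / real R"
              using iR i(1) R by (intro divide_right_mono) auto
            also have "\<dots> = real m / real R - 1" using R by (simp add: diff_divide_distrib)
            finally have "6 powr (1 - real m / real R) \<le> 6 powr (- (real (m - Suc i) / real R))" by (intro powr_mono) auto
            then have "6 * 6 powr (- (real m / real R)) \<le> 6 powr (- (real (m - Suc i) / real R))"
              by (simp add: powr_diff powr_minus divide_inverse)
            then have "C * h2 * (6 * 6 powr (- (real m / real R))) \<le> ?L2"
              using IH mult_left_mono[of _ _ "C * h2"] C h2 by (smt (verit) mult_pos_pos)
            then have "C * h2 * (6 * 6 powr (- (real m / real R))) * h \<le> ?L2 * h"
              using less.prems by (intro mult_right_mono) auto
            also have "\<dots> \<le> 6 * ?L * h2" by (rule i(6))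
            finally have "h2 * (C * h * 6 powr (- (real m / real R))) \<le> h2 * ?L" by (simp add: algebra_simps)
            then show ?thesis using h2 by (simp add: mult_le_cancel_left)
          qed
        qed
      qed
    qed
  qed
  show ?thesis by (rule that[OF C(1) main])
qed

end

section \<open>Height below the critical value as a measure of distance\<close>

text \<open>
  Non-flatness of order \<open>l\<close> enters with \<open>\<alpha> = 1 / l\<close>.
\<close>

locale nonflat_trap_free = trap_free +
  fixes \<alpha> cm cp :: real
  assumes \<alpha>: "0 < \<alpha>" "\<alpha> < 1" and cm_pos: "0 < cm"
    and nonflat: "\<And>z. 0 \<le> z \<Longrightarrow> z \<le> 1 \<Longrightarrow> cm * (T c - T z) powr \<alpha> \<le> \<bar>z - c\<bar> \<and> \<bar>z - c\<bar> \<le> cp * (T c - T z) powr \<alpha>"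
begin

text \<open>
  Comparable to the distance from \<open>c\<close>, but equal at two points with the same image.
\<close>

definition gap :: "real \<Rightarrow> real" where
  "gap z = (T c - T z) powr \<alpha>"

lemma gap_nonneg: "0 \<le> gap z"
  by (simp add: gap_def)

lemma gap_pos: "0 \<le> z \<Longrightarrow> z \<le> 1 \<Longrightarrow> z \<noteq> c \<Longrightarrow> 0 < gap z"
  using T_max[of z] by (simp add: gap_def)

lemma gap_bounds: "0 \<le> z \<Longrightarrow> z \<le> 1 \<Longrightarrow> cm * gap z \<le> \<bar>z - c\<bar>" "0 \<le> z \<Longrightarrow> z \<le> 1 \<Longrightarrow> \<bar>z - c\<bar> \<le> cp * gap z"
  using nonflat by (auto simp: gap_def)

lemma cm_le_cp: "cm \<le> cp"
proof -
  have "cm * gap 0 \<le> cp * gap 0" using gap_bounds[of 0] by simp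
  then show ?thesis using gap_pos[of 0] c_pos by simp
qed

lemma cp_pos: "0 < cp" using cm_pos cm_le_cp by simp

lemma gap_le_iff:
  assumes "0 \<le> z" "z \<le> 1" "0 \<le> y" "y \<le> 1"
  shows "gap z \<le> gap y \<longleftrightarrow> T y \<le> T z"
  unfolding gap_def using \<alpha> T_max_le[of z] T_max_le[of y] assms powr_mono2[of \<alpha> "T c - T z" "T c - T y"]
    powr_less_mono2[of \<alpha> "T c - T y" "T c - T z"] by fastforce

definition \<epsilon>1 :: real where "\<epsilon>1 = cm / (2 * cp)"

lemma \<epsilon>1: "0 < \<epsilon>1" "\<epsilon>1 < 1" "cp * \<epsilon>1 = cm / 2"
  unfolding \<epsilon>1_def using cm_pos cp_pos cm_le_cp by (auto simp: field_simps)

text \<open>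
  With \<open>\<epsilon>1\<^bsup>1/\<alpha>\<^esup> \<rho>\<close> as a height, distances from \<open>c\<close> are at most half of those at height \<open>\<rho>\<close>. The second factor
  is the constant in the final contradiction of \<open>far_end_bound\<close>.
\<close>

definition \<kappa> :: real where
  "\<kappa> = \<epsilon>1 powr (1 / \<alpha>) * min (1 / 2) ((cm / (6 * cp)) powr (1 / (1 - \<alpha>)))"

lemma \<kappa>: "0 < \<kappa>" "\<kappa> < 1"
proof -
  have m: "0 < min (1 / 2) ((cm / (6 * cp)) powr (1 / (1 - \<alpha>)))" using cm_pos cp_pos by simp
  then show "0 < \<kappa>" unfolding \<kappa>_def using \<epsilon>1 by (intro mult_pos_pos) auto
  have "\<kappa> \<le> 1 * (1 / 2)"
    unfolding \<kappa>_def using \<epsilon>1 \<alpha> m by (intro mult_mono powr_le1) auto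
  then show "\<kappa> < 1" by simp
qed

section \<open>Closest approaches to the critical point\<close>

text \<open>
  If \<open>T\<^sup>j e = c\<close>, then \<open>T\<^sup>k e\<close> lies on the orbit of \<open>c\<close>. If \<open>c\<close> does not separate it from \<open>x\<^sub>k\<close>, then the
  iterate \<open>T\<^bsup>k-j\<^esup>\<close> is monotone on the interval between \<open>x\<^bsub>j+1\<^esub>\<close> and \<open>T c\<close>, which is not trapped. As \<open>x\<^sub>k\<close> is
  closer to \<open>c\<close> than \<open>x\<^sub>j\<close>, the end \<open>T\<^sup>k e\<close> must be farther away than \<open>x\<^sub>j\<close>.
\<close>

lemma end_dichotomy:
  assumes x: "0 \<le> x" "x \<le> 1" and e: "0 \<le> e" "e \<le> 1" "e \<noteq> x" and k: "1 \<le> k"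
    and br: "branch k (min e x) (max e x)"
    and rec: "\<And>j. j < k \<Longrightarrow> (T ^^ Suc j) x < (T ^^ Suc k) x"
    and rho: "\<And>j. j < k \<Longrightarrow> (T ^^ Suc j) x \<le> T c - \<rho>" and rhoT: "\<rho> \<le> T c"
    and xk: "(T ^^ k) x \<noteq> c" and ee: "e \<in> precrit k \<or> e = 0 \<or> e = 1"
  shows "((T ^^ k) e < c \<and> c < (T ^^ k) x) \<or> ((T ^^ k) x < c \<and> c < (T ^^ k) e) \<or>
     (T ((T ^^ k) e) \<le> T c - \<rho> \<and> T ((T ^^ k) e) < T ((T ^^ k) x))"
proof (cases "e \<in> precrit k")
  case False
  have "(T ^^ k) 0 = 0" by (induction k) (auto simp: T_0)
  then have "(T ^^ k) e = 0" using ee False it_1[OF k] by auto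
  moreover have "0 < T ((T ^^ k) x)" using rec[of 0] k T_range[of x] x by simp
  ultimately show ?thesis using T_0 rhoT by auto
next
  case True
  then obtain j where j: "j < k" "(T ^^ j) e = c" "(T ^^ Suc j) e = T c" by (rule precritD)
  have kj: "k = Suc j + (k - Suc j)" and kt: "k = (k - j) + j" "1 \<le> k - j" using j by auto
  have ek: "(T ^^ k) e = (T ^^ (k - j)) c" using kt(1) j(2) by (metis it_add)
  have nc: "(T ^^ k) e \<noteq> c" using crit_nonperiodic[OF kt(2)] ek by simp
  show ?thesis
  proof (rule ccontr)
    assume neg: "\<not> ?thesis"
    then have same: "((T ^^ k) e < c \<and> (T ^^ k) x < c) \<or> (c < (T ^^ k) e \<and> c < (T ^^ k) x)"
      using nc xk by linarith
    let ?y = "(T ^^ Suc j) x"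
    have y: "0 \<le> ?y" "?y < T c" using rec[OF j(1)] it_range[OF x, of "Suc j"] it_le_Tc[OF x, of k] by auto
    let ?n = "k - Suc j"
    have "branch ?n (min ((T ^^ Suc j) (min e x)) ((T ^^ Suc j) (max e x))) (max ((T ^^ Suc j) (min e x)) ((T ^^ Suc j) (max e x)))"
      by (rule branch_image) (use x e br kj in auto)
    then have b1: "branch ?n ?y (T c)"
      using y j(3) by (auto simp: min_def max_def split: if_splits)
    have ny: "(T ^^ ?n) ?y = (T ^^ k) x" and nT: "(T ^^ ?n) (T c) = (T ^^ k) e"
      using it_add[of ?n "Suc j" x] it_add[of ?n "Suc j" e] kj j(3) by (auto simp: add.commute)
    have "branch (?n + 1) ?y (T c)"
    proof (rule branch_add[OF y(1) less_imp_le[OF y(2)] Tc_le b1])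
      show "branch 1 (min ((T ^^ ?n) ?y) ((T ^^ ?n) (T c))) (max ((T ^^ ?n) ?y) ((T ^^ ?n) (T c)))"
        unfolding ny nT branch_def using same by auto
    qed
    then have b2: "branch (k - j) ?y (T c)" using j(1) by (simp add: Suc_diff_Suc)
    have t1: "(T ^^ (k - j)) (T c) = T ((T ^^ k) e)" 
      using nT j(1) by (metis Suc_diff_Suc comp_apply funpow.simps(2))
    have t2: "(T ^^ (k - j)) ?y = (T ^^ Suc k) x"
      using ny j(1) by (metis Suc_diff_Suc comp_apply funpow.simps(2))
    have "T ((T ^^ k) e) < ?y"
      using no_trap_at_c1[OF kt(2), of "T c - ?y"] b2 y t1 t2 rec[OF j(1)] by auto
    then show False using neg rec[OF j(1)] rho[OF j(1)] by auto
  qed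
qed

text \<open>
  The end of the image branch on the side of \<open>c\<close> cannot lie between \<open>x\<^sub>k\<close> and \<open>c\<close>, since it would have to be
  farther away than \<open>x\<^sub>k\<close>. So the image covers \<open>c\<close>, and it extends from \<open>c\<close> to \<open>T\<^sup>k u\<close> on one side and
  beyond \<open>x\<^sub>k\<close> to \<open>T\<^sup>k w\<close> on the other.
\<close>

lemma ends_opposite:
  assumes ab: "0 \<le> a" "a < x" "x < b" "b \<le> 1" and k: "1 \<le> k"
    and br: "branch k a b"
    and rec: "\<And>j. j < k \<Longrightarrow> (T ^^ Suc j) x < (T ^^ Suc k) x"
    and rho: "\<And>j. j < k \<Longrightarrow> (T ^^ Suc j) x \<le> T c - \<rho>" and rhoT: "\<rho> \<le> T c"
    and xk: "(T ^^ k) x \<noteq> c" and ea: "a \<in> precrit k \<or> a = 0" and eb: "b \<in> precrit k \<or> b = 1"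
  obtains u w where "{u, w} = {a, b}" "T ((T ^^ k) w) \<le> T c - \<rho>"
    "((T ^^ k) u < c \<and> c < (T ^^ k) x \<and> (T ^^ k) x < (T ^^ k) w) \<or> ((T ^^ k) w < (T ^^ k) x \<and> (T ^^ k) x < c \<and> c < (T ^^ k) u)"
proof -
  let ?f = "T ^^ k"
  note out = that
  have x: "0 \<le> x" "x \<le> 1" using ab by auto
  have R: "0 \<le> ?f z \<and> ?f z \<le> 1" if "z \<in> {a, x, b}" for z using it_range[of z k] that ab by auto
  have da: "(?f a < c \<and> c < ?f x) \<or> (?f x < c \<and> c < ?f a) \<or> (T (?f a) \<le> T c - \<rho> \<and> T (?f a) < T (?f x))"
    by (rule end_dichotomy[OF x _ _ _ k _ rec rho rhoT xk]) (use ab ea branch_mono[OF br, of k a x] in auto)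
  have db: "(?f b < c \<and> c < ?f x) \<or> (?f x < c \<and> c < ?f b) \<or> (T (?f b) \<le> T c - \<rho> \<and> T (?f b) < T (?f x))"
    by (rule end_dichotomy[OF x _ _ _ k _ rec rho rhoT xk]) (use ab eb branch_mono[OF br, of k x b] in auto)
  have key: thesis if uw: "{u, w} = {a, b}"
     and du: "(?f u < c \<and> c < ?f x) \<or> (?f x < c \<and> c < ?f u) \<or> (T (?f u) \<le> T c - \<rho> \<and> T (?f u) < T (?f x))"
     and dw: "(?f w < c \<and> c < ?f x) \<or> (?f x < c \<and> c < ?f w) \<or> (T (?f w) \<le> T c - \<rho> \<and> T (?f w) < T (?f x))"
     and ord: "(?f u < ?f x \<and> ?f x < ?f w \<and> c < ?f x) \<or> (?f w < ?f x \<and> ?f x < ?f u \<and> ?f x < c)" for u w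
  proof -
    have "T (?f w) \<le> T c - \<rho>" using dw ord by auto
    moreover have "?f u < c" if "c < ?f x" "?f u < ?f x"
    proof (rule ccontr)
      assume "\<not> ?f u < c"
      then have "T (?f x) < T (?f u)" using T_decr[of "?f u" "?f x"] that R[of x] by auto
      then show False using du that \<open>\<not> ?f u < c\<close> by auto
    qed
    moreover have "c < ?f u" if "?f x < c" "?f x < ?f u"
    proof (rule ccontr)
      assume "\<not> c < ?f u"
      then have "T (?f x) < T (?f u)" using T_incr[of "?f x" "?f u"] that R[of x] by auto
      then show False using du that \<open>\<not> c < ?f u\<close> by auto
    qed
    ultimately show thesis using out[OF uw] ord by blast
  qed
  have "?f a < ?f x \<and> ?f x < ?f b \<or> ?f b < ?f x \<and> ?f x < ?f a"
    by (rule branch_between[OF ab(1,4) br]) (use ab in auto)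
  then consider "?f a < ?f x \<and> ?f x < ?f b \<and> c < ?f x \<or> ?f b < ?f x \<and> ?f x < ?f a \<and> ?f x < c"
    | "?f b < ?f x \<and> ?f x < ?f a \<and> c < ?f x \<or> ?f a < ?f x \<and> ?f x < ?f b \<and> ?f x < c"
    using xk by linarith
  then show thesis
  proof cases
    case 1
    show thesis by (rule key[OF _ da db 1]) simp
  next
    case 2
    show thesis by (rule key[OF _ db da 2]) auto
  qed
qed

text \<open>
  Let \<open>g = T\<^sup>n\<close> be the rest of the branch after \<open>u\<close> has reached the critical value, and let \<open>\<mu>\<close> be the height
  of \<open>T\<^sup>k u\<close> below \<open>T c\<close>. The map \<open>g\<close> sends \<open>T c\<close> to \<open>T\<^sup>k u\<close> and crosses \<open>c\<close> at a point \<open>q\<close>. The absence of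
  traps gives \<open>T c - \<mu> \<le> q\<close>, and places \<open>g (T c - r)\<close> at height at most \<open>r\<close> for \<open>\<mu> \<le> r < \<rho>\<close>. By non-flatness
  lengths of images near \<open>c\<close> are comparable to heights to the power \<open>\<alpha>\<close>. The cross-ratio inequality for the
  points \<open>s < T c - r < T c - \<mu> < T c\<close> then reads \<open>r / \<mu> \<le> const * (r / \<mu>)\<^sup>\<alpha>\<close>, so \<open>\<mu>\<close> cannot be small
  compared with \<open>r\<close>, because \<open>\<alpha> < 1\<close>.
\<close>

lemma far_end_bound:
  assumes ab: "0 \<le> a" "a < x" "x < b" "b \<le> 1" and k: "1 \<le> k"
    and br: "branch k a b"
    and rec: "\<And>j. j < k \<Longrightarrow> (T ^^ Suc j) x < (T ^^ Suc k) x"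
    and rho: "\<And>j. j < k \<Longrightarrow> (T ^^ Suc j) x \<le> T c - \<rho>" and rhoT: "0 < \<rho>" "\<rho> \<le> T c"
    and uw: "{u, w} = {a, b}" and Tw: "T ((T ^^ k) w) \<le> T c - \<rho>"
    and ord: "((T ^^ k) u < c \<and> c < (T ^^ k) x \<and> (T ^^ k) x < (T ^^ k) w) \<or> ((T ^^ k) w < (T ^^ k) x \<and> (T ^^ k) x < c \<and> c < (T ^^ k) u)"
    and eu: "u \<in> precrit k \<or> u = 0 \<or> u = 1"
  shows "\<kappa> * \<rho> \<le> T c - T ((T ^^ k) u)"
proof (cases "u \<in> precrit k")
  case False
  have "(T ^^ k) 0 = 0" by (induction k) (auto simp: T_0)
  then have "(T ^^ k) u = 0" using eu False it_1[OF k] by auto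
  moreover have "\<kappa> * \<rho> \<le> 1 * \<rho>" using \<kappa> rhoT by (intro mult_right_mono) auto
  then have "\<kappa> * \<rho> \<le> T c" using rhoT by linarith
  ultimately show ?thesis using T_0 by simp
next
  case True
  then obtain j where j: "j < k" "(T ^^ j) u = c" "(T ^^ Suc j) u = T c" by (rule precritD)
  define n where "n = k - Suc j"
  have kn: "k = Suc j + n" "k = n + Suc j" unfolding n_def using j by auto
  define y where "y = (T ^^ Suc j) x"
  define s where "s = (T ^^ Suc j) w"
  let ?g = "T ^^ n"
  have x01: "0 \<le> x" "x \<le> 1" and uw01: "0 \<le> u" "u \<le> 1" "0 \<le> w" "w \<le> 1" using ab uw by (auto simp: doubleton_eq_iff)
  have gT: "?g (T c) = (T ^^ k) u" and gy: "?g y = (T ^^ k) x" and gs: "?g s = (T ^^ k) w"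
    unfolding y_def s_def kn(2) it_add using j(3) by auto
  have brj: "branch (Suc j) a b" using branch_mono[OF br, of "Suc j"] j by auto
  have yr: "y < T c" using rec[OF j(1)] it_le_Tc[OF x01, of k] unfolding y_def by simp
  have sy: "s < y"
  proof -
    have "(T ^^ Suc j) a < y \<and> y < (T ^^ Suc j) b \<or> (T ^^ Suc j) b < y \<and> y < (T ^^ Suc j) a"
      unfolding y_def by (rule branch_between[OF ab(1,4) brj]) (use ab in auto)
    then show ?thesis using uw yr j(3) unfolding s_def by (auto simp: doubleton_eq_iff)
  qed
  have s0: "0 \<le> s" unfolding s_def using it_range[of w "Suc j"] uw01 by blast
  have bn: "branch n s (T c)"
  proof -
    have "branch n (min ((T ^^ Suc j) a) ((T ^^ Suc j) b)) (max ((T ^^ Suc j) a) ((T ^^ Suc j) b))"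
      by (rule branch_image) (use ab br kn(1) in auto)
    then show ?thesis using uw j(3) sy yr unfolding s_def by (auto simp: doubleton_eq_iff min_def max_def split: if_splits)
  qed
  note S = s0 Tc_le bn
  define \<mu> where "\<mu> = T c - T ((T ^^ k) u)"
  have fu: "0 \<le> (T ^^ k) u" "(T ^^ k) u \<le> 1" "(T ^^ k) u \<noteq> c" using it_range[of u k] uw01 ord by auto
  have mu0: "0 < \<mu>" unfolding \<mu>_def using T_max[OF fu] by simp
  show ?thesis
  proof (rule ccontr)
    assume "\<not> ?thesis"
    then have small: "\<mu> < \<kappa> * \<rho>" unfolding \<mu>_def by simp
    define r where "r = \<epsilon>1 powr (1 / \<alpha>) * \<rho>"
    define \<kappa>' where "\<kappa>' = min (1 / 2) ((cm / (6 * cp)) powr (1 / (1 - \<alpha>)))"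
    have e1: "0 < \<epsilon>1 powr (1 / \<alpha>)" "\<epsilon>1 powr (1 / \<alpha>) < 1" using \<epsilon>1 \<alpha> powr_less_mono2[of "1 / \<alpha>" \<epsilon>1 1] by auto
    have r: "0 < r" "r < \<rho>" unfolding r_def using e1 rhoT by auto
    have mur: "\<mu> < \<kappa>' * r" using small unfolding \<kappa>_def r_def \<kappa>'_def by (simp add: algebra_simps)
    have "\<kappa>' * r \<le> 1 / 2 * r" unfolding \<kappa>'_def using r by (intro mult_right_mono) auto
    then have mu2: "\<mu> < r / 2" using mur by simp
    have yrho: "y \<le> T c - \<rho>" using rho[OF j(1)] y_def by simp
    obtain q where q: "y \<le> q" "q \<le> T c" "?g q = c"
      by (rule it_ivt[of y "T c" n c]) (use ord gT gy sy s0 yr Tc_le in auto)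
    have qy: "y < q" "q < T c"
      using q gT gy ord by (auto simp: order_le_less)
    have len_c: "\<bar>?g z - c\<bar> = len n z q" "\<bar>?g z - c\<bar> = len n q z" for z unfolding len_def q(3)[symmetric] by auto
    have same_q: "branch (n + 1) q' (T c)" if "q \<le> q'" "q' < T c" for q'
    proof (rule branch_add)
      have q': "?g q' = c \<or> (c < ?g q' \<and> ?g q' < ?g (T c)) \<or> (?g (T c) < ?g q' \<and> ?g q' < c)"
        using branch_between[OF S, of q q' "T c"] that q sy qy by (cases "q = q'") auto
      show "branch 1 (min (?g q') (?g (T c))) (max (?g q') (?g (T c)))"
        unfolding branch_def using q' by auto
      show "branch n q' (T c)" using branch_mono[OF bn, of n q' "T c"] that qy sy by auto
    qed (use that q qy sy s0 Tc_le in auto)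
    \<comment> \<open>the preimage of the critical point lies at depth at most \<open>\<mu>\<close> below the critical value\<close>
    have i: "T c - \<mu> \<le> q"
    proof (rule ccontr)
      assume neg: "\<not> ?thesis"
      have b: "branch (Suc n) (T c - \<mu>) (T c)" using same_q[of "T c - \<mu>"] neg mu0 by simp
      have muT: "\<mu> \<le> T c" unfolding \<mu>_def using T_range[OF fu(1,2)] by simp
      have "T (?g (T c)) < T c - \<mu> \<or> T (?g (T c - \<mu>)) < T c - \<mu>"
        using no_trap_at_c1[OF _ mu0 muT b] by simp
      moreover have "T (?g (T c)) = T c - \<mu>" using gT \<mu>_def by simp
      ultimately have lt: "T (?g (T c - \<mu>)) < T (?g (T c))" by simp
      have btw: "(c < ?g (T c - \<mu>) \<and> ?g (T c - \<mu>) < ?g (T c)) \<or> (?g (T c) < ?g (T c - \<mu>) \<and> ?g (T c - \<mu>) < c)"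
        using branch_between[OF S, of q "T c - \<mu>" "T c"] neg mu0 sy qy q(3) by auto
      then have "T (?g (T c)) < T (?g (T c - \<mu>))"
        using T_decr[of "?g (T c - \<mu>)" "?g (T c)"] T_incr[of "?g (T c)" "?g (T c - \<mu>)"] fu gT by auto
      then show False using lt by simp
    qed
    \<comment> \<open>outside that preimage the branch moves points towards the critical value\<close>
    have rq: "T c - r < q" "y < T c - r" using i mu2 r yrho mu0 by auto
    have ii: "T c - r \<le> T (?g (T c - r))"
    proof (rule ccontr)
      assume neg: "\<not> ?thesis"
      let ?z = "T c - r"
      have btw: "(?g y < ?g ?z \<and> ?g ?z < c) \<or> (c < ?g ?z \<and> ?g ?z < ?g y)"
        using branch_between[OF S, of y ?z q] rq sy qy q(3) by auto
      have gyR: "0 \<le> ?g y" "?g y \<le> 1" unfolding gy using it_range[OF x01] by auto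
      have up: "T (?g y) < T (?g ?z)"
        using btw T_incr[of "?g y" "?g ?z"] T_decr[of "?g ?z" "?g y"] gyR by auto
      have Ty: "T (?g y) = (T ^^ Suc k) x" unfolding gy by simp
      have "branch (n + 1) y ?z"
      proof (rule branch_add)
        show "branch 1 (min (?g y) (?g ?z)) (max (?g y) (?g ?z))" unfolding branch_def using btw by auto
        show "branch n y ?z" using branch_mono[OF bn, of n y ?z] sy r by auto
      qed (use sy s0 rq r Tc_le in auto)
      then show False
        using no_trap[of "Suc n" y ?z] sy s0 rq r Tc_le up neg Ty rec[OF j(1)] unfolding y_def[symmetric] by auto
    qed
    have gR: "0 \<le> ?g z \<and> ?g z \<le> 1" if "s \<le> z" "z \<le> T c" for z using it_range[of z n] that s0 Tc_le by auto
    define W where "W = len n s q"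
    have Wb: "cm * \<rho> powr \<alpha> \<le> W"
    proof -
      have "cm * \<rho> powr \<alpha> \<le> cm * gap (?g s)"
        unfolding gap_def gs using Tw rhoT cm_pos \<alpha> by (intro mult_left_mono powr_mono2) auto
      also have "\<dots> \<le> \<bar>?g s - c\<bar>" using gap_bounds(1)[of "?g s"] gR[of s] sy yr by auto
      also have "\<dots> = W" unfolding len_c(1) W_def ..
      finally show ?thesis .
    qed
    have ra: "cp * r powr \<alpha> = cm / 2 * \<rho> powr \<alpha>"
      unfolding r_def using \<epsilon>1 rhoT \<alpha> by (simp add: powr_mult powr_powr)
    have M1: "len n (T c - r) q \<le> cp * r powr \<alpha>"
    proof -
      have "\<bar>?g (T c - r) - c\<bar> \<le> cp * gap (?g (T c - r))"
        using gap_bounds(2)[of "?g (T c - r)"] gR[of "T c - r"] rq sy r by auto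
      also have "\<dots> \<le> cp * r powr \<alpha>"
        unfolding gap_def using ii T_max_le gR[of "T c - r"] rq sy r cp_pos \<alpha> by (intro mult_left_mono powr_mono2) auto
      finally show ?thesis unfolding len_c(1) .
    qed
    have U1: "cm * \<mu> powr \<alpha> \<le> len n q (T c)" "len n q (T c) \<le> cp * \<mu> powr \<alpha>"
      using gap_bounds[of "?g (T c)"] fu(1,2) unfolding len_c(2)[symmetric] gT gap_def \<mu>_def by auto
    have U2: "cp * \<mu> powr \<alpha> \<le> cp * r powr \<alpha>" using mu0 mu2 r cp_pos \<alpha> by (intro mult_left_mono powr_mono2) auto
    have L: "W / 2 \<le> len n s (T c - r)"
      using len_add[OF S, of s "T c - r" q] sy rq qy M1 ra Wb unfolding W_def by auto
    have Tot: "len n s (T c) \<le> 3 / 2 * W"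
      using len_add[OF S, of s q "T c"] sy qy U1 U2 ra Wb unfolding W_def by auto
    have M: "len n (T c - r) (T c - \<mu>) \<le> cp * r powr \<alpha>"
      using len_mono[OF S, of "T c - r" "T c - r" "T c - \<mu>" q] M1 i rq sy qy mu2 r by auto
    have Rr: "cm * \<mu> powr \<alpha> \<le> len n (T c - \<mu>) (T c)"
      using len_mono[OF S, of "T c - \<mu>" q "T c" "T c"] U1 i rq sy qy mu0 mu2 r by auto
    have W0: "0 < W" using Wb cm_pos rhoT by (smt (verit) mult_pos_pos powr_gt_zero)
    have "(r - \<mu>) * (T c - s) * (len n s (T c - r) * len n (T c - \<mu>) (T c))
       \<le> (T c - r - s) * \<mu> * (len n (T c - r) (T c - \<mu>) * len n s (T c))"
      using cross_ratio_len[OF S, of s "T c - r" "T c - \<mu>" "T c"] sy rq mu2 mu0 r by (auto simp: algebra_simps)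
    also have "\<dots> \<le> (T c - s) * \<mu> * ((cp * r powr \<alpha>) * (3 / 2 * W))"
      by (intro mult_mono M Tot) (use r mu0 sy rq yr cp_pos in auto)
    finally have 1: "(r - \<mu>) * (T c - s) * (len n s (T c - r) * len n (T c - \<mu>) (T c)) \<le> \<dots>" .
    have "(r / 2) * (T c - s) * ((W / 2) * (cm * \<mu> powr \<alpha>)) \<le> (r - \<mu>) * (T c - s) * (len n s (T c - r) * len n (T c - \<mu>) (T c))"
      by (intro mult_mono L Rr) (use mu2 r mu0 sy yr W0 cm_pos in auto)
    note 2 = order_trans[OF this 1]
    define D where "D = T c - s"
    have "(D * W) * (r * (cm * \<mu> powr \<alpha>)) \<le> (D * W) * (6 * cp * \<mu> * r powr \<alpha>)"
      using 2 unfolding D_def[symmetric] by (simp add: algebra_simps)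
    moreover have "0 < D * W" unfolding D_def using sy yr W0 by simp
    ultimately have "r * (cm * \<mu> powr \<alpha>) \<le> 6 * cp * \<mu> * r powr \<alpha>" by (simp only: mult_le_cancel_left_pos)
    moreover have "\<mu> = \<mu> powr \<alpha> * \<mu> powr (1 - \<alpha>)" "r = r powr \<alpha> * r powr (1 - \<alpha>)"
      using mu0 r by (simp_all add: powr_add[symmetric])
    ultimately have "(r powr \<alpha> * r powr (1 - \<alpha>)) * (cm * \<mu> powr \<alpha>) \<le> 6 * cp * (\<mu> powr \<alpha> * \<mu> powr (1 - \<alpha>)) * r powr \<alpha>" by metis
    then have "(r powr \<alpha> * \<mu> powr \<alpha>) * (cm * r powr (1 - \<alpha>)) \<le> (r powr \<alpha> * \<mu> powr \<alpha>) * (6 * cp * \<mu> powr (1 - \<alpha>))"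
      by (simp add: algebra_simps)
    then have "cm * r powr (1 - \<alpha>) \<le> 6 * cp * \<mu> powr (1 - \<alpha>)" using mu0 r by (simp add: mult_le_cancel_left_pos)
    moreover have "\<mu> powr (1 - \<alpha>) < cm / (6 * cp) * r powr (1 - \<alpha>)"
    proof -
      have "\<mu> < (cm / (6 * cp)) powr (1 / (1 - \<alpha>)) * r"
        using mur r unfolding \<kappa>'_def by (smt (verit) min.cobounded2 mult_right_mono)
      then have "\<mu> powr (1 - \<alpha>) < ((cm / (6 * cp)) powr (1 / (1 - \<alpha>)) * r) powr (1 - \<alpha>)"
        using mu0 \<alpha> by (intro powr_less_mono2) auto
      also have "\<dots> = cm / (6 * cp) * r powr (1 - \<alpha>)"
        using cm_pos cp_pos r \<alpha> by (simp add: powr_mult powr_powr)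
      finally show ?thesis .
    qed
    ultimately show False using cp_pos by (simp add: field_simps)
  qed
qed

definition \<kappa>1 :: real where "\<kappa>1 = \<kappa> powr \<alpha>"

lemma \<kappa>1: "0 < \<kappa>1" "\<kappa>1 \<le> 1"
  unfolding \<kappa>1_def using \<kappa> \<alpha> by (auto intro!: powr_le1)

lemma closest_approach:
  assumes ab: "0 \<le> a" "a < x" "x < b" "b \<le> 1"
    and br: "branch k a b"
    and rec: "\<And>j. j < k \<Longrightarrow> (T ^^ Suc j) x < (T ^^ Suc k) x"
    and g: "0 < g" "g \<le> gap 0" "\<And>j. j < k \<Longrightarrow> g \<le> gap ((T ^^ j) x)"
    and xk: "(T ^^ k) x \<noteq> c" and ea: "a \<in> precrit k \<or> a = 0" and eb: "b \<in> precrit k \<or> b = 1"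
  shows "((T ^^ k) a < c \<and> c < (T ^^ k) b) \<or> ((T ^^ k) b < c \<and> c < (T ^^ k) a)"
    and "\<kappa>1 * g \<le> gap ((T ^^ k) a)" "\<kappa>1 * g \<le> gap ((T ^^ k) b)"
proof -
  have kg: "\<kappa>1 * g \<le> g" using \<kappa>1 g by simp
  have "(((T ^^ k) a < c \<and> c < (T ^^ k) b) \<or> ((T ^^ k) b < c \<and> c < (T ^^ k) a)) \<and>
     \<kappa>1 * g \<le> gap ((T ^^ k) a) \<and> \<kappa>1 * g \<le> gap ((T ^^ k) b)"
  proof (cases "k = 0")
    case True
    then have "a = 0" "b = 1" using ea eb by (auto simp: precrit_def)
    moreover have "gap 1 = gap 0" by (simp add: gap_def T_0 T_1)
    ultimately show ?thesis using True c_pos c_less order_trans[OF kg g(2)] by auto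
  next
    case False
    then have k: "1 \<le> k" by simp
    define \<rho> where "\<rho> = g powr (1 / \<alpha>)"
    have x01: "0 \<le> x" "x \<le> 1" using ab by auto
    have rho0: "0 < \<rho>" unfolding \<rho>_def using g by simp
    have conv: "\<rho> \<le> T c - T z" if "g \<le> gap z" "0 \<le> z" "z \<le> 1" for z
    proof -
      have "\<rho> \<le> gap z powr (1 / \<alpha>)" unfolding \<rho>_def using that g \<alpha> by (intro powr_mono2) auto
      also have "\<dots> = T c - T z" unfolding gap_def using \<alpha> T_max_le[of z] that by (simp add: powr_powr)
      finally show ?thesis .
    qed
    have rhoT: "\<rho> \<le> T c" using conv[of 0] g T_0 by simp
    have rho: "(T ^^ Suc j) x \<le> T c - \<rho>" if "j < k" for j
      using conv[OF g(3)[OF that]] it_range[OF x01] by simp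
    obtain u w where uw: "{u, w} = {a, b}" and Tw: "T ((T ^^ k) w) \<le> T c - \<rho>" and ord:
      "((T ^^ k) u < c \<and> c < (T ^^ k) x \<and> (T ^^ k) x < (T ^^ k) w) \<or> ((T ^^ k) w < (T ^^ k) x \<and> (T ^^ k) x < c \<and> c < (T ^^ k) u)"
      by (rule ends_opposite[OF ab k br rec rho rhoT xk ea eb])
    have eu: "u \<in> precrit k \<or> u = 0 \<or> u = 1" using uw ea eb by (auto simp: doubleton_eq_iff)
    have Tu: "\<kappa> * \<rho> \<le> T c - T ((T ^^ k) u)"
      by (rule far_end_bound[OF ab k br rec rho rho0 rhoT uw Tw ord eu])
    have big: "\<kappa>1 * g \<le> gap z" if "\<kappa> * \<rho> \<le> T c - T z" for z
    proof -
      have "\<kappa>1 * g = (\<kappa> * \<rho>) powr \<alpha>"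
        unfolding \<kappa>1_def \<rho>_def using \<kappa> g \<alpha> by (simp add: powr_mult powr_powr)
      also have "\<dots> \<le> gap z" unfolding gap_def using that \<kappa> rho0 \<alpha> by (intro powr_mono2) auto
      finally show ?thesis .
    qed
    have "\<kappa> * \<rho> \<le> \<rho>" using \<kappa> rho0 by simp
    then have "\<kappa>1 * g \<le> gap ((T ^^ k) w)" by (intro big) (use Tw in auto)
    moreover have "\<kappa>1 * g \<le> gap ((T ^^ k) u)" by (rule big[OF Tu])
    ultimately show ?thesis using uw ord by (auto simp: doubleton_eq_iff)
  qed
  then show "((T ^^ k) a < c \<and> c < (T ^^ k) b) \<or> ((T ^^ k) b < c \<and> c < (T ^^ k) a)"
    "\<kappa>1 * g \<le> gap ((T ^^ k) a)" "\<kappa>1 * g \<le> gap ((T ^^ k) b)" by auto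
qed

text \<open>
  The image of the branch contains all points of gap below \<open>g\<close>. Hence the image of \<open>[e1, e2]\<close> is shorter
  than those of the two parts outside, essentially by the factor \<open>\<theta>\<close>, and by the cross-ratio inequality so is
  \<open>[e1, e2]\<close> itself, compared with each of the two parts. The comparison with both parts is essential later.
\<close>

lemma deep_interval:
  assumes ab: "0 \<le> a" "a < b" "b \<le> 1" and br: "branch k a b"
    and opp: "((T ^^ k) a < c \<and> c < (T ^^ k) b) \<or> ((T ^^ k) b < c \<and> c < (T ^^ k) a)"
    and g: "0 < g" "g \<le> gap ((T ^^ k) a)" "g \<le> gap ((T ^^ k) b)"
    and \<theta>: "0 < \<theta>" "\<theta> \<le> 1"
  obtains e1 q e2 where "a \<le> e1" "e1 < q" "q < e2" "e2 \<le> b" "(T ^^ k) q = c"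
    "e2 - e1 \<le> 8 * \<theta> * (e1 - a)" "e2 - e1 \<le> 8 * \<theta> * (b - e2)"
    "\<And>z. a \<le> z \<Longrightarrow> z \<le> b \<Longrightarrow> gap ((T ^^ k) z) < \<epsilon>1 * \<theta> * g \<Longrightarrow> e1 < z \<and> z < e2"
proof -
  let ?f = "T ^^ k"
  note S = ab(1,3) br
  obtain q where q: "a \<le> q" "q \<le> b" "?f q = c"
    by (rule it_ivt[of a b k c]) (use ab opp in auto)
  have qab: "a < q" "q < b" using q opp by (auto simp: order_le_less)
  have fR: "0 \<le> ?f z \<and> ?f z \<le> 1" if "a \<le> z" "z \<le> b" for z using it_range[of z k] that ab by auto
  have len_c: "\<bar>?f z - c\<bar> = len k z q" "\<bar>?f z - c\<bar> = len k q z" for z unfolding len_def q(3)[symmetric] by auto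
  define r where "r = (\<epsilon>1 * \<theta> * g) powr (1 / \<alpha>)"
  have eg: "0 < \<epsilon>1 * \<theta> * g" "\<epsilon>1 * \<theta> * g < g"
  proof -
    show "0 < \<epsilon>1 * \<theta> * g" using \<epsilon>1 \<theta> g by simp
    have "\<epsilon>1 * \<theta> \<le> \<epsilon>1 * 1" using \<epsilon>1 \<theta> by (intro mult_left_mono) auto
    then have "\<epsilon>1 * \<theta> < 1" using \<epsilon>1(2) by linarith
    then show "\<epsilon>1 * \<theta> * g < g" using g by simp
  qed
  have r0: "0 < r" unfolding r_def using eg(1) by (simp only: powr_gt_zero)
  have rga: "r powr \<alpha> = \<epsilon>1 * \<theta> * g" unfolding r_def using eg \<alpha> by (simp add: powr_powr)
  have conv: "T (?f z) \<le> T c - r" if "\<epsilon>1 * \<theta> * g \<le> gap (?f z)" "a \<le> z" "z \<le> b" for z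
  proof -
    have "r \<le> gap (?f z) powr (1 / \<alpha>)" unfolding r_def using that eg \<alpha> by (intro powr_mono2) auto
    also have "\<dots> = T c - T (?f z)" unfolding gap_def using \<alpha> T_max_le[of "?f z"] fR that by (simp add: powr_powr)
    finally show ?thesis by simp
  qed
  have Tq: "(T ^^ Suc k) q = T c" using q by simp
  have side: "branch (Suc k) a q \<and> branch (Suc k) q b"
  proof -
    have "?f z \<noteq> c" if "a < z" "z < b" "z \<noteq> q" for z
      using branch_inj[OF S, of z q] that q qab by auto
    then show ?thesis using br qab unfolding branch_def by (metis less_Suc_eq less_trans less_irrefl)
  qed
  obtain e1 where e1: "a \<le> e1" "e1 \<le> q" "(T ^^ Suc k) e1 = T c - r"
    by (rule it_ivt[of a q "Suc k" "T c - r"]) (use conv[of a] eg g ab qab Tq r0 in auto)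
  obtain e2 where e2: "q \<le> e2" "e2 \<le> b" "(T ^^ Suc k) e2 = T c - r"
    by (rule it_ivt[of q b "Suc k" "T c - r"]) (use conv[of b] eg g ab qab Tq r0 in auto)
  have lt: "e1 < q" "q < e2" using e1 e2 Tq r0 by (auto simp: order_le_less)
  have gape: "gap (?f e1) = \<epsilon>1 * \<theta> * g" "gap (?f e2) = \<epsilon>1 * \<theta> * g"
    using e1(3) e2(3) rga unfolding gap_def by auto
  have inside: "e1 < z \<and> z < e2" if z: "a \<le> z" "z \<le> b" "gap (?f z) < \<epsilon>1 * \<theta> * g" for z
  proof (rule ccontr)
    assume "\<not> ?thesis"
    then consider "z = e1 \<or> z = e2" | "z < e1" | "e2 < z" by linarith
    then have "T (?f z) \<le> T c - r"
    proof cases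
      case 1
      then show ?thesis using e1 e2 by auto
    next
      case 2
      then have "(T ^^ Suc k) z < (T ^^ Suc k) e1 \<and> (T ^^ Suc k) e1 < (T ^^ Suc k) q \<or> (T ^^ Suc k) q < (T ^^ Suc k) e1 \<and> (T ^^ Suc k) e1 < (T ^^ Suc k) z"
        using side z lt qab ab by (intro branch_between[of a q]) auto
      then show ?thesis using e1(3) Tq r0 by auto
    next
      case 3
      then have "(T ^^ Suc k) q < (T ^^ Suc k) e2 \<and> (T ^^ Suc k) e2 < (T ^^ Suc k) z \<or> (T ^^ Suc k) z < (T ^^ Suc k) e2 \<and> (T ^^ Suc k) e2 < (T ^^ Suc k) q"
        using side z lt qab ab by (intro branch_between[of q b]) auto
      then show ?thesis using e2(3) Tq r0 by auto
    qed
    then have "r powr \<alpha> \<le> gap (?f z)" unfolding gap_def using r0 \<alpha> by (intro powr_mono2) auto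
    then show False using z rga by simp
  qed
  define G where "G = cm / 2 * g"
  have G0: "0 < G" unfolding G_def using cm_pos g by simp
  have l1: "len k e1 q \<le> G * \<theta>"
  proof -
    have "len k e1 q \<le> cp * gap (?f e1)" using gap_bounds(2)[of "?f e1"] fR[of e1] e1 qab len_c by auto
    also have "\<dots> = (cp * \<epsilon>1) * \<theta> * g" unfolding gape by simp
    finally show ?thesis unfolding \<epsilon>1(3) G_def by (simp add: algebra_simps)
  qed
  have l2: "len k q e2 \<le> G * \<theta>"
  proof -
    have "len k q e2 \<le> cp * gap (?f e2)" using gap_bounds(2)[of "?f e2"] fR[of e2] e2 qab len_c by auto
    also have "\<dots> = (cp * \<epsilon>1) * \<theta> * g" unfolding gape by simp
    finally show ?thesis unfolding \<epsilon>1(3) G_def by (simp add: algebra_simps)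
  qed
  have Gth: "G * \<theta> \<le> G" using G0 \<theta> by simp
  have la: "2 * G \<le> len k a q"
  proof -
    have "cm * g \<le> cm * gap (?f a)" using g(2) cm_pos by (intro mult_left_mono) auto
    also have "\<dots> \<le> \<bar>?f a - c\<bar>" using gap_bounds(1)[of "?f a"] fR[of a] ab by auto
    finally show ?thesis unfolding G_def len_c(1) by simp
  qed
  have lb: "2 * G \<le> len k q b"
  proof -
    have "cm * g \<le> cm * gap (?f b)" using g(3) cm_pos by (intro mult_left_mono) auto
    also have "\<dots> \<le> \<bar>?f b - c\<bar>" using gap_bounds(1)[of "?f b"] fR[of b] ab by auto
    finally show ?thesis unfolding G_def len_c(2) by simp
  qed
  define A where "A = len k a e1"
  define B where "B = len k e2 b"
  define K where "K = len k e1 e2"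
  have A: "G \<le> A" using len_add[OF S, of a e1 q] e1 qab la l1 Gth unfolding A_def by auto
  have B: "G \<le> B" using len_add[OF S, of q e2 b] e2 qab lb l2 Gth unfolding B_def by auto
  have K: "K \<le> 2 * (G * \<theta>)" "0 \<le> K" using len_add[OF S, of e1 q e2] e1 e2 qab l1 l2 unfolding K_def by auto
  have tot: "len k a b = A + K + B"
    using len_add[OF S, of a e1 b] len_add[OF S, of e1 e2 b] e1 e2 lt qab unfolding A_def B_def K_def by auto
  have AB: "0 < A" "0 < B" using A B G0 by auto
  have KAB: "K * (A + K + B) \<le> 8 * \<theta> * (A * B)"
  proof -
    have "K * A \<le> (2 * (B * \<theta>)) * A" using K B \<theta> AB by (intro mult_right_mono order_trans[OF K(1)]) auto
    moreover have "K * B \<le> (2 * (A * \<theta>)) * B" using K A \<theta> AB by (intro mult_right_mono order_trans[OF K(1)]) auto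
    moreover have "K * K \<le> (2 * (A * \<theta>)) * (2 * (B * 1))"
    proof (rule mult_mono)
      show "K \<le> 2 * (A * \<theta>)" using mult_right_mono[OF A, of \<theta>] K \<theta> by linarith
      show "K \<le> 2 * (B * 1)" using K Gth B by auto
    qed (use K AB \<theta> in auto)
    ultimately show ?thesis by (simp add: algebra_simps)
  qed
  have "(e2 - e1) * (b - a) * (A * B) \<le> (e1 - a) * (b - e2) * (K * (A + K + B))"
    using cross_ratio_len[OF S, of a e1 e2 b] e1 e2 lt qab tot unfolding A_def B_def K_def by auto
  also have "\<dots> \<le> (e1 - a) * (b - e2) * (8 * \<theta> * (A * B))"
    using KAB e1 e2 by (intro mult_left_mono) auto
  finally have "(A * B) * ((e2 - e1) * (b - a)) \<le> (A * B) * (8 * \<theta> * ((e1 - a) * (b - e2)))" by (simp add: algebra_simps)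
  then have main: "(e2 - e1) * (b - a) \<le> 8 * \<theta> * ((e1 - a) * (b - e2))" using AB by (simp add: mult_le_cancel_left)
  have "8 * \<theta> * ((e1 - a) * (b - e2)) \<le> 8 * \<theta> * ((e1 - a) * (b - a))"
    using \<theta> e1 e2 lt by (intro mult_left_mono) auto
  with main have "(b - a) * (e2 - e1) \<le> (b - a) * (8 * \<theta> * (e1 - a))" by (simp add: algebra_simps)
  then have m1: "e2 - e1 \<le> 8 * \<theta> * (e1 - a)" using ab by (simp add: mult_le_cancel_left)
  have "8 * \<theta> * ((e1 - a) * (b - e2)) \<le> 8 * \<theta> * ((b - a) * (b - e2))"
    using \<theta> e1 e2 lt qab by (intro mult_left_mono mult_right_mono) auto
  with main have "(b - a) * (e2 - e1) \<le> (b - a) * (8 * \<theta> * (b - e2))" by (simp add: algebra_simps)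
  then have m2: "e2 - e1 \<le> 8 * \<theta> * (b - e2)" using ab by (simp add: mult_le_cancel_left)
  show thesis by (rule that[OF e1(1) lt e2(2) q(3) m1 m2 inside])
qed

end

section \<open>Measure of the set of deep approaches\<close>

text \<open>
  An upper bound for the outer measure; working with covers avoids measurability of the sets involved.
\<close>

definition covered :: "real set \<Rightarrow> real \<Rightarrow> bool" where
  "covered X m \<longleftrightarrow> 0 \<le> m \<and> (\<exists>V\<in>sets lborel. X \<subseteq> V \<and> emeasure lborel V \<le> ennreal m)"

lemma covered_mono: "covered X m \<Longrightarrow> Y \<subseteq> X \<Longrightarrow> m \<le> n \<Longrightarrow> covered Y n"
  unfolding covered_def by (meson ennreal_leI order_trans)

lemma covered_Un:
  assumes "covered X m" "covered Y n" shows "covered (X \<union> Y) (m + n)"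
proof -
  obtain V where V: "V \<in> sets lborel" "X \<subseteq> V" "emeasure lborel V \<le> ennreal m" using assms by (auto simp: covered_def)
  obtain W where W: "W \<in> sets lborel" "Y \<subseteq> W" "emeasure lborel W \<le> ennreal n" using assms by (auto simp: covered_def)
  have mn: "0 \<le> m" "0 \<le> n" using assms by (auto simp: covered_def)
  have "emeasure lborel (V \<union> W) \<le> emeasure lborel V + emeasure lborel W" by (rule emeasure_subadditive[OF V(1) W(1)])
  also have "\<dots> \<le> ennreal m + ennreal n" by (rule add_mono[OF V(3) W(3)])
  also have "\<dots> = ennreal (m + n)" using mn by simp
  finally show ?thesis unfolding covered_def using V W mn by (intro conjI bexI[of _ "V \<union> W"]) auto
qed

lemma covered_point: "covered {x} 0"
  unfolding covered_def by (intro conjI bexI[of _ "{x}"]) auto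

lemma covered_empty: "0 \<le> m \<Longrightarrow> covered {} m"
  unfolding covered_def by (intro conjI bexI[of _ "{}"]) auto

lemma covered_interval: "d \<le> e \<Longrightarrow> covered {d<..<e} (e - d)"
  unfolding covered_def by (intro conjI bexI[of _ "{d<..<e}"]) auto

lemma covered_UN:
  assumes "finite I" "\<And>i. i \<in> I \<Longrightarrow> covered (X i) (m i)"
  shows "covered (\<Union>i\<in>I. X i) (\<Sum>i\<in>I. m i)"
  using assms by (induction I rule: finite_induct) (auto intro: covered_empty covered_Un)

context nonflat_trap_free
begin

definition cell :: "nat \<Rightarrow> real \<Rightarrow> real \<Rightarrow> bool" where
  "cell k a b \<longleftrightarrow> 0 \<le> a \<and> a < b \<and> b \<le> 1 \<and> branch k a b \<and> (a \<in> precrit k \<or> a = 0) \<and> (b \<in> precrit k \<or> b = 1)"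

definition deep :: "nat \<Rightarrow> nat \<Rightarrow> real \<Rightarrow> bool" where
  "deep k s x \<longleftrightarrow> (\<exists>a b. cell k a b \<and> a < x \<and> x < b \<and>
     (((T ^^ k) a < c \<and> c < (T ^^ k) b) \<or> ((T ^^ k) b < c \<and> c < (T ^^ k) a)) \<and>
     gap ((T ^^ k) x) < \<epsilon>1 * (1 / 4) ^ s * min (gap ((T ^^ k) a)) (gap ((T ^^ k) b)))"

text \<open>
  The points whose approaches at the times in \<open>ks\<close> have depths of sum at least \<open>S\<close>; depth \<open>0\<close> imposes no
  condition.
\<close>

definition total_depth :: "nat list \<Rightarrow> nat \<Rightarrow> real set" where
  "total_depth ks S = {x. \<exists>\<sigma>::nat \<Rightarrow> nat. S \<le> (\<Sum>k\<leftarrow>ks. \<sigma> k) \<and> (\<forall>k\<in>set ks. \<sigma> k = 0 \<or> deep k (\<sigma> k) x)}"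

lemma deep_mono:
  assumes "deep k s x" "s' \<le> s" shows "deep k s' x"
proof -
  from assms(1) obtain a b where ab: "cell k a b" "a < x" "x < b"
     "((T ^^ k) a < c \<and> c < (T ^^ k) b) \<or> ((T ^^ k) b < c \<and> c < (T ^^ k) a)"
     "gap ((T ^^ k) x) < \<epsilon>1 * (1 / 4) ^ s * min (gap ((T ^^ k) a)) (gap ((T ^^ k) b))"
    unfolding deep_def by blast
  have "\<epsilon>1 * (1 / 4) ^ s * min (gap ((T ^^ k) a)) (gap ((T ^^ k) b)) \<le> \<epsilon>1 * (1 / 4) ^ s' * min (gap ((T ^^ k) a)) (gap ((T ^^ k) b))"
    using assms(2) \<epsilon>1 gap_nonneg by (intro mult_right_mono mult_left_mono power_decreasing) auto
  then show ?thesis unfolding deep_def using ab by (intro exI[of _ a] exI[of _ b]) auto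
qed

lemma total_depth_Cons:
  assumes "x \<in> total_depth (k # ks) S"
  shows "\<exists>s\<le>S. (s = 0 \<or> deep k s x) \<and> x \<in> total_depth ks (S - s)"
proof -
  obtain \<sigma> :: "nat \<Rightarrow> nat" where \<sigma>: "S \<le> \<sigma> k + (\<Sum>k\<leftarrow>ks. \<sigma> k)" "\<sigma> k = 0 \<or> deep k (\<sigma> k) x"
    "\<forall>k\<in>set ks. \<sigma> k = 0 \<or> deep k (\<sigma> k) x"
    using assms unfolding total_depth_def by auto
  have "min (\<sigma> k) S = 0 \<or> deep k (min (\<sigma> k) S) x" using \<sigma>(2) deep_mono by (metis min.cobounded1 min_0L)
  moreover have "x \<in> total_depth ks (S - min (\<sigma> k) S)"
    unfolding total_depth_def using \<sigma> by (auto intro!: exI[of _ \<sigma>])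
  ultimately show ?thesis by (intro exI[of _ "min (\<sigma> k) S"]) auto
qed

lemma cell_contains:
  assumes "cell k a b" "a < x" "x < b" "0 \<le> d" "d < x" "x < e" "e \<le> 1" "{d<..<e} \<inter> precrit k = {}"
  shows "a \<le> d" "e \<le> b"
proof -
  show "a \<le> d"
  proof (rule ccontr)
    assume "\<not> a \<le> d"
    then have "a \<in> {d<..<e}" using assms by auto
    moreover have "a \<in> precrit k" using assms \<open>\<not> a \<le> d\<close> unfolding cell_def by auto
    ultimately show False using assms(8) by blast
  qed
  show "e \<le> b"
  proof (rule ccontr)
    assume "\<not> e \<le> b"
    then have "b \<in> {d<..<e}" using assms by auto
    moreover have "b \<in> precrit k" using assms \<open>\<not> e \<le> b\<close> unfolding cell_def by auto
    ultimately show False using assms(8) by blast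
  qed
qed

lemma cell_precrit: "cell k a b \<Longrightarrow> {a<..<b} \<inter> precrit k = {}"
  using branch_iff[of a b k] unfolding cell_def by auto

lemma cell_unique:
  assumes "cell k a b" "a < x" "x < b" "cell k a' b'" "a' < x" "x < b'"
  shows "a = a'" "b = b'"
  using cell_contains[OF assms(1-3), of a' b'] cell_contains[OF assms(4-6), of a b]
    cell_precrit[OF assms(1)] cell_precrit[OF assms(4)] assms unfolding cell_def by force+

text \<open>
  An interval with one end at a preimage of \<open>c\<close> is cut by further preimages into pieces of the same kind.
\<close>

lemma covered_split:
  assumes base: "\<And>d e. 0 \<le> d \<Longrightarrow> d \<le> e \<Longrightarrow> e \<le> 1 \<Longrightarrow> d \<in> precrit k \<union> {0, 1} \<or> e \<in> precrit k \<union> {0, 1} \<Longrightarrow>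
      {d<..<e} \<inter> precrit k = {} \<Longrightarrow> covered (X \<inter> {d<..<e}) (C * (e - d))"
    and de: "0 \<le> d" "d \<le> e" "e \<le> 1" "d \<in> precrit k \<union> {0, 1} \<or> e \<in> precrit k \<union> {0, 1}"
  shows "covered (X \<inter> {d<..<e}) (C * (e - d))"
  using de
proof (induction "card ({d<..<e} \<inter> precrit k)" arbitrary: d e rule: less_induct)
  case less
  show ?case
  proof (cases "{d<..<e} \<inter> precrit k = {}")
    case True
    then show ?thesis using base less.prems by blast
  next
    case False
    then obtain z where z: "d < z" "z < e" "z \<in> precrit k" by auto
    have fin: "finite ({d<..<e} \<inter> precrit k)" using finite_precrit by auto
    have l: "covered (X \<inter> {d<..<z}) (C * (z - d))"
    proof (rule less.hyps)
      show "card ({d<..<z} \<inter> precrit k) < card ({d<..<e} \<inter> precrit k)"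
        by (rule psubset_card_mono[OF fin]) (use z in auto)
    qed (use z less.prems in auto)
    have r: "covered (X \<inter> {z<..<e}) (C * (e - z))"
    proof (rule less.hyps)
      show "card ({z<..<e} \<inter> precrit k) < card ({d<..<e} \<inter> precrit k)"
        by (rule psubset_card_mono[OF fin]) (use z in auto)
    qed (use z less.prems in auto)
    have "covered ((X \<inter> {d<..<z} \<union> X \<inter> {z<..<e}) \<union> {z}) ((C * (z - d) + C * (e - z)) + 0)"
      by (intro covered_Un l r covered_point)
    then show ?thesis by (rule covered_mono) (auto simp: algebra_simps)
  qed
qed

text \<open>
  The deep points form an interval around a preimage \<open>q\<close> of \<open>c\<close>, whose two halves are again intervals with
  an end at a preimage of \<open>c\<close>, of order below \<open>k + 1\<close>, so that the induction hypothesis applies. An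
  interval \<open>(d, e)\<close> that is only a part of the cell, but shares an end with it, either misses the deep points
  or contains all of the cell on one side of them; in the second case it is long compared with the deep
  interval. This makes the estimate independent of how \<open>(d, e)\<close> was cut off by approaches at earlier times.
\<close>

lemma covered_deep:
  assumes de: "0 \<le> d" "d \<le> e" "e \<le> 1" "d \<in> precrit k \<union> {0, 1} \<or> e \<in> precrit k \<union> {0, 1}"
    and np: "{d<..<e} \<inter> precrit k = {}" and C: "0 \<le> C"
    and IH: "\<And>d e. 0 \<le> d \<Longrightarrow> d \<le> e \<Longrightarrow> e \<le> 1 \<Longrightarrow> d \<in> precrit (Suc k) \<union> {0, 1} \<or> e \<in> precrit (Suc k) \<union> {0, 1} \<Longrightarrow>
      covered (X \<inter> {d<..<e}) (C * (e - d))"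
  shows "covered ({x. deep k s x} \<inter> X \<inter> {d<..<e}) (C * (8 * (1 / 4) ^ s * (e - d)))"
proof (cases "\<exists>x0. deep k s x0 \<and> d < x0 \<and> x0 < e")
  case False
  then have "{x. deep k s x} \<inter> X \<inter> {d<..<e} = {}" by auto
  then show ?thesis using covered_empty C de by simp
next
  case True
  then obtain x0 where x0: "deep k s x0" "d < x0" "x0 < e" by auto
  obtain a b where ab: "cell k a b" "a < x0" "x0 < b"
     and opp: "((T ^^ k) a < c \<and> c < (T ^^ k) b) \<or> ((T ^^ k) b < c \<and> c < (T ^^ k) a)"
    using x0(1) unfolding deep_def by blast
  have ab': "0 \<le> a" "a < b" "b \<le> 1" "branch k a b" using ab(1) unfolding cell_def by auto
  have in1: "a \<le> d" "e \<le> b" using cell_contains[OF ab de(1) x0(2,3) de(3) np] .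
  define g where "g = min (gap ((T ^^ k) a)) (gap ((T ^^ k) b))"
  have fR: "0 \<le> (T ^^ k) a" "(T ^^ k) a \<le> 1" "0 \<le> (T ^^ k) b" "(T ^^ k) b \<le> 1"
    using it_range[of a k] it_range[of b k] ab' by auto
  have g: "0 < g" "g \<le> gap ((T ^^ k) a)" "g \<le> gap ((T ^^ k) b)"
    unfolding g_def using opp fR by (auto intro!: gap_pos)
  have th: "0 < (1 / 4 :: real) ^ s" "(1 / 4 :: real) ^ s \<le> 1" by (auto intro: power_le_one)
  obtain e1 q e2 where e: "a \<le> e1" "e1 < q" "q < e2" "e2 \<le> b" "(T ^^ k) q = c"
    "e2 - e1 \<le> 8 * (1 / 4) ^ s * (e1 - a)" "e2 - e1 \<le> 8 * (1 / 4) ^ s * (b - e2)"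
    "\<And>z. a \<le> z \<Longrightarrow> z \<le> b \<Longrightarrow> gap ((T ^^ k) z) < \<epsilon>1 * (1 / 4) ^ s * g \<Longrightarrow> e1 < z \<and> z < e2"
    using deep_interval[OF ab' opp g th] by blast
  have q: "q \<in> precrit (Suc k)" unfolding precrit_def using e ab' by auto
  have sub: "e1 < x \<and> x < e2" if x: "deep k s x" "d < x" "x < e" for x
  proof -
    obtain a' b' where x': "cell k a' b'" "a' < x" "x < b'"
      and gx: "gap ((T ^^ k) x) < \<epsilon>1 * (1 / 4) ^ s * min (gap ((T ^^ k) a')) (gap ((T ^^ k) b'))"
      using x(1) unfolding deep_def by blast
    have "a' = a" "b' = b" using cell_unique[OF x' ab(1)] in1 x by auto
    then show ?thesis using e(8)[of x] gx x' unfolding g_def by auto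
  qed
  have "covered (((X \<inter> {e1<..<q}) \<union> (X \<inter> {q<..<e2})) \<union> {q}) ((C * (q - e1) + C * (e2 - q)) + 0)"
    by (intro covered_Un covered_point IH) (use e ab' q in auto)
  moreover have "{x. deep k s x} \<inter> X \<inter> {d<..<e} \<subseteq> ((X \<inter> {e1<..<q}) \<union> (X \<inter> {q<..<e2})) \<union> {q}"
    using sub by fastforce
  moreover have "(C * (q - e1) + C * (e2 - q)) + 0 \<le> C * (8 * (1 / 4) ^ s * (e - d))"
  proof -
    have x0e: "e1 < x0" "x0 < e2" using sub[OF x0] by auto
    \<comment> \<open>the interval \<open>(d, e)\<close> shares an end with the cell\<close>
    have "d = a \<or> e = b"
    proof -
      have "d = a" if dd: "d \<in> precrit k \<union> {0, 1}"
      proof (rule ccontr)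
        assume "d \<noteq> a"
        then have "a < d" "d < b" "0 < d" "d < 1" using in1 ab' x0 de by linarith+
        then show False using dd cell_precrit[OF ab(1)] by auto
      qed
      moreover have "e = b" if ee: "e \<in> precrit k \<union> {0, 1}"
      proof (rule ccontr)
        assume "e \<noteq> b"
        then have "a < e" "e < b" "0 < e" "e < 1" using in1 ab' x0 de by linarith+
        then show False using ee cell_precrit[OF ab(1)] by auto
      qed
      ultimately show ?thesis using de(4) by blast
    qed
    then have "e2 - e1 \<le> 8 * (1 / 4) ^ s * (e - d)"
    proof
      assume "d = a"
      then have "8 * (1 / 4) ^ s * (e1 - a) \<le> 8 * (1 / 4) ^ s * (e - d)" using x0e x0 th by (intro mult_left_mono) auto
      then show ?thesis using e(6) by linarith
    next
      assume "e = b"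
      then have "8 * (1 / 4) ^ s * (b - e2) \<le> 8 * (1 / 4) ^ s * (e - d)" using x0e x0 th by (intro mult_left_mono) auto
      then show ?thesis using e(7) by linarith
    qed
    then have "C * (e2 - e1) \<le> C * (8 * (1 / 4) ^ s * (e - d))" using C by (rule mult_left_mono)
    then show ?thesis by (simp add: algebra_simps)
  qed
  ultimately show ?thesis by (rule covered_mono)
qed

lemma sum_half_powers: "(\<Sum>s\<le>S. (1 / 2 :: real) ^ s) \<le> 2"
proof -
  have "(\<Sum>s\<le>S. (1 / 2 :: real) ^ s) = 2 - (1 / 2) ^ S" by (induction S) auto
  then show ?thesis by simp
qed

text \<open>
  Induction on the list of times: the first time splits off the deep points of depth \<open>s\<close>, with a factor
  \<open>8 * 4\<^bsup>-s\<^esup>\<close>, and the remaining times have to contribute depth \<open>S - s\<close>. Claiming decay \<open>2\<^bsup>-S\<^esup>\<close> only leaves a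
  geometric series over \<open>s\<close>.
\<close>

lemma covered_total_depth:
  assumes "sorted_wrt (<) ks" "\<forall>k\<in>set ks. K \<le> k"
    and "0 \<le> d" "d \<le> e" "e \<le> 1" "d \<in> precrit K \<union> {0, 1} \<or> e \<in> precrit K \<union> {0, 1}"
  shows "covered (total_depth ks S \<inter> {d<..<e}) (16 ^ length ks * (1 / 2) ^ S * (e - d))"
  using assms
proof (induction ks arbitrary: K d e S)
  case Nil
  show ?case
  proof (cases "S = 0")
    case True
    then show ?thesis using Nil covered_mono[OF covered_interval[of d e]] by auto
  next
    case False
    then have "total_depth [] S = {}" unfolding total_depth_def by auto
    then show ?thesis using Nil covered_empty by simp
  qed
next
  case (Cons k ks)
  have ks: "sorted_wrt (<) ks" "\<forall>k'\<in>set ks. Suc k \<le> k'" "\<forall>k'\<in>set ks. k \<le> k'" using Cons.prems(1) by auto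
  have ends: "d \<in> precrit k \<union> {0, 1} \<or> e \<in> precrit k \<union> {0, 1}"
    using Cons.prems(2,6) precrit_mono[of K k] by auto
  let ?n = "length ks"
  show ?case
  proof (rule covered_split[where k = k, OF _ Cons.prems(3,4,5) ends])
    fix d e :: real
    assume de: "0 \<le> d" "d \<le> e" "e \<le> 1" "d \<in> precrit k \<union> {0, 1} \<or> e \<in> precrit k \<union> {0, 1}" "{d<..<e} \<inter> precrit k = {}"
    define Y where "Y s = {x. s = 0 \<or> deep k s x} \<inter> total_depth ks (S - s) \<inter> {d<..<e}" for s
    \<comment> \<open>the estimate for depth \<open>s\<close> at the first time, as \<open>4\<^bsup>-s\<^esup> 2\<^bsup>-(S-s)\<^esup> = 2\<^bsup>-S\<^esup> 2\<^bsup>-s\<^esup>\<close>\<close>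
    define m where "m s = 8 * 16 ^ ?n * (1 / 2) ^ S * (e - d) * (1 / 2) ^ s" for s :: nat
    have Y: "covered (Y s) (m s)" if "s \<le> S" for s
    proof (cases "s = 0")
      case True
      have "covered (total_depth ks S \<inter> {d<..<e}) (16 ^ ?n * (1 / 2) ^ S * (e - d))"
        by (rule Cons.IH[OF ks(1,3) de(1-4)])
      moreover have "16 ^ ?n * (1 / 2) ^ S * (e - d) \<le> m s" unfolding m_def using True de by simp
      ultimately show ?thesis unfolding Y_def using True by (elim covered_mono) auto
    next
      case False
      have "covered ({x. deep k s x} \<inter> total_depth ks (S - s) \<inter> {d<..<e}) (16 ^ ?n * (1 / 2) ^ (S - s) * (8 * (1 / 4) ^ s * (e - d)))"
        by (rule covered_deep[OF de]) (auto intro: Cons.IH[OF ks(1,2)])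
      moreover have "16 ^ ?n * (1 / 2) ^ (S - s) * (8 * (1 / 4) ^ s * (e - d)) = m s"
      proof -
        have "(1 / 2 :: real) ^ (S - s) * (1 / 4) ^ s = (1 / 2) ^ (S - s) * ((1 / 2) ^ s * (1 / 2) ^ s)"
          by (simp add: power_mult_distrib[symmetric])
        also have "\<dots> = (1 / 2) ^ S * (1 / 2) ^ s" using that by (simp add: power_add[symmetric])
        finally have eq: "(1 / 2 :: real) ^ (S - s) * (1 / 4) ^ s = (1 / 2) ^ S * (1 / 2) ^ s" .
        have "16 ^ ?n * (1 / 2) ^ (S - s) * (8 * (1 / 4) ^ s * (e - d))
          = 8 * 16 ^ ?n * ((1 / 2) ^ (S - s) * (1 / 4) ^ s) * (e - d)" by (simp only: ac_simps)
        also have "\<dots> = m s" unfolding eq m_def by (simp only: ac_simps)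
        finally show ?thesis .
      qed
      ultimately show ?thesis unfolding Y_def using False by (elim covered_mono) auto
    qed
    have "covered (\<Union>s\<in>{..S}. Y s) (\<Sum>s\<in>{..S}. m s)" by (rule covered_UN) (use Y in auto)
    moreover have "total_depth (k # ks) S \<inter> {d<..<e} \<subseteq> (\<Union>s\<in>{..S}. Y s)"
      using total_depth_Cons unfolding Y_def by fastforce
    moreover have "(\<Sum>s\<in>{..S}. m s) \<le> 16 ^ length (k # ks) * (1 / 2) ^ S * (e - d)"
    proof -
      have "(\<Sum>s\<in>{..S}. m s) = 8 * 16 ^ ?n * (1 / 2) ^ S * (e - d) * (\<Sum>s\<le>S. (1 / 2) ^ s)"
        unfolding m_def by (simp add: sum_distrib_left)
      also have "\<dots> \<le> 8 * 16 ^ ?n * (1 / 2) ^ S * (e - d) * 2"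
        using sum_half_powers de by (intro mult_left_mono) auto
      finally show ?thesis by simp
    qed
    ultimately show "covered (total_depth (k # ks) S \<inter> {d<..<e}) (16 ^ length (k # ks) * (1 / 2) ^ S * (e - d))"
      by (rule covered_mono)
  qed
qed

end

section \<open>Separated sets of times\<close>

definition separated :: "nat \<Rightarrow> nat \<Rightarrow> nat set set" where
  "separated R n = {A. A \<subseteq> {..<n} \<and> (\<forall>i\<in>A. \<forall>j\<in>A. i < j \<longrightarrow> R \<le> j - i)}"

lemma finite_separated: "finite (separated R n)"
  unfolding separated_def by simp

lemma separated_Suc:
  assumes "1 \<le> R"
  shows "separated R (Suc n) \<subseteq> separated R n \<union> insert n ` separated R (Suc n - R)"
proof
  fix A assume A: "A \<in> separated R (Suc n)"
  show "A \<in> separated R n \<union> insert n ` separated R (Suc n - R)"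
  proof (cases "n \<in> A")
    case False
    then have "A \<in> separated R n" using A unfolding separated_def by (auto simp: less_Suc_eq)
    then show ?thesis by simp
  next
    case True
    have "i < Suc n - R" if "i \<in> A - {n}" for i
    proof -
      have "i < n" "R \<le> n - i" using A that True unfolding separated_def by (auto simp: less_Suc_eq)
      then show ?thesis by linarith
    qed
    then have "A - {n} \<in> separated R (Suc n - R)" using A unfolding separated_def by auto
    moreover have "A = insert n (A - {n})" using True by auto
    ultimately show ?thesis by blast
  qed
qed

text \<open>
  Removing the largest element gives the recursion \<open>F (n + 1) \<le> F n + Q * F (n + 1 - R)\<close>. Its growth rate
  tends to \<open>1\<close> as \<open>R\<close> grows, whatever \<open>Q\<close> is.
\<close>

lemma separated_sum_bound:
  fixes Q b :: real
  assumes "1 \<le> R" "0 \<le> Q" "1 \<le> b" "Q * b \<le> (b - 1) * b ^ R"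
  shows "(\<Sum>A\<in>separated R n. Q ^ card A) \<le> (1 + Q * R) * b ^ n"
proof -
  define F where "F n = (\<Sum>A\<in>separated R n. Q ^ card A)" for n
  have "separated R 0 = {{}}" unfolding separated_def by auto
  then have F0: "F 0 = 1" unfolding F_def by simp
  have FS: "F (Suc n) \<le> F n + Q * F (Suc n - R)" for n
  proof -
    have "F (Suc n) \<le> (\<Sum>A\<in>separated R n \<union> insert n ` separated R (Suc n - R). Q ^ card A)"
      unfolding F_def by (rule sum_mono2) (use finite_separated separated_Suc assms in auto)
    also have "\<dots> \<le> F n + (\<Sum>A\<in>insert n ` separated R (Suc n - R). Q ^ card A)"
      unfolding F_def using assms finite_separated by (subst sum_Un) (auto intro!: sum_nonneg)
    also have "(\<Sum>A\<in>insert n ` separated R (Suc n - R). Q ^ card A) \<le> (\<Sum>A\<in>separated R (Suc n - R). Q ^ card (insert n A))"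
      using sum_image_le[of "separated R (Suc n - R)" "\<lambda>A. Q ^ card A" "insert n"] assms finite_separated
      by (simp add: comp_def)
    also have "\<dots> = Q * F (Suc n - R)"
      unfolding F_def sum_distrib_left
    proof (rule sum.cong[OF refl])
      fix A assume "A \<in> separated R (Suc n - R)"
      then have "A \<subseteq> {..<Suc n - R}" unfolding separated_def by auto
      then have "finite A" "n \<notin> A" using assms finite_subset by auto
      then show "Q ^ card (insert n A) = Q * Q ^ card A" by simp
    qed
    finally show ?thesis by simp
  qed
  have small: "F n \<le> 1 + Q * n" if "n \<le> R" for n
    using that
  proof (induction n)
    case 0
    then show ?case using F0 by simp
  next
    case (Suc n)
    then have "Suc n - R = 0" by simp
    then show ?case using FS[of n] F0 Suc by (simp add: algebra_simps)
  qed
  have "F n \<le> (1 + Q * R) * b ^ n"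
  proof (induction n rule: less_induct)
    case (less n)
    have C: "0 \<le> 1 + Q * R" using assms by simp
    show ?case
    proof (cases "n \<le> R")
      case True
      have "F n \<le> 1 + Q * n" using small True by simp
      also have "\<dots> \<le> (1 + Q * R) * 1" using True assms by (simp add: mult_left_mono)
      also have "\<dots> \<le> (1 + Q * R) * b ^ n" using C assms by (intro mult_left_mono) auto
      finally show ?thesis .
    next
      case False
      then obtain m where n: "n = Suc m" "R \<le> m" by (cases n) auto
      have "F n \<le> F m + Q * F (Suc m - R)" using FS n by simp
      also have "\<dots> \<le> (1 + Q * R) * b ^ m + Q * ((1 + Q * R) * b ^ (Suc m - R))"
        using less.IH[of m] less.IH[of "Suc m - R"] n assms by (intro add_mono mult_left_mono) auto
      also have "Q * ((1 + Q * R) * b ^ (Suc m - R)) = (1 + Q * R) * (Q * b * b ^ (m - R))"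
        using n by (simp add: Suc_diff_le)
      also have "\<dots> \<le> (1 + Q * R) * ((b - 1) * b ^ R * b ^ (m - R))"
        using assms C by (intro mult_left_mono mult_right_mono) auto
      also have "(b - 1) * b ^ R * b ^ (m - R) = (b - 1) * b ^ m"
        using n by (simp add: power_add[symmetric])
      finally show ?thesis using n by (simp add: algebra_simps)
    qed
  qed
  then show ?thesis unfolding F_def .
qed

section \<open>Almost every orbit approaches the critical point subexponentially\<close>

context nonflat_trap_free
begin

definition closest_time :: "nat \<Rightarrow> real \<Rightarrow> bool" where
  "closest_time k x \<longleftrightarrow> (\<forall>j<k. gap ((T ^^ k) x) < gap ((T ^^ j) x))"

definition \<kappa>2 :: real where "\<kappa>2 = \<epsilon>1 * \<kappa>1 / 4"

lemma \<kappa>2: "0 < \<kappa>2"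
  unfolding \<kappa>2_def using \<epsilon>1 \<kappa>1 by simp

lemma cell_exists:
  assumes "0 < x" "x < 1" "\<And>j. (T ^^ j) x \<noteq> c"
  obtains a b where "cell k a b" "a < x" "x < b"
proof -
  have np: "x \<notin> precrit k" using assms unfolding precrit_def by auto
  have b0: "branch k x x" unfolding branch_def by auto
  obtain b where b: "x \<le> b" "b \<le> 1" "branch k x b" "b \<in> precrit k \<or> b = 1 \<and> b \<notin> precrit k"
    by (rule branch_right_end[OF _ order_refl _ b0]) (use assms in auto)
  obtain a where a: "0 \<le> a" "a \<le> x" "branch k a b" "a \<in> precrit k \<or> a = 0 \<and> a \<notin> precrit k"
    by (rule branch_left_end[OF _ b(1-3)]) (use assms in auto)
  have "x < b" using b np assms by (cases "x = b") auto
  moreover have "a < x" using a np assms by (cases "x = a") auto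
  ultimately show ?thesis using that[of a b] a b unfolding cell_def by auto
qed

text \<open>
  Take for \<open>s\<close> the greatest depth of the approach; then the gap is at least \<open>\<epsilon>1 4\<^bsup>-s-1\<^esup>\<close> times
  the bound from \<open>closest_approach\<close>.
\<close>

lemma record_depth:
  assumes x: "0 < x" "x < 1" "\<And>j. (T ^^ j) x \<noteq> c" and rec: "closest_time k x"
    and g: "0 < g" "g \<le> gap 0" "\<And>j. j < k \<Longrightarrow> g \<le> gap ((T ^^ j) x)"
  shows "\<exists>s. (s = 0 \<or> deep k s x) \<and> \<kappa>2 * (1 / 4) ^ s * g \<le> gap ((T ^^ k) x)"
proof -
  have x01: "0 \<le> x" "x \<le> 1" using x by auto
  obtain a b where ab: "cell k a b" "a < x" "x < b" using cell_exists[OF x] .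
  have ab': "0 \<le> a" "b \<le> 1" "branch k a b" "a \<in> precrit k \<or> a = 0" "b \<in> precrit k \<or> b = 1"
    using ab(1) unfolding cell_def by auto
  have rec': "(T ^^ Suc j) x < (T ^^ Suc k) x" if "j < k" for j
    using rec that gap_le_iff[of "(T ^^ j) x" "(T ^^ k) x"] it_range[OF x01, of j] it_range[OF x01, of k]
    unfolding closest_time_def by force
  note ca = closest_approach[OF ab'(1) ab(2,3) ab'(2,3) rec' g x(3) ab'(4,5)]
  define r where "r = min (gap ((T ^^ k) a)) (gap ((T ^^ k) b))"
  define y where "y = gap ((T ^^ k) x)"
  have r: "\<kappa>1 * g \<le> r" unfolding r_def using ca by auto
  have r0: "0 < r" using r \<kappa>1 g by (smt (verit) mult_pos_pos)
  have y0: "0 < y" unfolding y_def using gap_pos x it_range[OF x01] by auto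
  have ex: "\<exists>s. \<epsilon>1 * (1 / 4) ^ s * r \<le> y"
  proof -
    obtain s where "(1 / 4 :: real) ^ s < y / (\<epsilon>1 * r)"
      using real_arch_pow_inv[of "y / (\<epsilon>1 * r)" "1 / 4"] y0 r0 \<epsilon>1 by auto
    then have "\<epsilon>1 * (1 / 4) ^ s * r \<le> y" using r0 \<epsilon>1 by (simp add: field_simps)
    then show ?thesis by blast
  qed
  define s where "s = (LEAST s. \<epsilon>1 * (1 / 4) ^ s * r \<le> y)"
  have s: "\<epsilon>1 * (1 / 4) ^ s * r \<le> y" unfolding s_def using ex by (rule LeastI_ex)
  have fin: "\<kappa>2 * (1 / 4) ^ t * g \<le> y" if "\<epsilon>1 * (1 / 4) ^ Suc t * r \<le> y" for t
  proof -
    have "\<kappa>2 * (1 / 4) ^ t * g = \<epsilon>1 * (1 / 4) ^ Suc t * (\<kappa>1 * g)" unfolding \<kappa>2_def by simp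
    also have "\<dots> \<le> \<epsilon>1 * (1 / 4) ^ Suc t * r" using r \<epsilon>1 by (intro mult_left_mono) auto
    finally show ?thesis using that by linarith
  qed
  show ?thesis
  proof (cases s)
    case 0
    have "\<epsilon>1 * (1 / 4) ^ Suc 0 * r \<le> \<epsilon>1 * (1 / 4) ^ s * r" using 0 r0 \<epsilon>1 by simp
    then show ?thesis using fin[of 0] s y_def by (intro exI[of _ 0]) auto
  next
    case (Suc t)
    have "\<not> \<epsilon>1 * (1 / 4) ^ t * r \<le> y" using not_less_Least[of t "\<lambda>s. \<epsilon>1 * (1 / 4) ^ s * r \<le> y"] Suc s_def by auto
    then have "deep k t x" unfolding deep_def using ab ca(1) unfolding y_def r_def by (intro exI[of _ a] exI[of _ b]) auto
    then show ?thesis using fin[of t] s Suc y_def by auto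
  qed
qed

definition running_min :: "real \<Rightarrow> real \<Rightarrow> nat \<Rightarrow> real" where
  "running_min H x k = Min (insert H ((\<lambda>i. gap ((T ^^ i) x)) ` {..<k}))"

lemma running_min_0: "running_min H x 0 = H" and running_min_Suc: "running_min H x (Suc k) = min (gap ((T ^^ k) x)) (running_min H x k)"
  by (simp_all add: running_min_def lessThan_Suc insert_commute[of H])

lemma running_min_le: "j < k \<Longrightarrow> running_min H x k \<le> gap ((T ^^ j) x)" "running_min H x k \<le> H"
  unfolding running_min_def by auto

text \<open>
  The running minimum, capped at \<open>H\<close>, changes only at closest approaches below \<open>H\<close>, each time by a
  factor controlled by the depth.
\<close>

lemma running_min_product:
  assumes H: "0 < H" "H \<le> gap 0" and x: "0 < x" "x < 1" "\<And>j. (T ^^ j) x \<noteq> c"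
    and \<delta>: "\<And>k g. closest_time k x \<Longrightarrow> 0 < g \<Longrightarrow> g \<le> gap 0 \<Longrightarrow> (\<And>j. j < k \<Longrightarrow> g \<le> gap ((T ^^ j) x)) \<Longrightarrow>
        gap ((T ^^ k) x) < H \<Longrightarrow> g = running_min H x k \<Longrightarrow> \<kappa>2 * (1 / 4) ^ \<delta> k * g \<le> gap ((T ^^ k) x)"
  defines "A \<equiv> \<lambda>n. {j. j < n \<and> closest_time j x \<and> gap ((T ^^ j) x) < H}"
  shows "0 < running_min H x n \<and> H * \<kappa>2 ^ card (A n) * (1 / 4) ^ (\<Sum>j\<in>A n. \<delta> j) \<le> running_min H x n"
proof (induction n)
  case 0
  then show ?case using H by (simp add: A_def running_min_0)
next
  case (Suc n)
  have x01: "0 \<le> x" "x \<le> 1" using x by auto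
  have gp: "0 < gap ((T ^^ n) x)" using gap_pos x it_range[OF x01] by auto
  have pos: "0 < running_min H x (Suc n)" using Suc gp running_min_Suc by simp
  have fin: "finite (A n)" unfolding A_def by simp
  show ?case
  proof (cases "closest_time n x \<and> gap ((T ^^ n) x) < H")
    case True
    then have AS: "A (Suc n) = insert n (A n)" unfolding A_def by (auto simp: less_Suc_eq)
    have nA: "n \<notin> A n" unfolding A_def by simp
    have "running_min H x n \<le> gap 0" using running_min_le(2)[of H x n] H by simp
    then have step: "\<kappa>2 * (1 / 4) ^ \<delta> n * running_min H x n \<le> gap ((T ^^ n) x)"
      using \<delta>[of n "running_min H x n"] True Suc running_min_le(1) by blast
    have "gap ((T ^^ n) x) \<le> running_min H x n"
      using True unfolding running_min_def closest_time_def by (intro Min.boundedI) (auto simp: less_imp_le)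
    then have lS: "running_min H x (Suc n) = gap ((T ^^ n) x)" unfolding running_min_Suc by simp
    have "H * \<kappa>2 ^ card (A (Suc n)) * (1 / 4) ^ (\<Sum>j\<in>A (Suc n). \<delta> j)
       = \<kappa>2 * (1 / 4) ^ \<delta> n * (H * \<kappa>2 ^ card (A n) * (1 / 4) ^ (\<Sum>j\<in>A n. \<delta> j))"
      unfolding AS using fin nA by (simp add: power_add)
    also have "\<dots> \<le> \<kappa>2 * (1 / 4) ^ \<delta> n * running_min H x n" using Suc \<kappa>2 by (intro mult_left_mono) auto
    also have "\<dots> \<le> running_min H x (Suc n)" using step lS by simp
    finally show ?thesis using pos by simp
  next
    case False
    then have AS: "A (Suc n) = A n" unfolding A_def by (auto simp: less_Suc_eq)
    have "running_min H x n \<le> gap ((T ^^ n) x)"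
    proof (cases "H \<le> gap ((T ^^ n) x)")
      case True
      then show ?thesis using running_min_le(2)[of H x n] by simp
    next
      case h: False
      then obtain j where "j < n" "gap ((T ^^ j) x) \<le> gap ((T ^^ n) x)" using False unfolding closest_time_def by (auto simp: not_less)
      then show ?thesis using running_min_le(1)[of j n H x] by simp
    qed
    then have "running_min H x (Suc n) = running_min H x n" unfolding running_min_Suc by simp
    then show ?thesis using Suc AS by simp
  qed
qed

definition fast_approach :: "real \<Rightarrow> nat \<Rightarrow> real set" where
  "fast_approach \<eta> k = {x. 0 < x \<and> x < 1 \<and> (\<forall>j. (T ^^ j) x \<noteq> c) \<and> gap ((T ^^ k) x) < exp (- \<eta> * k)}"

text \<open>
  For a point of this set let \<open>A\<close> be the set of times of closest approaches below the level \<open>H\<close>. It is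
  \<open>R\<close>-separated, and the total depth over \<open>A\<close> is at least about \<open>\<eta> k / ln 4\<close> minus a multiple of \<open>card A\<close>.
  Given \<open>A\<close>, the measure is at most a constant times \<open>Q\<^bsup>card A\<^esup> exp (- \<eta> k / 2)\<close>, and for large \<open>R\<close> the sum of
  \<open>Q\<^bsup>card A\<^esup>\<close> over all separated \<open>A\<close> grows at most like \<open>exp (\<eta> k / 4)\<close>.
\<close>

lemma covered_fast_approach:
  assumes \<eta>: "0 < \<eta>"
  obtains C where "0 \<le> C" "\<And>k. covered (fast_approach \<eta> k) (C * exp (- \<eta> / 4) ^ k)"
proof -
  define Q where "Q = 16 / sqrt \<kappa>2"
  define b where "b = exp (\<eta> / 4)"
  have Q: "0 < Q" unfolding Q_def using \<kappa>2 by simp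
  have b: "1 < b" unfolding b_def using \<eta> by simp
  \<comment> \<open>\<open>R\<close> is so large that separated sets of times do not outweigh the decay of the measure\<close>
  obtain R0 where R0: "Q * b / (b - 1) < b ^ R0" using real_arch_pow[OF b] by blast
  define R where "R = Suc R0"
  have "b ^ R0 \<le> b ^ R" by (rule power_increasing) (use b R_def in auto)
  then have "Q * b / (b - 1) \<le> b ^ R" using R0 by linarith
  then have RQ: "Q * b \<le> (b - 1) * b ^ R" using b by (simp add: field_simps)
  have R1: "1 \<le> R" unfolding R_def by simp
  obtain h0 where h0: "0 < h0" "h0 \<le> T c"
    and ret: "\<And>y t. 0 \<le> y \<Longrightarrow> y \<le> 1 \<Longrightarrow> T c - T y < h0 \<Longrightarrow> 1 \<le> t \<Longrightarrow> t < R \<Longrightarrow> h0 \<le> T c - T ((T ^^ t) y)"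
    using return_time[of R] by blast
  define H where "H = h0 powr \<alpha>"
  have H: "0 < H" unfolding H_def using h0 by (simp only: powr_gt_zero)
  have H0: "H \<le> gap 0" unfolding H_def gap_def using h0 T_0 \<alpha> by (intro powr_mono2) auto
  have gapH: "T c - T y < h0" if "gap y < H" for y
  proof (rule ccontr)
    assume "\<not> ?thesis"
    then have "H \<le> gap y" unfolding H_def gap_def using h0 \<alpha> by (intro powr_mono2) auto
    then show False using that by simp
  qed
  define C where "C = (1 + Q * R) * b / sqrt H"
  have C: "0 \<le> C" unfolding C_def using Q b H by simp
  have cov: "covered (fast_approach \<eta> k) (C * exp (- \<eta> / 4) ^ k)" for k
  proof -
    define y where "y = exp (- \<eta> * k)"
    have y0: "0 < y" unfolding y_def by simp
    \<comment> \<open>the least total depth over the times \<open>A\<close> that can bring the running minimum below \<open>y\<close>\<close>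
    define SA where "SA A = (LEAST S. H * \<kappa>2 ^ card A * (1 / 4) ^ S < y)" for A :: "nat set"
    have SA: "H * \<kappa>2 ^ card A * (1 / 4) ^ SA A < y" for A
    proof -
      have p: "0 < H * \<kappa>2 ^ card A" using H \<kappa>2 by simp
      obtain s where "(1 / 4 :: real) ^ s < y / (H * \<kappa>2 ^ card A)"
        using real_arch_pow_inv[of "y / (H * \<kappa>2 ^ card A)" "1 / 4"] y0 p by auto
      then have "H * \<kappa>2 ^ card A * (1 / 4) ^ s < y" using p by (simp add: field_simps)
      then show ?thesis unfolding SA_def by (rule LeastI)
    qed
    have half: "16 ^ card A * (1 / 2) ^ SA A \<le> sqrt y / sqrt H * Q ^ card A" for A
    proof -
      have p: "0 < H * \<kappa>2 ^ card A" using H \<kappa>2 by simp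
      have "((1 / 2 :: real) ^ SA A)\<^sup>2 = (1 / 4) ^ SA A" by (simp add: power2_eq_square power_mult_distrib[symmetric])
      then have "(1 / 2 :: real) ^ SA A = sqrt ((1 / 4) ^ SA A)" by (metis real_sqrt_unique zero_le_power zero_le_divide_1_iff zero_le_numeral)
      also have "\<dots> \<le> sqrt (y / (H * \<kappa>2 ^ card A))" using SA[of A] p by (intro real_sqrt_le_mono) (simp add: field_simps)
      also have "\<dots> = sqrt y / sqrt H * (1 / sqrt \<kappa>2) ^ card A"
        by (simp add: real_sqrt_divide real_sqrt_mult real_sqrt_power power_divide)
      finally have "16 ^ card A * (1 / 2) ^ SA A \<le> 16 ^ card A * (sqrt y / sqrt H * (1 / sqrt \<kappa>2) ^ card A)"
        by (rule mult_left_mono) simp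
      also have "\<dots> = sqrt y / sqrt H * Q ^ card A"
        unfolding Q_def by (simp add: power_divide)
      finally show ?thesis .
    qed
    define Y where "Y A = total_depth (sorted_list_of_set A) (SA A) \<inter> {0<..<1}" for A
    have cY: "covered (Y A) (sqrt y / sqrt H * Q ^ card A)" if "A \<in> separated R (Suc k)" for A
    proof -
      have "finite A" using that finite_subset unfolding separated_def by auto
      then have "covered (Y A) (16 ^ length (sorted_list_of_set A) * (1 / 2) ^ SA A * (1 - 0))"
        unfolding Y_def by (intro covered_total_depth[where K = 0]) auto
      then show ?thesis using half[of A] \<open>finite A\<close> by (elim covered_mono) auto
    qed
    have "covered (\<Union>A\<in>separated R (Suc k). Y A) (\<Sum>A\<in>separated R (Suc k). sqrt y / sqrt H * Q ^ card A)"
      by (rule covered_UN[OF finite_separated cY])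
    moreover have "(\<Sum>A\<in>separated R (Suc k). sqrt y / sqrt H * Q ^ card A) \<le> C * exp (- \<eta> / 4) ^ k"
    proof -
      have "(\<Sum>A\<in>separated R (Suc k). sqrt y / sqrt H * Q ^ card A) = sqrt y / sqrt H * (\<Sum>A\<in>separated R (Suc k). Q ^ card A)"
        by (simp add: sum_distrib_left)
      also have "\<dots> \<le> sqrt y / sqrt H * ((1 + Q * R) * b ^ Suc k)"
        using separated_sum_bound[OF R1 _ _ RQ, of "Suc k"] Q b y0 H by (intro mult_left_mono) auto
      also have "\<dots> = C * (sqrt y * b ^ k)" unfolding C_def by simp
      also have "sqrt y * b ^ k = exp (- \<eta> / 4) ^ k"
      proof -
        have "sqrt y = exp (- \<eta> / 2 * k)"
        proof (rule real_sqrt_unique)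
          show "(exp (- \<eta> / 2 * k))\<^sup>2 = y" unfolding y_def by (simp add: power2_eq_square exp_add[symmetric])
        qed simp
        then show ?thesis
          unfolding b_def by (simp add: exp_of_nat_mult[symmetric] exp_add[symmetric] algebra_simps)
      qed
      finally show ?thesis .
    qed
    moreover have "fast_approach \<eta> k \<subseteq> (\<Union>A\<in>separated R (Suc k). Y A)"
    proof
      fix x assume "x \<in> fast_approach \<eta> k"
      then have x: "0 < x" "x < 1" "\<And>j. (T ^^ j) x \<noteq> c" and gk: "gap ((T ^^ k) x) < y"
        unfolding fast_approach_def y_def by auto
      have x01: "0 \<le> x" "x \<le> 1" using x by auto
      define A where "A n = {j. j < n \<and> closest_time j x \<and> gap ((T ^^ j) x) < H}" for n
      let ?A = "A (Suc k)"
      have finA: "finite (A n)" for n unfolding A_def by simp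
      have sepA: "?A \<in> separated R (Suc k)"
      proof -
        have "R \<le> j - i" if "i \<in> ?A" "j \<in> ?A" "i < j" for i j
        proof (rule ccontr)
          assume "\<not> R \<le> j - i"
          moreover have "T c - T ((T ^^ i) x) < h0" "T c - T ((T ^^ j) x) < h0" using gapH that unfolding A_def by auto
          moreover have "1 \<le> j - i" using that by simp
          moreover have "(T ^^ j) x = (T ^^ (j - i)) ((T ^^ i) x)" using it_add[of "j - i" i x] that by simp
          ultimately show False using ret[of "(T ^^ i) x" "j - i"] it_range[OF x01, of i] that by auto
        qed
        then show ?thesis unfolding separated_def A_def by auto
      qed
      define P where "P j s \<longleftrightarrow> (s = 0 \<or> deep j s x) \<and> \<kappa>2 * (1 / 4) ^ s * running_min H x j \<le> gap ((T ^^ j) x)" for j s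
      define \<sigma> where "\<sigma> j = (if \<exists>s. P j s then SOME s. P j s else 0)" for j
      have P: "P j (\<sigma> j)" if "\<exists>s. P j s" for j unfolding \<sigma>_def using that someI_ex[of "P j"] by auto
      have \<sigma>: "\<sigma> j = 0 \<or> deep j (\<sigma> j) x" for j
      proof (cases "\<exists>s. P j s")
        case True
        then show ?thesis using P[of j] P_def by auto
      next
        case False
        then show ?thesis unfolding \<sigma>_def by (intro disjI1 if_not_P)
      qed
      have lp: "0 < running_min H x (Suc k) \<and> H * \<kappa>2 ^ card ?A * (1 / 4) ^ (\<Sum>j\<in>?A. \<sigma> j) \<le> running_min H x (Suc k)"
        unfolding A_def
      proof (rule running_min_product[OF H H0 x])
        fix j g assume "closest_time j x" "0 < g" "g \<le> gap 0" "\<And>i. i < j \<Longrightarrow> g \<le> gap ((T ^^ i) x)" "g = running_min H x j"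
        then have "\<exists>s. P j s" unfolding P_def using record_depth[OF x, of j g] by blast
        then show "\<kappa>2 * (1 / 4) ^ \<sigma> j * g \<le> gap ((T ^^ j) x)" using P \<open>g = running_min H x j\<close> unfolding P_def by blast
      qed
      have "running_min H x (Suc k) < y" using gk unfolding running_min_Suc by simp
      then have "SA ?A \<le> (\<Sum>j\<in>?A. \<sigma> j)" unfolding SA_def using lp by (intro Least_le) auto
      moreover have "(\<Sum>j\<leftarrow>sorted_list_of_set ?A. \<sigma> j) = (\<Sum>j\<in>?A. \<sigma> j)"
        using finA by (metis distinct_sorted_list_of_set set_sorted_list_of_set sum_list_distinct_conv_sum_set)
      ultimately have "x \<in> total_depth (sorted_list_of_set ?A) (SA ?A)"
        unfolding total_depth_def using \<sigma> by (auto intro!: exI[of _ \<sigma>])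
      then show "x \<in> (\<Union>A\<in>separated R (Suc k). Y A)" unfolding Y_def using sepA x by auto
    qed
    ultimately show ?thesis by (meson covered_mono)
  qed
  show ?thesis by (rule that[OF C cov])
qed

lemma slow_approach:
  fixes \<eta> :: real
  assumes \<eta>: "0 < \<eta>"
  shows "AE x in lborel. 0 < x \<and> x < 1 \<and> (\<forall>j. (T ^^ j) x \<noteq> c) \<longrightarrow>
     (\<forall>\<^sub>F k in sequentially. exp (- \<eta> * k) \<le> gap ((T ^^ k) x))"
proof -
  obtain C where C: "0 \<le> C" and cov: "\<And>k. covered (fast_approach \<eta> k) (C * exp (- \<eta> / 4) ^ k)"
    using covered_fast_approach[OF \<eta>] by blast
  define m where "m k = C * exp (- \<eta> / 4) ^ k" for k :: nat
  have "\<exists>V. V \<in> sets lborel \<and> fast_approach \<eta> k \<subseteq> V \<and> emeasure lborel V \<le> ennreal (m k)" for k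
    using cov[of k] unfolding covered_def m_def by auto
  then obtain V where V: "\<And>k. V k \<in> sets lborel" "\<And>k. fast_approach \<eta> k \<subseteq> V k" "\<And>k. emeasure lborel (V k) \<le> ennreal (m k)"
    by metis
  have m0: "0 \<le> m k" for k unfolding m_def using C by simp
  have sm: "summable (\<lambda>k. m k)" unfolding m_def using \<eta> by (intro summable_mult summable_geometric) auto
  have "AE x in lborel. \<forall>\<^sub>F k in sequentially. x \<in> space lborel - V k"
  proof (rule borel_cantelli_AE1)
    show "V k \<in> sets lborel" for k by (rule V)
    show "emeasure lborel (V k) < \<infinity>" for k
      using V(3)[of k] by (simp add: order_le_less_trans[OF _ ennreal_less_top])
    have "measure lborel (V k) \<le> m k" for k
      using V(3)[of k] m0 unfolding measure_def by (metis enn2real_leI)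
    then show "summable (\<lambda>k. measure lborel (V k))"
      by (intro summable_comparison_test'[OF sm, of 0]) auto
  qed
  then show ?thesis
  proof (eventually_elim, intro impI)
    case (elim x)
    assume x: "0 < x \<and> x < 1 \<and> (\<forall>j. (T ^^ j) x \<noteq> c)"
    from elim have "\<forall>\<^sub>F k in sequentially. x \<notin> fast_approach \<eta> k"
      by eventually_elim (use V(2) in auto)
    then show "\<forall>\<^sub>F k in sequentially. exp (- \<eta> * k) \<le> gap ((T ^^ k) x)"
      by eventually_elim (use x in \<open>auto simp: fast_approach_def not_less\<close>)
  qed
qed

end

section \<open>Lower bounds for the derivative along typical orbits\<close>

locale smooth_nonflat_trap_free =
  nonflat_trap_free T c \<sigma> \<alpha> cm cp + smooth_unimodal T c T'
  for T :: "real \<Rightarrow> real" and c \<sigma> \<alpha> cm cp :: real and T' :: "real \<Rightarrow> real"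
begin

lemma deriv_on_unit:
  assumes "0 \<le> x" "x \<le> 1" "(f has_real_derivative D) (at x within {0..1})"
  shows "deriv_on {0..1} f x = D"
  unfolding deriv_on_def using assms
  by (intro vector_derivative_within_cbox[of 0 1, unfolded cbox_interval])
    (auto simp: has_real_derivative_iff_has_vector_derivative)

text \<open>
  This is the minimum principle for maps of nonpositive Schwarzian derivative: let \<open>y\<close> tend to \<open>x\<close> in the
  cross-ratio inequality for \<open>a < x < y < b\<close>.
\<close>

lemma slope_le_derivative:
  assumes ab: "0 \<le> a" "a < x" "x < b" "b \<le> 1" "branch n a b"
    and D: "((T ^^ n) has_real_derivative D) (at x within {0..1})"
    and t: "0 < t" "t * (x - a) \<le> len n a x" "t * (b - x) \<le> len n x b"
  shows "t \<le> \<bar>D\<bar>"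
proof -
  note S = ab(1,4,5)
  define p where "p = x - a"
  define q where "q = b - x"
  define L where "L = len n a x"
  define R where "R = len n x b"
  have pq: "0 < p" "0 < q" unfolding p_def q_def using ab by auto
  have L: "t * p \<le> L" "0 < L" and R: "t * q \<le> R" "0 < R"
    using t pq len_pos[OF S, of a x] len_pos[OF S, of x b] ab unfolding p_def q_def L_def R_def by auto
  have tot: "len n a b = L + R" unfolding L_def R_def using len_add[OF S, of a x b] ab by auto
  have lim: "((\<lambda>y. ((T ^^ n) y - (T ^^ n) x) / (y - x)) \<longlongrightarrow> D) (at x within {x<..<b})"
  proof -
    have "((\<lambda>y. ((T ^^ n) y - (T ^^ n) x) / (y - x)) \<longlongrightarrow> D) (at x within {0..1})"
      using D unfolding has_field_derivative_iff .
    then show ?thesis by (rule tendsto_within_subset) (use ab in auto)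
  qed
  have lim2: "((\<lambda>y. len n x y / (y - x)) \<longlongrightarrow> \<bar>D\<bar>) (at x within {x<..<b})"
  proof (rule Lim_transform_eventually[OF tendsto_rabs[OF lim]])
    show "\<forall>\<^sub>F y in at x within {x<..<b}. \<bar>((T ^^ n) y - (T ^^ n) x) / (y - x)\<bar> = len n x y / (y - x)"
      unfolding eventually_at_filter by (auto simp: len_def abs_divide abs_minus_commute)
  qed
  have cont: "((T ^^ n) \<longlongrightarrow> (T ^^ n) x) (at x within {x<..<b})"
  proof -
    have "((T ^^ n) \<longlongrightarrow> (T ^^ n) x) (at x within {0..1})"
      using it_cont ab unfolding continuous_on_def by auto
    then show ?thesis by (rule tendsto_within_subset) (use ab in auto)
  qed
  have lim3: "((\<lambda>y. (b - a) * (L * len n y b)) \<longlongrightarrow> (b - a) * (L * R)) (at x within {x<..<b})"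
    unfolding R_def len_def by (intro tendsto_intros cont)
  have lim4: "((\<lambda>y. (x - a) * (b - y) * (len n x y / (y - x) * (L + R))) \<longlongrightarrow> (x - a) * (b - x) * (\<bar>D\<bar> * (L + R))) (at x within {x<..<b})"
    by (intro tendsto_intros lim2)
  have "(b - a) * (L * R) \<le> (x - a) * (b - x) * (\<bar>D\<bar> * (L + R))"
  proof (rule tendsto_le[OF _ lim4 lim3])
    have "x islimpt {x<..<b}" using ab by (intro islimpt_greaterThanLessThan1) auto
    then show "at x within {x<..<b} \<noteq> bot" using trivial_limit_within by blast
    have "(b - a) * (L * len n y b) \<le> (x - a) * (b - y) * (len n x y / (y - x) * (L + R))" if y: "x < y" "y < b" for y
    proof -
      have "(y - x) * (b - a) * (L * len n y b) \<le> (x - a) * (b - y) * (len n x y * (L + R))"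
        using cross_ratio_len[OF S, of a x y b] y ab tot unfolding L_def by auto
      then show ?thesis using y by (simp add: field_simps)
    qed
    then show "\<forall>\<^sub>F y in at x within {x<..<b}. (b - a) * (L * len n y b) \<le> (x - a) * (b - y) * (len n x y / (y - x) * (L + R))"
      unfolding eventually_at_filter by auto
  qed
  then have 1: "(p + q) * (L * R) \<le> p * q * (\<bar>D\<bar> * (L + R))" unfolding p_def q_def by (simp add: algebra_simps)
  have "(t * q) * (L * p) \<le> R * (L * p)" using R L pq by (intro mult_right_mono) auto
  moreover have "(t * p) * (R * q) \<le> L * (R * q)" using R L pq by (intro mult_right_mono) auto
  ultimately have "(p * q * (L + R)) * t \<le> (p + q) * (L * R)" by (simp add: algebra_simps)
  with 1 have "(p * q * (L + R)) * t \<le> (p * q * (L + R)) * \<bar>D\<bar>" by (simp add: algebra_simps)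
  moreover have "0 < p * q * (L + R)" using pq L R by simp
  ultimately show ?thesis by (simp only: mult_le_cancel_left_pos)
qed

lemma gap_lower_bound:
  assumes x: "0 < x" "x < 1" "\<And>j. (T ^^ j) x \<noteq> c" and \<eta>: "0 < \<eta>"
    and slow: "\<forall>\<^sub>F k in sequentially. exp (- \<eta> * real k) \<le> gap ((T ^^ k) x)"
  obtains C where "0 < C" "C \<le> 1" "\<And>n j. j < n \<Longrightarrow> C * exp (- \<eta> * real n) \<le> gap ((T ^^ j) x)"
proof -
  obtain N where N: "\<And>k. N \<le> k \<Longrightarrow> exp (- \<eta> * real k) \<le> gap ((T ^^ k) x)"
    using slow unfolding eventually_sequentially by auto
  define C where "C = Min (insert 1 ((\<lambda>i. gap ((T ^^ i) x)) ` {..<N}))"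
  have gp: "0 < gap ((T ^^ i) x)" for i using gap_pos x it_range[of x i] by auto
  have C: "0 < C" "C \<le> 1" "\<And>i. i < N \<Longrightarrow> C \<le> gap ((T ^^ i) x)" unfolding C_def using gp by auto
  have "C * exp (- \<eta> * real n) \<le> gap ((T ^^ j) x)" if "j < n" for n j
  proof (cases "N \<le> j")
    case True
    have "C * exp (- \<eta> * real n) \<le> 1 * exp (- \<eta> * real j)"
      using C that \<eta> by (intro mult_mono) auto
    then show ?thesis using N[OF True] by simp
  next
    case False
    have "C * exp (- \<eta> * real n) \<le> C * 1" using C \<eta> by (intro mult_left_mono) auto
    then show ?thesis using C(3)[of j] False by simp
  qed
  then show ?thesis using that C by blast
qed

text \<open>
  The branch, moved along the orbit of its end \<open>e\<close> up to the critical value, becomes an interval to which the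
  contraction estimate applies, of length at least \<open>h0\<close>. Ends of the unit interval need only a constant.
\<close>

lemma end_distance:
  assumes x: "0 < x" "x < 1" and e: "0 \<le> e" "e \<le> 1" "e \<noteq> x" and n: "1 \<le> n"
    and br: "branch n (min e x) (max e x)" and ee: "e \<in> precrit n \<or> e = 0 \<or> e = 1"
    and C: "0 < C" "\<And>m h. 0 < h \<Longrightarrow> h \<le> T c \<Longrightarrow> branch m (T c - h) (T c) \<Longrightarrow>
      C * h * 6 powr (- (real m / real R)) \<le> len m (T c - h) (T c)"
    and h0: "0 < h0" "\<And>j. j < n \<Longrightarrow> h0 \<le> T c - (T ^^ Suc j) x"
  shows "min (C * h0 * 6 powr (- (real n / real R))) (min 1 \<sigma>) * \<bar>x - e\<bar> \<le> len n e x"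
proof -
  define t where "t = min (C * h0 * 6 powr (- (real n / real R))) (min 1 \<sigma>)"
  have t0: "0 \<le> t" unfolding t_def using C h0 \<sigma>_pos by simp
  have "t * \<bar>x - e\<bar> \<le> len n e x"
  proof (cases "e \<in> precrit n")
    case True
    then obtain j where j: "j < n" "(T ^^ Suc j) e = T c" by (rule precritD)
    let ?y = "(T ^^ Suc j) x"
    have m: "n = Suc j + (n - Suc j)" "n = (n - Suc j) + Suc j" using j by auto
    have y: "0 \<le> ?y" "h0 \<le> T c - ?y" using it_range[of x "Suc j"] x h0(2)[OF j(1)] by auto
    have "branch (n - Suc j) (min ((T ^^ Suc j) (min e x)) ((T ^^ Suc j) (max e x))) (max ((T ^^ Suc j) (min e x)) ((T ^^ Suc j) (max e x)))"
      by (rule branch_image) (use x e br m in auto)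
    then have b1: "branch (n - Suc j) ?y (T c)"
      using y h0 j(2) by (auto simp: min_def max_def split: if_splits)
    have "C * h0 * 6 powr (- (real n / real R)) \<le> C * (T c - ?y) * 6 powr (- (real (n - Suc j) / real R))"
      using C h0 y by (intro mult_mono powr_mono) (auto intro: divide_right_mono)
    also have "\<dots> \<le> len (n - Suc j) ?y (T c)"
      using C(2)[of "T c - ?y" "n - Suc j"] b1 y h0 by auto
    also have "\<dots> = len n e x"
      using len_it[of "n - Suc j" "Suc j" x e] j by (simp add: len_commute add.commute)
    finally have "t \<le> len n e x" unfolding t_def by simp
    moreover have "t * \<bar>x - e\<bar> \<le> t * 1" using t0 x e by (intro mult_left_mono) auto
    ultimately show ?thesis by simp
  next
    case False
    then consider "e = 0" | "e = 1" using ee by auto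
    then show ?thesis
    proof cases
      case 1
      have "(T ^^ n) 0 = 0" by (induction n) (auto simp: T_0)
      moreover have "x \<le> (T ^^ n) x" using branch_from_0[of x n] br x 1 by auto
      moreover have "t * x \<le> 1 * x" unfolding t_def using x by (intro mult_right_mono) auto
      moreover have "len n 0 x = (T ^^ n) x" "\<bar>x - e\<bar> = x"
        using calculation(1) it_range[of x n] x 1 by (simp_all add: len_def)
      ultimately show ?thesis using 1 by simp
    next
      case 2
      have "\<sigma> * (1 - x) \<le> len n x 1" using branch_to_1[of x n] br x 2 n by auto
      moreover have "t * (1 - x) \<le> \<sigma> * (1 - x)" unfolding t_def using x by (intro mult_right_mono) auto
      ultimately have "t * (1 - x) \<le> len n x 1" by linarith
      then show ?thesis using 2 x by (simp add: len_commute)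
    qed
  qed
  then show ?thesis unfolding t_def .
qed

lemma derivative_lower_bound:
  assumes x: "0 < x" "x < 1" "\<And>j. (T ^^ j) x \<noteq> c"
    and slow: "\<And>m. \<forall>\<^sub>F k in sequentially. exp (- (1 / Suc m) * real k) \<le> gap ((T ^^ k) x)"
    and \<zeta>: "0 < \<zeta>"
  obtains K where "0 < K" "\<And>n. 1 \<le> n \<Longrightarrow> K * exp (- \<zeta> * real n) \<le> \<bar>deriv_on {0..1} (T ^^ n) x\<bar>"
proof -
  have x01: "0 \<le> x" "x \<le> 1" using x by auto
  \<comment> \<open>the rates lost through close approaches and through contraction are each below \<open>\<zeta> / 2\<close>\<close>
  obtain m where m: "1 / Suc m < \<zeta> * \<alpha> / 2"
    using reals_Archimedean[of "\<zeta> * \<alpha> / 2"] \<zeta> \<alpha> by (auto simp: inverse_eq_divide)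
  define \<eta> where "\<eta> = 1 / Suc m"
  have "\<eta> < \<zeta> / 2 * \<alpha>" using m unfolding \<eta>_def by simp
  then have "\<eta> / \<alpha> < \<zeta> / 2" using \<alpha> by (simp only: pos_divide_less_eq)
  moreover have "0 < \<eta>" unfolding \<eta>_def by simp
  ultimately have \<eta>: "0 < \<eta>" "\<eta> / \<alpha> < \<zeta> / 2" by auto
  obtain R :: nat where R: "2 * ln 6 / \<zeta> < R" using reals_Archimedean2 by blast
  have "0 < 2 * ln 6 / \<zeta>" using \<zeta> by simp
  then have R1: "1 \<le> R" using R by (cases R) auto
  have R2: "ln 6 / R < \<zeta> / 2" using R \<zeta> R1 by (simp add: field_simps)
  obtain G where G: "0 < G" "G \<le> 1" "\<And>n j. j < n \<Longrightarrow> G * exp (- \<eta> * real n) \<le> gap ((T ^^ j) x)"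
    by (rule gap_lower_bound[OF x \<eta>(1) slow[of m, folded \<eta>_def]]) blast
  obtain C where C: "0 < C" "\<And>m h. 0 < h \<Longrightarrow> h \<le> T c \<Longrightarrow> branch m (T c - h) (T c) \<Longrightarrow>
      C * h * 6 powr (- (real m / real R)) \<le> len m (T c - h) (T c)"
    using contraction[OF R1] by blast
  define K where "K = min (C * G powr (1 / \<alpha>)) (min 1 \<sigma>)"
  have K0: "0 < K" unfolding K_def using C G \<sigma>_pos by simp
  have "K * exp (- \<zeta> * real n) \<le> \<bar>deriv_on {0..1} (T ^^ n) x\<bar>" if n: "1 \<le> n" for n
  proof -
    obtain a b where ab: "cell n a b" "a < x" "x < b" using cell_exists[OF x] .
    have ab': "0 \<le> a" "b \<le> 1" "branch n a b" "a \<in> precrit n \<or> a = 0" "b \<in> precrit n \<or> b = 1"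
      using ab(1) unfolding cell_def by auto
    define h0 where "h0 = (G * exp (- \<eta> * real n)) powr (1 / \<alpha>)"
    have h0: "0 < h0" unfolding h0_def using G by simp
    have h0': "h0 \<le> T c - (T ^^ Suc j) x" if "j < n" for j
    proof -
      have "h0 \<le> gap ((T ^^ j) x) powr (1 / \<alpha>)" unfolding h0_def using G(3)[OF that] G(1) \<alpha> by (intro powr_mono2) auto
      also have "\<dots> = T c - (T ^^ Suc j) x"
        unfolding gap_def using \<alpha> T_max_le[of "(T ^^ j) x"] it_range[OF x01, of j] by (simp add: powr_powr)
      finally show ?thesis .
    qed
    define t where "t = min (C * h0 * 6 powr (- (real n / real R))) (min 1 \<sigma>)"
    have t0: "0 < t" unfolding t_def using C h0 \<sigma>_pos by simp
    have ta: "t * (x - a) \<le> len n a x"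
      using end_distance[OF x(1,2) ab'(1) _ _ n _ _ C h0 h0'] ab ab' branch_mono[OF ab'(3), of n a x] unfolding t_def by auto
    have tb: "t * (b - x) \<le> len n x b"
      using end_distance[OF x(1,2) _ ab'(2) _ n _ _ C h0 h0'] ab ab' branch_mono[OF ab'(3), of n x b] unfolding t_def by (auto simp: len_commute)
    have D: "deriv_on {0..1} (T ^^ n) x = (\<Prod>j<n. T' ((T ^^ j) x))" by (rule deriv_on_unit[OF x01 it_deriv[OF x01]])
    have tD: "t \<le> \<bar>deriv_on {0..1} (T ^^ n) x\<bar>"
      unfolding D by (rule slope_le_derivative[OF ab'(1) ab(2,3) ab'(2,3) it_deriv[OF x01] t0 ta tb])
    have e1: "exp (- \<zeta> * real n) \<le> 1" using \<zeta> by simp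
    have e2: "exp (- \<zeta> * real n) \<le> exp (- \<eta> * real n) powr (1 / \<alpha>) * 6 powr (- (real n / real R))"
    proof -
      have "exp (- \<eta> * real n) powr (1 / \<alpha>) * 6 powr (- (real n / real R)) = exp (- (\<eta> / \<alpha> + ln 6 / R) * real n)"
        by (simp add: powr_def exp_add[symmetric] algebra_simps)
      moreover have "- \<zeta> * real n \<le> - (\<eta> / \<alpha> + ln 6 / R) * real n"
      proof (rule mult_right_mono)
        show "- \<zeta> \<le> - (\<eta> / \<alpha> + ln 6 / R)" using \<eta>(2) R2 by linarith
      qed simp
      ultimately show ?thesis by simp
    qed
    have "K * exp (- \<zeta> * real n) \<le> t"
      unfolding t_def
    proof (intro min.boundedI)
      have "K * exp (- \<zeta> * real n) \<le> (C * G powr (1 / \<alpha>)) * (exp (- \<eta> * real n) powr (1 / \<alpha>) * 6 powr (- (real n / real R)))"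
        using e2 K0 by (intro mult_mono) (auto simp: K_def)
      also have "\<dots> = C * h0 * 6 powr (- (real n / real R))" unfolding h0_def using G(1) by (simp add: powr_mult)
      finally show "K * exp (- \<zeta> * real n) \<le> \<dots>" .
      have "K * exp (- \<zeta> * real n) \<le> K * 1" using e1 K0 by (intro mult_left_mono) auto
      moreover have "K \<le> 1" "K \<le> \<sigma>" unfolding K_def by auto
      ultimately show "K * exp (- \<zeta> * real n) \<le> 1" "K * exp (- \<zeta> * real n) \<le> \<sigma>" by auto
    qed
    then show ?thesis using tD by simp
  qed
  then show ?thesis using that K0 by blast
qed

lemma lower_lyapunov_nonneg:
  assumes x: "0 < x" "x < 1" "\<And>j. (T ^^ j) x \<noteq> c"
    and slow: "\<And>m. \<forall>\<^sub>F k in sequentially. exp (- (1 / Suc m) * real k) \<le> gap ((T ^^ k) x)"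
  shows "0 \<le> lower_lyapunov T x"
proof -
  have low: "ereal (- 2 * \<zeta>) \<le> lower_lyapunov T x" if \<zeta>: "0 < \<zeta>" for \<zeta> :: real
  proof -
    obtain K where K: "0 < K" "\<And>n. 1 \<le> n \<Longrightarrow> K * exp (- \<zeta> * real n) \<le> \<bar>deriv_on {0..1} (T ^^ n) x\<bar>"
      using derivative_lower_bound[OF x slow \<zeta>] by blast
    have "(\<lambda>n. ln K / real n) \<longlonglongrightarrow> 0" by (rule lim_const_over_n)
    then have ev: "\<forall>\<^sub>F n in sequentially. - \<zeta> < ln K / real n" using \<zeta> by (intro order_tendstoD) auto
    show ?thesis unfolding lower_lyapunov_def
    proof (rule Liminf_bounded)
      show "\<forall>\<^sub>F n in sequentially. ereal (- 2 * \<zeta>) \<le> ereal (1 / real n) * log_abs (deriv_on {0..1} (T ^^ n) x)"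
        using ev eventually_ge_at_top[of 1]
      proof eventually_elim
        case (elim n)
        let ?D = "deriv_on {0..1} (T ^^ n) x"
        have p: "0 < K * exp (- \<zeta> * real n)" using K by simp
        then have D: "?D \<noteq> 0" using K(2)[OF elim(2)] by auto
        have "ln K - \<zeta> * real n = ln (K * exp (- \<zeta> * real n))" using K by (simp add: ln_mult)
        also have "\<dots> \<le> ln \<bar>?D\<bar>" using K(2)[OF elim(2)] p by (rule ln_mono)
        finally have "(ln K - \<zeta> * real n) / real n \<le> ln \<bar>?D\<bar> / real n" by (rule divide_right_mono) simp
        moreover have "(ln K - \<zeta> * real n) / real n = ln K / real n - \<zeta>" using elim(2) by (simp add: diff_divide_distrib)
        ultimately have "- 2 * \<zeta> \<le> ln \<bar>?D\<bar> / real n" using elim(1) by simp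
        then show ?case using D by (simp add: log_abs_def)
      qed
    qed
  qed
  show ?thesis
  proof (rule ccontr)
    assume "\<not> ?thesis"
    then have "lower_lyapunov T x < ereal 0" by (simp add: not_le zero_ereal_def)
    then obtain r where r: "lower_lyapunov T x < ereal r" "ereal r < ereal 0" using ereal_dense2 by blast
    then have "ereal (- 2 * (- r / 2)) \<le> lower_lyapunov T x" by (intro low) auto
    then show False using r by (simp add: not_less[symmetric])
  qed
qed

lemma AE_lower_lyapunov_nonneg: "AE x in lborel. 0 \<le> x \<and> x \<le> 1 \<longrightarrow> 0 \<le> lower_lyapunov T x"
proof -
  have "AE x in lborel. \<forall>m. 0 < x \<and> x < 1 \<and> (\<forall>j. (T ^^ j) x \<noteq> c) \<longrightarrow>
     (\<forall>\<^sub>F k in sequentially. exp (- (1 / Suc m) * real k) \<le> gap ((T ^^ k) x))"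
    unfolding AE_all_countable by (intro allI slow_approach) simp
  moreover have "AE x in lborel. x \<notin> (\<Union>n. precrit n) \<union> {0, 1}"
  proof (rule AE_I')
    have "countable ((\<Union>n. precrit n) \<union> {0, 1})" using finite_precrit by (auto intro: countable_finite)
    then show "(\<Union>n. precrit n) \<union> {0, 1} \<in> null_sets lborel" by (rule countable_imp_null_set_lborel)
  qed auto
  ultimately show ?thesis
  proof eventually_elim
    case (elim x)
    show ?case
    proof
      assume "0 \<le> x \<and> x \<le> 1"
      then have x: "0 < x" "x < 1" "\<And>j. (T ^^ j) x \<noteq> c"
        using elim(2) unfolding precrit_def by (auto simp: order_le_less)
      show "0 \<le> lower_lyapunov T x" by (rule lower_lyapunov_nonneg[OF x]) (use elim(1) x in auto)
    qed
  qed
qed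

end

section \<open>Analytic properties of S-unimodal maps\<close>

lemma critical_point_unique:
  assumes "unimodal T"
  shows "0 < critical_point T" "critical_point T < 1"
    "\<And>x. 0 \<le> x \<Longrightarrow> x \<le> 1 \<Longrightarrow> deriv_on {0..1} T x = 0 \<longleftrightarrow> x = critical_point T"
proof -
  obtain d where d: "d \<in> {0<..<1}" "\<forall>x\<in>{0..1}. deriv_on {0..1} T x = 0 \<longleftrightarrow> x = d"
    using assms unfolding unimodal_def by blast
  have "critical_point T = d"
    unfolding critical_point_def by (rule the_equality) (use d in auto)
  then show "0 < critical_point T" "critical_point T < 1"
    "\<And>x. 0 \<le> x \<Longrightarrow> x \<le> 1 \<Longrightarrow> deriv_on {0..1} T x = 0 \<longleftrightarrow> x = critical_point T"
    using d by auto
qed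

lemma has_deriv_on:
  assumes "f differentiable_on S" "x \<in> S"
  shows "(f has_real_derivative deriv_on S f x) (at x within S)"
  using assms unfolding deriv_on_def differentiable_on_def has_real_derivative_iff_has_vector_derivative
  by (simp add: vector_derivative_works)

text \<open>
  On open sets the derivatives relative to the ambient set are the ordinary ones.
\<close>

lemma Ck_on_derivs:
  assumes C: "Ck_on n f S" and U: "open U" "U \<subseteq> S"
  shows "j < n \<Longrightarrow> x \<in> U \<Longrightarrow> ((deriv ^^ j) f has_real_derivative (deriv ^^ Suc j) f x) (at x)"
    and "j \<le> n \<Longrightarrow> x \<in> U \<Longrightarrow> (deriv ^^ j) f x = (deriv_on S ^^ j) f x"
proof -
  let ?D = "\<lambda>j. (deriv_on S ^^ j) f"
  have D: "(?D j has_real_derivative ?D (Suc j) x) (at x)" if "j < n" "x \<in> U" for j x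
  proof -
    have "(?D j has_real_derivative deriv_on S (?D j) x) (at x within S)"
      using C that U unfolding Ck_on_def by (intro has_deriv_on) auto
    then show ?thesis using at_within_open_subset[OF that(2) U] by simp
  qed
  have eq: "\<forall>x\<in>U. (deriv ^^ j) f x = ?D j x" if "j \<le> n" for j
    using that
  proof (induction j)
    case (Suc j)
    show ?case
    proof
      fix x assume x: "x \<in> U"
      have "((deriv ^^ j) f has_real_derivative ?D (Suc j) x) (at x)"
        by (rule has_field_derivative_transform_within_open[OF D[of j x] U(1) x]) (use Suc x in auto)
      then show "(deriv ^^ Suc j) f x = ?D (Suc j) x" by (simp add: DERIV_imp_deriv)
    qed
  qed simp
  show "(deriv ^^ j) f x = ?D j x" if "j \<le> n" "x \<in> U" for j x using eq that by blast
  show "((deriv ^^ j) f has_real_derivative (deriv ^^ Suc j) f x) (at x)" if "j < n" "x \<in> U" for j x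
  proof -
    have "((deriv ^^ j) f has_real_derivative ?D (Suc j) x) (at x)"
      by (rule has_field_derivative_transform_within_open[OF D[OF that] U(1) that(2)]) (use eq[of j] that in auto)
    moreover have "(deriv ^^ Suc j) f x = ?D (Suc j) x" using eq[of "Suc j"] that by auto
    ultimately show ?thesis by simp
  qed
qed

locale S_unimodal_map =
  fixes T :: "real \<Rightarrow> real"
  assumes S: "S_unimodal T"
begin

abbreviation (input) "c \<equiv> critical_point T"
abbreviation (input) "T' \<equiv> deriv_on {0..1} T"

lemma S_uni: "unimodal T" "Ck_on 1 T {0..1}" "Ck_on 3 T ({0..1} - {c})" "negative_schwarzian T" "T 0 = 0" "T 1 = 0"
  using S unfolding S_unimodal_def unimodal_C3_def by auto

lemmas cp = critical_point_unique[OF S_uni(1)]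

lemma S_range: "0 \<le> x \<Longrightarrow> x \<le> 1 \<Longrightarrow> 0 \<le> T x \<and> T x \<le> 1"
  using S_uni(1) unfolding unimodal_def by (auto simp: Pi_iff)

lemma S_deriv: "0 \<le> x \<Longrightarrow> x \<le> 1 \<Longrightarrow> (T has_real_derivative T' x) (at x within {0..1})"
  using S_uni(1) unfolding unimodal_def by (intro has_deriv_on) auto

lemma S_deriv_at: "0 < x \<Longrightarrow> x < 1 \<Longrightarrow> (T has_real_derivative T' x) (at x)"
  using S_deriv[of x] at_within_Icc_at[of 0 x 1] by simp

lemma S_cont: "continuous_on {0..1} T"
  using S_uni(1) unfolding unimodal_def by (auto intro: differentiable_imp_continuous_on)

lemma S_deriv_cont: "continuous_on {0..1} T'"
  using S_uni(2) unfolding Ck_on_def by simp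

lemma S_deriv_ivt:
  assumes "0 \<le> x" "x \<le> y" "y \<le> 1" "T' x \<le> 0 \<and> 0 \<le> T' y \<or> T' y \<le> 0 \<and> 0 \<le> T' x"
  shows "x \<le> c \<and> c \<le> y"
proof -
  have "continuous_on {x..y} T'" using S_deriv_cont by (rule continuous_on_subset) (use assms in auto)
  then have "\<exists>z. x \<le> z \<and> z \<le> y \<and> T' z = 0"
    using assms IVT'[of T' x 0 y] IVT2'[of T' y 0 x] by auto
  then show ?thesis using cp(3) assms by auto
qed

lemma S_deriv_pos: assumes "0 \<le> x" "x < c" shows "0 < T' x"
proof -
  obtain d where d: "0 < d" "(T has_real_derivative d) (at_right 0)" using S unfolding S_unimodal_def by auto
  have "(T has_real_derivative T' 0) (at_right 0)" using S_deriv[of 0] unfolding at_within_Icc_at_right[OF zero_less_one] by simp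
  then have "T' 0 = d"
    using d(2) unfolding has_field_derivative_iff by (intro tendsto_unique[OF trivial_limit_at_right_real]) auto
  then show ?thesis using S_deriv_ivt[of 0 x] assms cp d(1) by force
qed

lemma S_incr: assumes "0 \<le> x" "x < y" "y \<le> c" shows "T x < T y"
proof (rule DERIV_pos_imp_increasing_open[OF assms(2)])
  show "\<exists>d. (T has_real_derivative d) (at t) \<and> 0 < d" if "x < t" "t < y" for t
    using S_deriv_at[of t] S_deriv_pos[of t] that assms cp by auto
  show "continuous_on {x..y} T" using S_cont by (rule continuous_on_subset) (use assms cp in auto)
qed

lemma S_deriv_neg: assumes "c < x" "x \<le> 1" shows "T' x < 0"
proof (rule ccontr)
  assume "\<not> T' x < 0"
  then have pos: "0 < T' y" if "c < y" "y \<le> 1" for y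
    using S_deriv_ivt[of x y] S_deriv_ivt[of y x] that assms cp by (cases "x \<le> y") force+
  have "T c < T 1"
  proof (rule DERIV_pos_imp_increasing_open[OF cp(2)])
    show "\<exists>d. (T has_real_derivative d) (at t) \<and> 0 < d" if "c < t" "t < 1" for t
      using S_deriv_at[of t] pos[of t] that cp by auto
    show "continuous_on {c..1} T" using S_cont by (rule continuous_on_subset) (use cp in auto)
  qed
  then show False using S_range[of c] S_uni cp by auto
qed

lemma S_decr: assumes "c \<le> x" "x < y" "y \<le> 1" shows "T y < T x"
proof (rule DERIV_neg_imp_decreasing_open[OF assms(2)])
  show "\<exists>d. (T has_real_derivative d) (at t) \<and> d < 0" if "x < t" "t < y" for t
    using S_deriv_at[of t] S_deriv_neg[of t] that assms cp by auto
  show "continuous_on {x..y} T" using S_cont by (rule continuous_on_subset) (use assms cp in auto)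
qed

lemma S_C3:
  assumes "0 < x" "x < 1" "x \<noteq> c"
  shows "(T has_real_derivative deriv T x) (at x)"
    "(deriv T has_real_derivative (deriv ^^ 2) T x) (at x)"
    "((deriv ^^ 2) T has_real_derivative (deriv ^^ 3) T x) (at x)"
    "deriv T x = T' x"
    "(deriv ^^ 3) T x / deriv T x - 3 / 2 * ((deriv ^^ 2) T x / deriv T x)\<^sup>2 \<le> 0"
proof -
  define U where "U = {0<..<1} - {c}"
  have U: "open U" "U \<subseteq> {0..1} - {c}" "x \<in> U" unfolding U_def using assms by (auto intro: open_delete)
  note D = Ck_on_derivs(1)[OF S_uni(3) U(1,2) _ U(3)]
  show "(T has_real_derivative deriv T x) (at x)" using D[of 0] by simp
  show "(deriv T has_real_derivative (deriv ^^ 2) T x) (at x)" using D[of 1] by (simp add: numeral_2_eq_2)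
  show "((deriv ^^ 2) T has_real_derivative (deriv ^^ 3) T x) (at x)" using D[of 2] by (simp add: numeral_3_eq_3 numeral_2_eq_2)
  show "deriv T x = T' x" by (rule DERIV_imp_deriv[OF S_deriv_at[OF assms(1,2)]])
  have "schwarzian T x \<le> 0" using S_uni(4) assms unfolding negative_schwarzian_def by auto
  then show "(deriv ^^ 3) T x / deriv T x - 3 / 2 * ((deriv ^^ 2) T x / deriv T x)\<^sup>2 \<le> 0"
    unfolding schwarzian_def .
qed

lemma S_cr_left:
  assumes "0 \<le> w" "w \<le> x" "x \<le> y" "y \<le> z" "z \<le> c" shows "cross_ratio_le T w x y z"
proof -
  interpret schwarzian_nonpos T "deriv T" "(deriv ^^ 2) T" "(deriv ^^ 3) T" 0 c
    by unfold_locales (use S_C3 S_deriv_pos cp in auto)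
  show ?thesis
    by (rule cross_ratio_closed[OF continuous_on_subset[OF S_cont]]) (use assms cp in auto)
qed

lemma S_cr_right:
  assumes "c \<le> w" "w \<le> x" "x \<le> y" "y \<le> z" "z \<le> 1" shows "cross_ratio_le T w x y z"
proof -
  interpret schwarzian_nonpos "\<lambda>x. - T x" "\<lambda>x. - deriv T x" "\<lambda>x. - (deriv ^^ 2) T x" "\<lambda>x. - (deriv ^^ 3) T x" c 1
  proof
    fix x :: real assume x: "c < x" "x < 1"
    then have x': "0 < x" "x < 1" "x \<noteq> c" using cp by auto
    show "((\<lambda>x. - T x) has_real_derivative - deriv T x) (at x)" by (rule DERIV_minus[OF S_C3(1)[OF x']])
    show "((\<lambda>x. - deriv T x) has_real_derivative - (deriv ^^ 2) T x) (at x)" by (rule DERIV_minus[OF S_C3(2)[OF x']])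
    show "((\<lambda>x. - (deriv ^^ 2) T x) has_real_derivative - (deriv ^^ 3) T x) (at x)" by (rule DERIV_minus[OF S_C3(3)[OF x']])
    show "0 < - deriv T x" using S_deriv_neg[of x] x S_C3(4)[OF x'] by simp
    show "- (deriv ^^ 3) T x / - deriv T x - 3 / 2 * (- (deriv ^^ 2) T x / - deriv T x)\<^sup>2 \<le> 0"
      using S_C3(5)[OF x'] by simp
  qed
  have "cross_ratio_le (\<lambda>x. - T x) w x y z"
    by (rule cross_ratio_closed[OF continuous_on_minus[OF continuous_on_subset[OF S_cont]]]) (use assms cp in auto)
  then show ?thesis unfolding cross_ratio_le_def by (simp add: algebra_simps)
qed

text \<open>
  The derivative is bounded away from zero near \<open>1\<close> by compactness, and \<open>T 1 = 0\<close>.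
\<close>

lemma S_slope_at_1:
  obtains \<sigma> where "0 < \<sigma>" "\<And>z. c \<le> z \<Longrightarrow> z \<le> 1 \<Longrightarrow> \<sigma> * (1 - z) \<le> T z"
proof -
  define m where "m = (c + 1) / 2"
  have m: "c < m" "m < 1" "1 - c = 2 * (1 - m)" unfolding m_def using cp by (auto simp: field_simps)
  have "continuous_on {m..1} T'" using S_deriv_cont by (rule continuous_on_subset) (use m cp in auto)
  then obtain s where s: "s \<in> {m..1}" "\<And>z. z \<in> {m..1} \<Longrightarrow> T' z \<le> T' s"
    using continuous_attains_sup[of "{m..1}" T'] m by auto
  define d where "d = - T' s"
  have d: "0 < d" unfolding d_def using S_deriv_neg[of s] s m by auto
  have near: "d * (1 - z) \<le> T z" if z: "m \<le> z" "z \<le> 1" for z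
  proof (cases "z = 1")
    case False
    then have "z < 1" using z by simp
    moreover have "continuous_on {z..1} T" using S_cont by (rule continuous_on_subset) (use z m cp in auto)
    moreover have "T differentiable (at x)" if "z < x" "x < 1" for x
      unfolding real_differentiable_def using S_deriv_at[of x] that z m cp by auto
    ultimately obtain l y where y: "z < y" "y < 1" "(T has_real_derivative l) (at y)" "T 1 - T z = (1 - z) * l"
      using MVT[of z 1 T] by blast
    have "l = T' y" using DERIV_unique[OF y(3) S_deriv_at[of y]] y z m cp by auto
    then have "l \<le> - d" using s(2)[of y] y z unfolding d_def by auto
    then have "(1 - z) * l \<le> (1 - z) * (- d)" using z by (intro mult_left_mono) auto
    then show ?thesis using y(4) S_uni by (simp add: algebra_simps)
  qed (use S_uni in simp)
  have "d / 2 * (1 - z) \<le> T z" if z: "c \<le> z" "z \<le> 1" for z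
  proof (cases "m \<le> z")
    case True
    have "d / 2 * (1 - z) \<le> d * (1 - z)" using d z by (intro mult_right_mono) auto
    then show ?thesis using near[OF True z(2)] by simp
  next
    case False
    have "d / 2 * (1 - z) \<le> d / 2 * (2 * (1 - m))" using d z m by (intro mult_left_mono) auto
    also have "\<dots> = d * (1 - m)" by simp
    also have "\<dots> \<le> T m" using near[of m] m by simp
    also have "\<dots> < T z" using S_decr[of z m] z False m by auto
    finally show ?thesis by simp
  qed
  then show ?thesis using that[of "d / 2"] d by auto
qed

lemma S_max: "0 \<le> z \<Longrightarrow> z \<le> 1 \<Longrightarrow> z \<noteq> c \<Longrightarrow> T z < T c"
  using S_incr[of z c] S_decr[of c z] by (cases "z < c") auto

text \<open>
  Near \<open>c\<close> the height to the power \<open>1 / l\<close> equals \<open>|\<phi> (z - c)|\<close>, and \<open>\<phi>\<close> is differentiable at \<open>0\<close> with nonzero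
  derivative, its inverse being differentiable as well. Away from \<open>c\<close> both sides are bounded and bounded away
  from zero.
\<close>

lemma S_nonflat:
  assumes "nonflat_critical_point T"
  obtains \<alpha> cm cp' where "0 < \<alpha>" "\<alpha> < 1" "0 < cm"
    "\<And>z. 0 \<le> z \<Longrightarrow> z \<le> 1 \<Longrightarrow> cm * (T c - T z) powr \<alpha> \<le> \<bar>z - c\<bar> \<and> \<bar>z - c\<bar> \<le> cp' * (T c - T z) powr \<alpha>"
proof -
  obtain \<phi> l where \<phi>: "C3_diffeomorphism \<phi>" "\<phi> 0 = 0" "1 < l"
    and nf: "\<forall>\<^sub>F x in nhds c. T x = T c - \<bar>\<phi> (x - c)\<bar> powr l"
    using assms unfolding nonflat_critical_point_def by blast
  have bij: "bij \<phi>" and C\<phi>: "Ck_on 3 \<phi> UNIV" "Ck_on 3 (inv \<phi>) UNIV" using \<phi>(1) unfolding C3_diffeomorphism_def by auto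
  have d\<phi>: "(\<phi> has_real_derivative deriv \<phi> 0) (at 0)" using Ck_on_derivs(1)[OF C\<phi>(1), of UNIV 0 0] by simp
  have "(inv \<phi> has_real_derivative deriv (inv \<phi>) 0) (at (\<phi> 0))" using Ck_on_derivs(1)[OF C\<phi>(2), of UNIV 0 0] \<phi>(2) by simp
  from DERIV_chain[OF this d\<phi>] have "(id has_real_derivative deriv (inv \<phi>) 0 * deriv \<phi> 0) (at 0)"
    using inv_o_cancel[OF bij_is_inj[OF bij]] by simp
  then have "deriv (inv \<phi>) 0 * deriv \<phi> 0 = 1" using DERIV_unique[OF _ DERIV_ident] by (auto simp: id_def)
  then have p0: "0 < \<bar>deriv \<phi> 0\<bar>" by auto
  define p where "p = \<bar>deriv \<phi> 0\<bar>"
  have p: "0 < p" using p0 p_def by simp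
  have "((\<lambda>y. \<phi> y / y) \<longlongrightarrow> deriv \<phi> 0) (at 0)" using d\<phi> \<phi>(2) unfolding has_field_derivative_iff by simp
  then have "((\<lambda>y. \<bar>\<phi> y / y\<bar>) \<longlongrightarrow> p) (at 0)" unfolding p_def by (rule tendsto_rabs)
  then have "\<forall>\<^sub>F y in at 0. dist \<bar>\<phi> y / y\<bar> p < p / 2" by (rule tendstoD) (use p in simp)
  then obtain d1 where d1: "0 < d1" "\<And>y. y \<noteq> 0 \<Longrightarrow> \<bar>y\<bar> < d1 \<Longrightarrow> \<bar>\<bar>\<phi> y / y\<bar> - p\<bar> < p / 2"
    unfolding eventually_at by (auto simp: dist_real_def)
  have b1: "p / 2 * \<bar>y\<bar> \<le> \<bar>\<phi> y\<bar> \<and> \<bar>\<phi> y\<bar> \<le> 2 * p * \<bar>y\<bar>" if y: "\<bar>y\<bar> < d1" for y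
  proof (cases "y = 0")
    case False
    have "\<bar>\<phi> y / y\<bar> < 2 * p" "p / 2 < \<bar>\<phi> y / y\<bar>" using d1(2)[OF False y] p by (auto simp: abs_if split: if_splits)
    then show ?thesis using False by (simp add: abs_divide field_simps)
  qed (use \<phi> in simp)
  obtain d2 where d2: "0 < d2" "\<And>x. \<bar>x - c\<bar> < d2 \<Longrightarrow> T x = T c - \<bar>\<phi> (x - c)\<bar> powr l"
    using nf unfolding eventually_nhds_metric by (auto simp: dist_real_def)
  define \<alpha> where "\<alpha> = 1 / l"
  have \<alpha>: "0 < \<alpha>" "\<alpha> < 1" unfolding \<alpha>_def using \<phi>(3) by auto
  define d where "d = min (min d1 d2) (min (c / 2) (1 / 2 - c / 2))"
  have "0 < d" unfolding d_def using d1 d2 cp by simp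
  moreover have "d \<le> d1" "d \<le> d2" "d \<le> c / 2" "d \<le> 1 / 2 - c / 2" unfolding d_def by linarith+
  ultimately have dd: "0 < d" "d \<le> d1" "d \<le> d2" "d \<le> c / 2" "2 * d \<le> 1 - c" by auto
  define h where "h = min (T c - T (c - d)) (T c - T (c + d))"
  have h: "0 < h" unfolding h_def using S_max[of "c - d"] S_max[of "c + d"] dd cp by auto
  have far: "h \<le> T c - T z" if "0 \<le> z" "z \<le> 1" "d \<le> \<bar>z - c\<bar>" for z
  proof (cases "z < c")
    case True
    then have "T z \<le> T (c - d)" using S_incr[of z "c - d"] that dd by (cases "z = c - d") auto
    then show ?thesis unfolding h_def by auto
  next
    case False
    then have "T z \<le> T (c + d)" using S_decr[of "c + d" z] that dd by (cases "z = c + d") auto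
    then show ?thesis unfolding h_def by auto
  qed
  define cm where "cm = min (1 / (2 * p)) d"
  define cq where "cq = max (2 / p) (1 / h powr \<alpha>)"
  have cm: "0 < cm" unfolding cm_def using p dd by simp
  have main: "cm * (T c - T z) powr \<alpha> \<le> \<bar>z - c\<bar> \<and> \<bar>z - c\<bar> \<le> cq * (T c - T z) powr \<alpha>" if z: "0 \<le> z" "z \<le> 1" for z
  proof (cases "\<bar>z - c\<bar> < d")
    case True
    then have "T c - T z = \<bar>\<phi> (z - c)\<bar> powr l" using d2(2)[of z] dd by auto
    then have g: "(T c - T z) powr \<alpha> = \<bar>\<phi> (z - c)\<bar>" unfolding \<alpha>_def using \<phi>(3) by (simp add: powr_powr)
    have b: "p / 2 * \<bar>z - c\<bar> \<le> \<bar>\<phi> (z - c)\<bar>" "\<bar>\<phi> (z - c)\<bar> \<le> 2 * p * \<bar>z - c\<bar>" using b1[of "z - c"] True dd by auto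
    have "cm * \<bar>\<phi> (z - c)\<bar> \<le> 1 / (2 * p) * (2 * p * \<bar>z - c\<bar>)"
      using b cm p by (intro mult_mono) (auto simp: cm_def)
    moreover have "2 / p * (p / 2 * \<bar>z - c\<bar>) \<le> cq * \<bar>\<phi> (z - c)\<bar>"
      using b p by (intro mult_mono) (auto simp: cq_def le_max_iff_disj)
    ultimately show ?thesis unfolding g using p by simp
  next
    case False
    have hz: "h \<le> T c - T z" using far z False by auto
    have T1: "T c - T z \<le> 1" using S_range[of c] S_range[of z] z cp by auto
    have "(T c - T z) powr \<alpha> \<le> 1" using hz h T1 \<alpha> by (intro powr_le1) auto
    then have "cm * (T c - T z) powr \<alpha> \<le> d * 1" using cm dd by (intro mult_mono) (auto simp: cm_def)
    moreover have "\<bar>z - c\<bar> \<le> cq * (T c - T z) powr \<alpha>"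
    proof -
      have hp: "0 < h powr \<alpha>" using h by simp
      have "\<bar>z - c\<bar> \<le> 1" using z cp by auto
      also have "1 = 1 / h powr \<alpha> * h powr \<alpha>" using hp by simp
      also have "\<dots> \<le> cq * (T c - T z) powr \<alpha>"
        using hz h hp \<alpha> by (intro mult_mono powr_mono2) (auto simp: cq_def le_max_iff_disj)
      finally show ?thesis .
    qed
    ultimately show ?thesis using False by auto
  qed
  show ?thesis by (rule that[OF \<alpha> cm main])
qed

end

section \<open>Nonnegative lower Lyapunov exponents\<close>

theorem proposition5p1:
  fixes T :: "real \<Rightarrow> real"
  assumes "S_unimodal T"
    and "nonflat_critical_point T"
    and "\<not> has_periodic_attractor T"
  shows "AE x in lebesgue_on {0..1}. lower_lyapunov T x \<ge> 0"
proof -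
  interpret S: S_unimodal_map T by unfold_locales (rule assms(1))
  define c where "c = critical_point T"
  define T' where "T' = deriv_on {0..1} T"
  note defs = c_def[symmetric] T'_def[symmetric]
  obtain \<sigma> where \<sigma>: "0 < \<sigma>" "\<And>z. c \<le> z \<Longrightarrow> z \<le> 1 \<Longrightarrow> \<sigma> * (1 - z) \<le> T z"
    using S.S_slope_at_1 unfolding defs by blast
  obtain \<alpha> cm cp where nf: "0 < \<alpha>" "\<alpha> < 1" "0 < cm"
    "\<And>z. 0 \<le> z \<Longrightarrow> z \<le> 1 \<Longrightarrow> cm * (T c - T z) powr \<alpha> \<le> \<bar>z - c\<bar> \<and> \<bar>z - c\<bar> \<le> cp * (T c - T z) powr \<alpha>"
    using S.S_nonflat[OF assms(2)] unfolding defs by blast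
  interpret U: smooth_unimodal T c T'
  proof
    show "0 < c" "c < 1" "T' c = 0" using S.cp unfolding defs by auto
    show "T 0 = 0" "T 1 = 0" by (rule S.S_uni)+
    show "continuous_on {0..1} T" by (rule S.S_cont)
    show "0 \<le> T z \<and> T z \<le> 1" if "0 \<le> z" "z \<le> 1" for z by (rule S.S_range[OF that])
    show "T x < T y" if "0 \<le> x" "x < y" "y \<le> c" for x y using S.S_incr[of x y] that unfolding defs by simp
    show "T y < T x" if "c \<le> x" "x < y" "y \<le> 1" for x y using S.S_decr[of x y] that unfolding defs by simp
    show "cross_ratio_le T w x y z" if "0 \<le> w" "w \<le> x" "x \<le> y" "y \<le> z" "z \<le> c" for w x y z
      using S.S_cr_left[of w x y z] that unfolding defs by simp
    show "cross_ratio_le T w x y z" if "c \<le> w" "w \<le> x" "x \<le> y" "y \<le> z" "z \<le> 1" for w x y z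
      using S.S_cr_right[of w x y z] that unfolding defs by simp
    show "(T has_real_derivative T' x) (at x within {0..1})" if "0 \<le> x" "x \<le> 1" for x
      using S.S_deriv[OF that] unfolding defs .
  qed
  interpret smooth_nonflat_trap_free T c \<sigma> \<alpha> cm cp T'
  proof
    show False if "1 \<le> p" "0 \<le> u" "u < v" "v \<le> 1" "U.branch p u v"
      "u \<le> (T ^^ p) u" "(T ^^ p) u \<le> v" "u \<le> (T ^^ p) v" "(T ^^ p) v \<le> v" for p u v
      using U.trap_attractor[OF that] assms(3) by blast
    show "(T ^^ p) c \<noteq> c" if "1 \<le> p" for p
      using U.periodic_critical_point_attractor[OF that] assms(3) by blast
  qed (fact \<sigma> nf)+
  have "AE x in lebesgue. 0 \<le> x \<and> x \<le> 1 \<longrightarrow> 0 \<le> lower_lyapunov T x"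
    by (rule AE_completion[OF AE_lower_lyapunov_nonneg])
  then show ?thesis by (subst AE_restrict_space_iff) auto
qed

end
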